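(* Let $N\ge1$, $\rho\in[0,1)$, $\alpha\in[0,1]$, $q\in(0,1)$, and let $(r_n)_{n\ge0}$ satisfy $0\le r_n<1$ and $\lim_{n\to\infty}n^\gamma r_n=c>0$ for some $\gamma\in(\tfrac12,1]$. Let $Z_n(i)\in[0,1]$ ($i=1,\dots,N$, $n\ge0$) evolve by $Z_{n+1}(i)=(1-r_n)Z_n(i)+r_n(\rho I_{n+1}(i)+(1-\rho)q)$, where, with $\mathcal F_n=\sigma(Z_k(i):\,1\le i\le N,\ 0\le k\le n)$ and $Z_n=\frac1N\sum_{i=1}^N Z_n(i)$, the $I_{n+1}(1),\dots,I_{n+1}(N)\in\{0,1\}$ are conditionally independent given $\mathcal F_n$ with $P(I_{n+1}(i)=1\mid\mathcal F_n)=(1-\alpha)Z_n(i)+\alpha Z_n$. Assume the law of $(Z_0(1),\dots,Z_0(N))$ is permutation invariant, $E[Z_0(i)]=\tfrac12$ and $E[Z_0(1-Z_0)]>0$. Fix $i\in\{1,\dots,N\}$ and set $\beta=1-\rho(1-\alpha)$. (i) If $\tfrac12<\gamma<1$, then \[\Big(n^{\gamma/2}e^{c\beta t}\big(Z_{\lfloor n+n^\gamma t\rfloor}(i)-Z_{\lfloor n+n^\gamma t\rfloor}\big)\Big)_{t\ge0}\xrightarrow{d}(W_{V_t})_{t\ge0},\quad V_t=\Big(1-\frac1N\Big)\frac{c\rho^2q(1-q)}{2\beta}e^{2c\beta t}.\] (ii) If $\gamma=1$ and $2c\beta>1$, then \[\Big(n^{1/2}(1+t)^{c\beta}\big(Z_{\lfloor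 n+nt\rfloor}(i)-Z_{\lfloor n+nt\rfloor}\big)\Big)_{t\ge0}\xrightarrow{d}(W_{V_t})_{t\ge0},\quad V_t=\Big(1-\frac1N\Big)\frac{c^2\rho^2q(1-q)}{2c\beta-1}(1+t)^{2c\beta-1}.\] Here $W$ is a standard Brownian motion and convergence in distribution is with respect to the Skorohod topology on $D[0,+\infty)$. *)

theory Defs
  imports "HOL-Probability.Probability" "HOL-Combinatorics.Permutations"
begin

definition Zbar :: "nat \<Rightarrow> (nat \<Rightarrow> nat \<Rightarrow> 'a \<Rightarrow> real) \<Rightarrow> nat \<Rightarrow> 'a \<Rightarrow> real" where
  "Zbar N Z n \<omega> = (\<Sum>j = 1..N. Z n j \<omega>) / real N"

definition Filt :: "'a measure \<Rightarrow> nat \<Rightarrow> (nat \<Rightarrow> nat \<Rightarrow> 'a \<Rightarrow> real) \<Rightarrow> nat \<Rightarrow> 'a measure" where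
  "Filt M N Z n = sigma (space M)
     {Z k j -` B \<inter> space M | k j B. k \<le> n \<and> j \<in> {1..N} \<and> B \<in> sets borel}"

text \<open>Skorohod space D[0,\<infinity>): cadlag paths on [0,\<infinity>) (values at t<0 are ignored).\<close>
definition cadlag :: "(real \<Rightarrow> real) \<Rightarrow> bool" where
  "cadlag x \<longleftrightarrow> (\<forall>t\<ge>0. (x \<longlongrightarrow> x t) (at_right t)) \<and> (\<forall>t>0. \<exists>l. (x \<longlongrightarrow> l) (at_left t))"

definition time_change :: "(real \<Rightarrow> real) \<Rightarrow> bool" where
  "time_change l \<longleftrightarrow> continuous_on {0..} l \<and> strict_mono_on {0..} l \<and> l ` {0..} = {0..}"

text \<open>Convergence in the Skorohod J1 topology of D[0,\<infinity>)
  (Billingsley, Convergence of Probability Measures, 2nd ed., Thm 16.2).\<close>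
definition sk_converges :: "(nat \<Rightarrow> real \<Rightarrow> real) \<Rightarrow> (real \<Rightarrow> real) \<Rightarrow> bool" where
  "sk_converges xs x \<longleftrightarrow> (\<exists>ls. (\<forall>n. time_change (ls n)) \<and>
      (\<forall>e>0. eventually (\<lambda>n. \<forall>t\<ge>0. \<bar>ls n t - t\<bar> \<le> e) sequentially) \<and>
      (\<forall>m::real. \<forall>e>0. eventually (\<lambda>n. \<forall>t\<in>{0..m}. \<bar>xs n (ls n t) - x t\<bar> \<le> e) sequentially))"

text \<open>Bounded functionals on D[0,\<infinity>) continuous for the Skorohod topology
  (the topology is metrizable, so sequential continuity is continuity).\<close>
definition sk_test :: "((real \<Rightarrow> real) \<Rightarrow> real) \<Rightarrow> bool" where
  "sk_test f \<longleftrightarrow> (\<exists>B. \<forall>x. cadlag x \<longrightarrow> \<bar>f x\<bar> \<le> B) \<and>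
     (\<forall>xs x. cadlag x \<and> (\<forall>n. cadlag (xs n)) \<and> sk_converges xs x \<longrightarrow> (\<lambda>n. f (xs n)) \<longlonglongrightarrow> f x)"

definition sk_conv_dist :: "'a measure \<Rightarrow> (nat \<Rightarrow> 'a \<Rightarrow> real \<Rightarrow> real) \<Rightarrow> 'b measure \<Rightarrow> ('b \<Rightarrow> real \<Rightarrow> real) \<Rightarrow> bool" where
  "sk_conv_dist M X P Y \<longleftrightarrow>
     (\<forall>f. sk_test f \<longrightarrow> (\<lambda>n. \<integral>\<omega>. f (X n \<omega>) \<partial>M) \<longlonglongrightarrow> (\<integral>\<omega>. f (Y \<omega>) \<partial>P))"

definition brownian_motion :: "'b measure \<Rightarrow> (real \<Rightarrow> 'b \<Rightarrow> real) \<Rightarrow> bool" where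
  "brownian_motion P W \<longleftrightarrow> prob_space P \<and>
     (\<forall>t\<ge>0. W t \<in> borel_measurable P) \<and>
     (\<forall>\<omega>\<in>space P. W 0 \<omega> = 0 \<and> continuous_on {0..} (\<lambda>t. W t \<omega>)) \<and>
     (\<forall>s t. 0 \<le> s \<and> s < t \<longrightarrow>
        distributed P lborel (\<lambda>\<omega>. W t \<omega> - W s \<omega>) (normal_density 0 (sqrt (t - s)))) \<and>
     (\<forall>ts::nat \<Rightarrow> real. \<forall>k. 0 \<le> ts 0 \<and> (\<forall>j. ts j \<le> ts (Suc j)) \<longrightarrow>
        prob_space.indep_vars P (\<lambda>_. borel) (\<lambda>j \<omega>. W (ts (Suc j)) \<omega> - W (ts j) \<omega>) {..<k})"

end

theory Submission
  imports Defs "HOL-Real_Asymp.Real_Asymp"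
begin

text \<open>
  Put \<beta> = 1 - \<rho>(1 - \<alpha>) and D(n) = Z(n, i) - Z(n). Then D(n+1) = (1 - \<beta> r(n)) D(n) + \<rho> r(n) \<zeta>(n) with bounded
  martingale differences \<zeta>(n), so D(n) / A(n) is a martingale, where A(n) is the product of 1 - \<beta> r(j) over j < n. All
  Z(n, j) converge to q in mean square, hence the conditional variance of \<zeta>(n) converges in mean to
  (1 - 1/N) q (1 - q). After rescaling, the martingale is compared with a Brownian motion run at the accumulated
  deterministic variance by Lindeberg replacement of its increments one at a time; a fourth moment maximal
  inequality controls the oscillation between grid points. Weak convergence in the Skorohod topology then needs no
  tightness theorem: a bounded continuous functional is the increasing limit of its inf-convolutions with the
  locally uniform metric, which are Lipschitz and therefore depend, up to a small error, only on finitely many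
  coordinates of the path.
\<close>

section \<open>Bounded Lipschitz functions and smoothing\<close>

text \<open>The time scale is the one on which A moves: over n^\<gamma> t steps it shrinks by about
  exp (-c \<beta> t), or (1 + t) powr (-c \<beta>) when \<gamma> = 1, and the weight in the
  statement undoes exactly this factor. What remains is a martingale in units of G(n) =
  n^(\<gamma>/2) A(n). One step multiplies G by about 1 - \<theta> n^(-\<gamma>), with \<theta> = c
  \<beta> for \<gamma> < 1 and \<theta> = c \<beta> - 1/2 for \<gamma> = 1, so 2 c \<beta> > 1 is
  the positivity of \<theta>. This makes the initial deviation disappear and lets G(n)^2 times the
  sum of (r/A)^2 converge, through a linear recursion, to c^2 / (2 \<theta>), the origin of the
  denominators in V. The two regimes are thus instances of one limit theorem with parameters. A
  recurring obstacle is that path functionals come without a sigma-algebra on path space: each time,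
  measurability is obtained by passing through countably many real coordinates.\<close>

definition blip :: "nat \<Rightarrow> ((nat \<Rightarrow> real) \<Rightarrow> real) \<Rightarrow> bool" where
  "blip J h \<longleftrightarrow> (\<exists>B. \<forall>x. \<bar>h x\<bar> \<le> B) \<and> (\<exists>L. \<forall>x y. \<bar>h x - h y\<bar> \<le> L * (\<Sum>j\<le>J. \<bar>x j - y j\<bar>))"

lemma blipI:
  assumes "\<And>x. \<bar>h x\<bar> \<le> B" "\<And>x y. \<bar>h x - h y\<bar> \<le> L * (\<Sum>j\<le>J. \<bar>x j - y j\<bar>)"
  shows "blip J h"
  using assms unfolding blip_def by blast

lemma blipD:
  assumes "blip J h"
  shows "\<exists>B\<ge>0. \<exists>L\<ge>0. (\<forall>x. \<bar>h x\<bar> \<le> B) \<and> (\<forall>x y. \<bar>h x - h y\<bar> \<le> L * (\<Sum>j\<le>J. \<bar>x j - y j\<bar>))"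
proof -
  obtain B L where *: "\<forall>x. \<bar>h x\<bar> \<le> B" "\<forall>x y. \<bar>h x - h y\<bar> \<le> L * (\<Sum>j\<le>J. \<bar>x j - y j\<bar>)"
    using assms unfolding blip_def by blast
  have 1: "L * (\<Sum>j\<le>J. \<bar>x j - y j\<bar>) \<le> \<bar>L\<bar> * (\<Sum>j\<le>J. \<bar>x j - y j\<bar>)" for x y :: "nat \<Rightarrow> real"
    by (intro mult_right_mono sum_nonneg) auto
  have 2: "B \<ge> 0" using *(1)[rule_format, of undefined] by linarith
  have "\<bar>h x - h y\<bar> \<le> \<bar>L\<bar> * (\<Sum>j\<le>J. \<bar>x j - y j\<bar>)" for x y
    using *(2)[rule_format, of x y] 1[of x y] by linarith
  thus ?thesis using 2 *(1) abs_ge_zero by blast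
qed

text \<open>Only finitely many coordinates enter the bound, so continuity holds for the product
  topology on \<open>nat \<Rightarrow> real\<close>. Measurability of a composition then needs only
  measurable coordinates; for this reason test functions take whole sequences as arguments.\<close>

lemma blip_continuous:
  assumes "blip J h" shows "continuous_on UNIV h"
proof -
  obtain B L where L: "B \<ge> 0" "L \<ge> 0" "\<And>x. \<bar>h x\<bar> \<le> B" "\<And>x y. \<bar>h x - h y\<bar> \<le> L * (\<Sum>j\<le>J. \<bar>x j - y j\<bar>)"
    using blipD[OF assms] by blast
  have "(h \<longlongrightarrow> h x) (at x)" for x
  proof -
    have c: "((\<lambda>y::nat\<Rightarrow>real. y j) \<longlongrightarrow> x j) (at x)" for j
    proof -
      have "continuous_on UNIV (\<lambda>y::nat\<Rightarrow>real. y j)" by (rule continuous_on_product_coordinates)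
      thus ?thesis by (simp add: continuous_on_def)
    qed
    have "((\<lambda>y. L * (\<Sum>j\<le>J. \<bar>y j - x j\<bar>)) \<longlongrightarrow> L * (\<Sum>j\<le>J. \<bar>x j - x j\<bar>)) (at x)"
      by (intro tendsto_intros c)
    hence "((\<lambda>y. L * (\<Sum>j\<le>J. \<bar>y j - x j\<bar>)) \<longlongrightarrow> 0) (at x)" by simp
    hence "((\<lambda>y. h y - h x) \<longlongrightarrow> 0) (at x)"
      by (rule Lim_null_comparison[rotated]) (use L(4) in auto)
    thus ?thesis by (simp add: LIM_zero_iff)
  qed
  thus ?thesis by (simp add: continuous_on_def)
qed

lemma blip_measurable:
  assumes "blip J h" "\<And>j. (\<lambda>\<omega>. X \<omega> j) \<in> borel_measurable M"
  shows "(\<lambda>\<omega>. h (X \<omega>)) \<in> borel_measurable M"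
proof -
  have "X \<in> borel_measurable M" using assms(2) by (rule measurable_coordinatewise_then_product)
  moreover have "h \<in> borel_measurable borel"
    using blip_continuous[OF assms(1)] by (rule borel_measurable_continuous_onI)
  ultimately show ?thesis by measurable
qed

lemma (in prob_space) blip_integrable:
  assumes "blip J h" "\<And>j. (\<lambda>\<omega>. X \<omega> j) \<in> borel_measurable M"
  shows "integrable M (\<lambda>\<omega>. h (X \<omega>))"
proof -
  obtain B L where "B \<ge> 0" "L \<ge> 0" "\<And>x. \<bar>h x\<bar> \<le> B" "\<And>x y. \<bar>h x - h y\<bar> \<le> L * (\<Sum>j\<le>J. \<bar>x j - y j\<bar>)"
    using blipD[OF assms(1)] by blast
  thus ?thesis
    by (intro integrable_const_bound[where B=B] AE_I2 blip_measurable[where X=X, OF assms]) auto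
qed

text \<open>Integrability is not assumed: the integral of a non-integrable function is 0 by
  convention, and \<open>B \<ge> 0\<close> covers that case.\<close>

lemma (in prob_space) abs_expectation_le:
  fixes f :: "'a \<Rightarrow> real"
  assumes "\<And>\<omega>. \<omega> \<in> space M \<Longrightarrow> \<bar>f \<omega>\<bar> \<le> B" "B \<ge> 0"
  shows "\<bar>expectation f\<bar> \<le> B"
proof (cases "integrable M f")
  case True
  have "\<bar>expectation f\<bar> \<le> expectation (\<lambda>\<omega>. \<bar>f \<omega>\<bar>)" by (rule integral_abs_bound)
  also have "\<dots> \<le> expectation (\<lambda>\<omega>. B)"
    by (intro integral_mono) (use True assms in auto)
  finally show ?thesis by (simp add: prob_space)
next
  case False thus ?thesis using assms by (simp add: not_integrable_integral_eq)
qed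

text \<open>A shift by \<open>Y \<omega>\<close> changes neither the bound nor the Lipschitz
  constant, so both pass through the integral. The shift will be a point of a segment when
  smoothing, and the future of the Brownian path when replacing increments.\<close>

lemma (in prob_space) blip_average:
  assumes h: "blip J h" and Y: "\<And>j. (\<lambda>\<omega>. Y \<omega> j) \<in> borel_measurable M"
  shows "blip J (\<lambda>x. expectation (\<lambda>\<omega>. h (\<lambda>j. x j + Y \<omega> j)))"
proof -
  obtain B L where B: "B \<ge> 0" "L \<ge> 0" "\<And>x. \<bar>h x\<bar> \<le> B" "\<And>x y. \<bar>h x - h y\<bar> \<le> L * (\<Sum>j\<le>J. \<bar>x j - y j\<bar>)"
    using blipD[OF h] by blast
  have int: "integrable M (\<lambda>\<omega>. h (\<lambda>j. x j + Y \<omega> j))" for x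
    by (rule blip_integrable[OF h]) (use Y in simp)
  show ?thesis
  proof (rule blipI)
    show "\<bar>expectation (\<lambda>\<omega>. h (\<lambda>j. x j + Y \<omega> j))\<bar> \<le> B" for x
      by (rule abs_expectation_le) (use B in auto)
    show "\<bar>expectation (\<lambda>\<omega>. h (\<lambda>j. x j + Y \<omega> j)) - expectation (\<lambda>\<omega>. h (\<lambda>j. y j + Y \<omega> j))\<bar>
      \<le> L * (\<Sum>j\<le>J. \<bar>x j - y j\<bar>)" for x y
    proof -
      have "expectation (\<lambda>\<omega>. h (\<lambda>j. x j + Y \<omega> j)) - expectation (\<lambda>\<omega>. h (\<lambda>j. y j + Y \<omega> j))
        = expectation (\<lambda>\<omega>. h (\<lambda>j. x j + Y \<omega> j) - h (\<lambda>j. y j + Y \<omega> j))"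
        using int by simp
      also have "\<bar>\<dots>\<bar> \<le> L * (\<Sum>j\<le>J. \<bar>x j - y j\<bar>)"
      proof (rule abs_expectation_le)
        fix \<omega>
        show "\<bar>h (\<lambda>j. x j + Y \<omega> j) - h (\<lambda>j. y j + Y \<omega> j)\<bar> \<le> L * (\<Sum>j\<le>J. \<bar>x j - y j\<bar>)"
          using B(4)[of "\<lambda>j. x j + Y \<omega> j" "\<lambda>j. y j + Y \<omega> j"] by simp
      qed (use B(2) in \<open>auto intro!: mult_nonneg_nonneg sum_nonneg\<close>)
      finally show ?thesis .
    qed
  qed
qed

text \<open>Stating the Taylor expansion as an inequality, without mentioning derivatives of h, lets it survive averaging
  without differentiation under the integral sign.\<close>

definition dsmooth :: "nat \<Rightarrow> real \<Rightarrow> (nat \<Rightarrow> real) \<Rightarrow> ((nat \<Rightarrow> real) \<Rightarrow> real) \<Rightarrow>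
    ((nat \<Rightarrow> real) \<Rightarrow> real) \<Rightarrow> ((nat \<Rightarrow> real) \<Rightarrow> real) \<Rightarrow> bool" where
  "dsmooth J C e h h1 h2 \<longleftrightarrow> blip J h \<and> blip J h1 \<and> blip J h2 \<and> (\<forall>x. \<bar>h2 x\<bar> \<le> C) \<and>
     (\<forall>x y. \<bar>h (\<lambda>j. x j + y * e j) - h x - y * h1 x - y\<^sup>2 / 2 * h2 x\<bar> \<le> C * \<bar>y\<bar> ^ 3)"

text \<open>The expansion is linear in h, h1 and h2, so integrating it keeps the same C. Hence
  smoothing along one direction does not spoil smoothness gained along another, and neither does
  integrating out later Brownian steps.\<close>

lemma (in prob_space) dsmooth_average:
  assumes h: "dsmooth J C e h h1 h2" and C: "C \<ge> 0" and Y: "\<And>j. (\<lambda>\<omega>. Y \<omega> j) \<in> borel_measurable M"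
  shows "dsmooth J C e (\<lambda>x. expectation (\<lambda>\<omega>. h (\<lambda>j. x j + Y \<omega> j)))
     (\<lambda>x. expectation (\<lambda>\<omega>. h1 (\<lambda>j. x j + Y \<omega> j))) (\<lambda>x. expectation (\<lambda>\<omega>. h2 (\<lambda>j. x j + Y \<omega> j)))"
proof -
  have b: "blip J h" "blip J h1" "blip J h2" and b2: "\<And>x. \<bar>h2 x\<bar> \<le> C"
    and t: "\<And>x y. \<bar>h (\<lambda>j. x j + y * e j) - h x - y * h1 x - y\<^sup>2 / 2 * h2 x\<bar> \<le> C * \<bar>y\<bar> ^ 3"
    using h unfolding dsmooth_def by blast+
  have int: "integrable M (\<lambda>\<omega>. g (\<lambda>j. x j + Y \<omega> j))" if "blip J g" for g x
    by (rule blip_integrable[OF that]) (use Y in simp)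
  have "\<bar>expectation (\<lambda>\<omega>. h (\<lambda>j. (x j + y * e j) + Y \<omega> j)) - expectation (\<lambda>\<omega>. h (\<lambda>j. x j + Y \<omega> j))
     - y * expectation (\<lambda>\<omega>. h1 (\<lambda>j. x j + Y \<omega> j)) - y\<^sup>2 / 2 * expectation (\<lambda>\<omega>. h2 (\<lambda>j. x j + Y \<omega> j))\<bar> \<le> C * \<bar>y\<bar> ^ 3" for x y
  proof -
    have "expectation (\<lambda>\<omega>. h (\<lambda>j. (x j + y * e j) + Y \<omega> j)) - expectation (\<lambda>\<omega>. h (\<lambda>j. x j + Y \<omega> j))
     - y * expectation (\<lambda>\<omega>. h1 (\<lambda>j. x j + Y \<omega> j)) - y\<^sup>2 / 2 * expectation (\<lambda>\<omega>. h2 (\<lambda>j. x j + Y \<omega> j))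
     = expectation (\<lambda>\<omega>. h (\<lambda>j. (x j + y * e j) + Y \<omega> j) - h (\<lambda>j. x j + Y \<omega> j)
     - y * h1 (\<lambda>j. x j + Y \<omega> j) - y\<^sup>2 / 2 * h2 (\<lambda>j. x j + Y \<omega> j))"
      using int[OF b(1)] int[OF b(2)] int[OF b(3)] by simp
    also have "\<bar>\<dots>\<bar> \<le> C * \<bar>y\<bar> ^ 3"
    proof (rule abs_expectation_le)
      fix \<omega>
      show "\<bar>h (\<lambda>j. (x j + y * e j) + Y \<omega> j) - h (\<lambda>j. x j + Y \<omega> j)
     - y * h1 (\<lambda>j. x j + Y \<omega> j) - y\<^sup>2 / 2 * h2 (\<lambda>j. x j + Y \<omega> j)\<bar> \<le> C * \<bar>y\<bar> ^ 3"
        using t[of "\<lambda>j. x j + Y \<omega> j" y] by (simp add: algebra_simps)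
    qed (use C in auto)
    finally show ?thesis .
  qed
  moreover have "\<bar>expectation (\<lambda>\<omega>. h2 (\<lambda>j. x j + Y \<omega> j))\<bar> \<le> C" for x
    by (rule abs_expectation_le) (use b2 C in auto)
  ultimately show ?thesis unfolding dsmooth_def
    using blip_average[where Y=Y, OF b(1) Y] blip_average[where Y=Y, OF b(2) Y] blip_average[where Y=Y, OF b(3) Y] by blast
qed

text \<open>In the Lagrange form the second derivative is taken at some t with |t| \<le> |y|, and
  moving it to 0 costs K |y|. The resulting bound K |y|^3 / 2 is rounded up.\<close>

lemma Taylor2_Lipschitz:
  fixes G G1 G2 :: "real \<Rightarrow> real"
  assumes "\<And>x. (G has_real_derivative G1 x) (at x)" "\<And>x. (G1 has_real_derivative G2 x) (at x)"
    and K: "\<And>x y. \<bar>G2 x - G2 y\<bar> \<le> K * \<bar>x - y\<bar>"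
  shows "\<bar>G y - G 0 - y * G1 0 - y\<^sup>2 / 2 * G2 0\<bar> \<le> K * \<bar>y\<bar> ^ 3"
proof -
  define d where "d = (\<lambda>m::nat. if m = 0 then G else if m = 1 then G1 else G2)"
  have "\<exists>t. \<bar>t\<bar> \<le> \<bar>y\<bar> \<and> G y = (\<Sum>m<2. d m 0 / fact m * y ^ m) + d 2 t / fact 2 * y ^ 2"
  proof (rule Maclaurin_bi_le)
    show "\<forall>m t. m < 2 \<and> \<bar>t\<bar> \<le> \<bar>y\<bar> \<longrightarrow> (d m has_real_derivative d (Suc m) t) (at t)"
    proof (intro allI impI)
      fix m :: nat and t :: real assume "m < 2 \<and> \<bar>t\<bar> \<le> \<bar>y\<bar>"
      hence "m = 0 \<or> m = 1" by auto
      thus "(d m has_real_derivative d (Suc m) t) (at t)"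
        using assms(1)[of t] assms(2)[of t] by (auto simp: d_def)
    qed
  qed (simp add: d_def)
  then obtain t where t: "\<bar>t\<bar> \<le> \<bar>y\<bar>" and "G y = (\<Sum>m<2. d m 0 / fact m * y ^ m) + d 2 t / fact 2 * y ^ 2"
    by blast
  hence "G y = G 0 + G1 0 * y + G2 t / 2 * y\<^sup>2"
    by (simp add: d_def numeral_2_eq_2)
  hence "G y - G 0 - y * G1 0 - y\<^sup>2 / 2 * G2 0 = y\<^sup>2 / 2 * (G2 t - G2 0)"
    by (simp add: algebra_simps)
  hence "\<bar>G y - G 0 - y * G1 0 - y\<^sup>2 / 2 * G2 0\<bar> = \<bar>y\<^sup>2 / 2 * (G2 t - G2 0)\<bar>" by (rule arg_cong)
  also have "\<dots> = y\<^sup>2 / 2 * \<bar>G2 t - G2 0\<bar>" by (simp add: abs_mult)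
  also have "\<dots> \<le> y\<^sup>2 / 2 * (K * \<bar>y\<bar>)"
  proof (intro mult_left_mono)
    have "K \<ge> 0" using K[of 1 0] by simp
    thus "\<bar>G2 t - G2 0\<bar> \<le> K * \<bar>y\<bar>"
      using K[of t 0] t by (smt (verit) mult_left_mono)
  qed simp
  also have "\<dots> \<le> K * \<bar>y\<bar> ^ 3"
  proof -
    have "K \<ge> 0" using K[of 1 0] by simp
    moreover have "y\<^sup>2 / 2 * (K * \<bar>y\<bar>) = K * \<bar>y\<bar> ^ 3 / 2"
      by (simp add: power3_eq_cube power2_eq_square)
    moreover have "K * \<bar>y\<bar> ^ 3 \<ge> 0" using \<open>K \<ge> 0\<close> by simp
    ultimately show ?thesis by linarith
  qed
  finally show ?thesis .
qed

section \<open>Smoothing by averages over segments\<close>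

definition unit_iv :: "real measure" where "unit_iv = restrict_space lborel {0..1}"

lemma prob_space_unit_iv: "prob_space unit_iv"
  by (rule prob_spaceI) (simp add: unit_iv_def space_restrict_space emeasure_restrict_space)

lemma measurable_unit_iv: "f \<in> borel_measurable borel \<Longrightarrow> f \<in> borel_measurable unit_iv"
  unfolding unit_iv_def by (rule measurable_restrict_space1) simp

text \<open>By substitution the average is (F (x + \<delta>) - F x) / \<delta> for an antiderivative
  F of g. So each averaging gains one derivative, and that derivative is a difference quotient of
  the averaged function.\<close>

lemma has_derivative_box_average:
  fixes g :: "real \<Rightarrow> real"
  assumes g: "continuous_on UNIV g" and d: "\<delta> > 0"
  shows "((\<lambda>x. \<integral>u. g (x + \<delta> * u) \<partial>unit_iv) has_real_derivative (g (x + \<delta>) - g x) / \<delta>) (at x)"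
proof -
  have "\<exists>F. \<forall>x :: real. -\<infinity> < ereal x \<longrightarrow> ereal x < \<infinity> \<longrightarrow> (F has_vector_derivative g x) (at x)"
    by (rule einterval_antiderivative) (use g in \<open>auto simp: continuous_on_eq_continuous_at\<close>)
  then obtain F where F: "\<And>x. (F has_real_derivative g x) (at x)"
    by (auto simp: has_real_derivative_iff_has_vector_derivative)
  have eq: "(\<integral>u. g (x + \<delta> * u) \<partial>unit_iv) = (F (x + \<delta>) - F x) / \<delta>" for x
  proof -
    have c: "continuous_on {0..1} (\<lambda>u. g (x + \<delta> * u))"
      by (rule continuous_on_compose2[OF g]) (auto intro!: continuous_intros)
    have "((\<lambda>u. g (x + \<delta> * u)) has_integral F (x + \<delta> * 1) / \<delta> - F (x + \<delta> * 0) / \<delta>) {0..1}"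
    proof (rule fundamental_theorem_of_calculus)
      fix u :: real
      have "((\<lambda>u. F (x + \<delta> * u) / \<delta>) has_real_derivative g (x + \<delta> * u)) (at u)"
        using d by (auto intro!: derivative_eq_intros DERIV_chain2[OF F])
      thus "((\<lambda>u. F (x + \<delta> * u) / \<delta>) has_vector_derivative g (x + \<delta> * u)) (at u within {0..1})"
        by (simp add: has_real_derivative_iff_has_vector_derivative has_vector_derivative_at_within)
    qed simp
    moreover have "(\<integral>u. g (x + \<delta> * u) \<partial>unit_iv) = integral {0..1} (\<lambda>u. g (x + \<delta> * u))"
      using set_borel_integral_eq_integral(2)[OF borel_integrable_atLeastAtMost'[OF c]]
      unfolding unit_iv_def by (simp add: integral_restrict_space set_lebesgue_integral_def)
    ultimately show ?thesis by (simp add: diff_divide_distrib integral_unique)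
  qed
  have "((\<lambda>x. (F (x + \<delta>) - F x) / \<delta>) has_real_derivative (g (x + \<delta>) - g x) / \<delta>) (at x)"
    using d by (auto intro!: derivative_eq_intros F DERIV_chain2[OF F])
  thus ?thesis by (simp add: eq)
qed

definition dbox :: "real \<Rightarrow> (nat \<Rightarrow> real) \<Rightarrow> ((nat \<Rightarrow> real) \<Rightarrow> real) \<Rightarrow> (nat \<Rightarrow> real) \<Rightarrow> real" where
  "dbox \<delta> e h x = (\<integral>u. h (\<lambda>j. x j + \<delta> * u * e j) \<partial>unit_iv)"

lemma blip_dbox: "blip J h \<Longrightarrow> blip J (dbox \<delta> e h)"
  unfolding dbox_def
  by (rule prob_space.blip_average[OF prob_space_unit_iv]) (auto intro!: measurable_unit_iv)

lemma dsmooth_dbox: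
  assumes "dsmooth J C e h h1 h2" "C \<ge> 0"
  shows "dsmooth J C e (dbox \<delta> d h) (dbox \<delta> d h1) (dbox \<delta> d h2)"
  unfolding dbox_def
  by (rule prob_space.dsmooth_average[OF prob_space_unit_iv assms]) (auto intro!: measurable_unit_iv)

text \<open>The averaged function k may differ from h by b, so that the second of two averagings is
  again measured with the Lipschitz constant of the original h.\<close>

lemma dbox_close:
  assumes k: "blip J k" and b: "\<And>x. \<bar>k x - h x\<bar> \<le> b"
    and L: "\<And>x y. \<bar>h x - h y\<bar> \<le> L * (\<Sum>j\<le>J. \<bar>x j - y j\<bar>)" and "L \<ge> 0" "\<delta> \<ge> 0" "\<And>j. \<bar>e j\<bar> \<le> 1"
  shows "\<bar>dbox \<delta> e k x - h x\<bar> \<le> b + L * (real (Suc J) * \<delta>)"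
proof -
  interpret prob_space unit_iv by (rule prob_space_unit_iv)
  have "integrable unit_iv (\<lambda>u. k (\<lambda>j. x j + \<delta> * u * e j))"
    by (rule blip_integrable[OF k]) (auto intro!: measurable_unit_iv)
  hence "dbox \<delta> e k x - h x = expectation (\<lambda>u. k (\<lambda>j. x j + \<delta> * u * e j) - h x)"
    unfolding dbox_def by (simp add: prob_space)
  also have "\<bar>\<dots>\<bar> \<le> b + L * (real (Suc J) * \<delta>)"
  proof (rule abs_expectation_le)
    fix u assume "u \<in> space unit_iv"
    hence u: "0 \<le> u" "u \<le> 1" by (auto simp: unit_iv_def space_restrict_space)
    have "\<bar>h (\<lambda>j. x j + \<delta> * u * e j) - h x\<bar> \<le> L * (\<Sum>j\<le>J. \<bar>x j + \<delta> * u * e j - x j\<bar>)"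
      by (rule L)
    also have "\<dots> \<le> L * (\<Sum>j\<le>J. \<delta>)"
    proof (intro mult_left_mono sum_mono)
      fix j
      have "\<bar>\<delta> * u * e j\<bar> = \<delta> * (u * \<bar>e j\<bar>)" using assms u by (simp add: abs_mult)
      also have "\<dots> \<le> \<delta> * 1" using assms u by (intro mult_left_mono) (auto simp: mult_le_one)
      finally show "\<bar>x j + \<delta> * u * e j - x j\<bar> \<le> \<delta>" by simp
    qed (use assms in auto)
    finally have "\<bar>h (\<lambda>j. x j + \<delta> * u * e j) - h x\<bar> \<le> L * (real (Suc J) * \<delta>)" by simp
    thus "\<bar>k (\<lambda>j. x j + \<delta> * u * e j) - h x\<bar> \<le> b + L * (real (Suc J) * \<delta>)"
      using b[of "\<lambda>j. x j + \<delta> * u * e j"] by linarith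
  next
    have "b \<ge> 0" using b[of undefined] by linarith
    thus "0 \<le> b + L * (real (Suc J) * \<delta>)" using assms by simp
  qed
  finally show ?thesis .
qed

lemma blip_shift:
  assumes "blip J h" shows "blip J (\<lambda>x. h (\<lambda>j. x j + d j))"
proof -
  obtain B L where B: "\<And>x. \<bar>h x\<bar> \<le> B" "\<And>x y. \<bar>h x - h y\<bar> \<le> L * (\<Sum>j\<le>J. \<bar>x j - y j\<bar>)"
    using blipD[OF assms] by blast
  show ?thesis
  proof (rule blipI)
    show "\<bar>h (\<lambda>j. x j + d j) - h (\<lambda>j. y j + d j)\<bar> \<le> L * (\<Sum>j\<le>J. \<bar>x j - y j\<bar>)" for x y
      using B(2)[of "\<lambda>j. x j + d j" "\<lambda>j. y j + d j"] by simp
  qed (rule B)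
qed

lemma blip_cmult:
  assumes "blip J h" shows "blip J (\<lambda>x. c * h x)"
proof -
  obtain B L where B: "B \<ge> 0" "L \<ge> 0" "\<And>x. \<bar>h x\<bar> \<le> B" "\<And>x y. \<bar>h x - h y\<bar> \<le> L * (\<Sum>j\<le>J. \<bar>x j - y j\<bar>)"
    using blipD[OF assms] by blast
  show ?thesis
  proof (rule blipI)
    show "\<bar>c * h x\<bar> \<le> \<bar>c\<bar> * B" for x by (simp add: abs_mult B mult_left_mono)
    show "\<bar>c * h x - c * h y\<bar> \<le> (\<bar>c\<bar> * L) * (\<Sum>j\<le>J. \<bar>x j - y j\<bar>)" for x y
      using mult_left_mono[OF B(4)[of x y], of "\<bar>c\<bar>"] by (simp add: abs_mult[symmetric] algebra_simps)
  qed
qed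

lemma blip_diff:
  assumes "blip J h" "blip J k" shows "blip J (\<lambda>x. h x - k x)"
proof -
  obtain B L where B: "\<And>x. \<bar>h x\<bar> \<le> B" "\<And>x y. \<bar>h x - h y\<bar> \<le> L * (\<Sum>j\<le>J. \<bar>x j - y j\<bar>)"
    using blipD[OF assms(1)] by blast
  obtain B' L' where B': "\<And>x. \<bar>k x\<bar> \<le> B'" "\<And>x y. \<bar>k x - k y\<bar> \<le> L' * (\<Sum>j\<le>J. \<bar>x j - y j\<bar>)"
    using blipD[OF assms(2)] by blast
  show ?thesis
  proof (rule blipI)
    show "\<bar>h x - k x\<bar> \<le> B + B'" for x using B(1)[of x] B'(1)[of x] by linarith
    show "\<bar>h x - k x - (h y - k y)\<bar> \<le> (L + L') * (\<Sum>j\<le>J. \<bar>x j - y j\<bar>)" for x y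
      using B(2)[of x y] B'(2)[of x y] by (simp add: algebra_simps)
  qed
qed

text \<open>Averaging twice over a segment makes a Lipschitz function twice differentiable along that segment, and the
  second derivative is a difference quotient of h, hence again Lipschitz.\<close>

lemma dsmooth_dbox_dbox:
  assumes h: "blip J h" and d: "\<delta> > 0" and e: "\<And>j. \<bar>e j\<bar> \<le> 1"
  shows "\<exists>C\<ge>0. \<exists>h1 h2. dsmooth J C e (dbox \<delta> e (dbox \<delta> e h)) h1 h2"
proof -
  obtain B L where B: "B \<ge> 0" "L \<ge> 0" "\<And>x. \<bar>h x\<bar> \<le> B" "\<And>x y. \<bar>h x - h y\<bar> \<le> L * (\<Sum>j\<le>J. \<bar>x j - y j\<bar>)"
    using blipD[OF h] by blast
  define h1 where "h1 = (\<lambda>x. inverse \<delta> * (dbox \<delta> e h (\<lambda>j. x j + \<delta> * e j) - dbox \<delta> e h x))"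
  define D where "D = (\<lambda>x. inverse \<delta> * (h (\<lambda>j. x j + \<delta> * e j) - h x))"
  define h2 where "h2 = (\<lambda>x. inverse \<delta> * (D (\<lambda>j. x j + \<delta> * e j) - D x))"
  have bh1: "blip J h1" unfolding h1_def by (intro blip_cmult blip_diff blip_shift blip_dbox h)
  have bD: "blip J D" unfolding D_def by (intro blip_cmult blip_diff blip_shift h)
  have bh2: "blip J h2" unfolding h2_def by (intro blip_cmult blip_diff blip_shift bD)
  obtain B2 L2 where B2: "B2 \<ge> 0" "L2 \<ge> 0" "\<And>x. \<bar>h2 x\<bar> \<le> B2" "\<And>x y. \<bar>h2 x - h2 y\<bar> \<le> L2 * (\<Sum>j\<le>J. \<bar>x j - y j\<bar>)"
    using blipD[OF bh2] by blast
  have lc: "continuous_on UNIV (\<lambda>s::real. k (\<lambda>j. x j + s * e j))" if "blip J k" for k x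
  proof -
    have "continuous_on UNIV (\<lambda>s::real. (\<lambda>j. x j + s * e j))"
      by (rule continuous_on_coordinatewise_then_product) (auto intro!: continuous_intros)
    thus ?thesis by (rule continuous_on_compose2[OF blip_continuous[OF that]]) auto
  qed
  have der: "((\<lambda>s. dbox \<delta> e k (\<lambda>j. x j + s * e j)) has_real_derivative
      inverse \<delta> * (k (\<lambda>j. (x j + s * e j) + \<delta> * e j) - k (\<lambda>j. x j + s * e j))) (at s)" if "blip J k" for k x s
    using has_derivative_box_average[OF lc[OF that, of x] d, of s]
    by (simp add: dbox_def algebra_simps divide_inverse)
  \<comment> \<open>The terms \<open>0 * e j\<close> give the goal the shape \<open>G 0\<close>,
    \<open>G1 0\<close>, \<open>G2 0\<close> of the Taylor lemma along the line x + s e.\<close>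
  have "\<bar>dbox \<delta> e (dbox \<delta> e h) (\<lambda>j. x j + y * e j) - dbox \<delta> e (dbox \<delta> e h) (\<lambda>j. x j + 0 * e j) - y * h1 (\<lambda>j. x j + 0 * e j)
     - y\<^sup>2 / 2 * h2 (\<lambda>j. x j + 0 * e j)\<bar> \<le> (L2 * real (Suc J)) * \<bar>y\<bar> ^ 3" for x y
  proof (rule Taylor2_Lipschitz[where G = "\<lambda>s. dbox \<delta> e (dbox \<delta> e h) (\<lambda>j. x j + s * e j)"
        and ?G1.0 = "\<lambda>s. h1 (\<lambda>j. x j + s * e j)" and ?G2.0 = "\<lambda>s. h2 (\<lambda>j. x j + s * e j)"])
    fix s
    show "((\<lambda>s. dbox \<delta> e (dbox \<delta> e h) (\<lambda>j. x j + s * e j)) has_real_derivative h1 (\<lambda>j. x j + s * e j)) (at s)"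
      unfolding h1_def by (rule der[OF blip_dbox[OF h]])
    have "((\<lambda>s. dbox \<delta> e h (\<lambda>j. (x j + \<delta> * e j) + s * e j)) has_real_derivative
      D (\<lambda>j. (x j + \<delta> * e j) + s * e j)) (at s)"
      unfolding D_def by (rule der[OF h])
    moreover have "((\<lambda>s. dbox \<delta> e h (\<lambda>j. x j + s * e j)) has_real_derivative D (\<lambda>j. x j + s * e j)) (at s)"
      unfolding D_def by (rule der[OF h])
    ultimately show "((\<lambda>s. h1 (\<lambda>j. x j + s * e j)) has_real_derivative h2 (\<lambda>j. x j + s * e j)) (at s)"
      unfolding h1_def h2_def by (intro DERIV_cmult DERIV_diff) (simp_all add: algebra_simps)
  next
    fix s t
    have "\<bar>h2 (\<lambda>j. x j + s * e j) - h2 (\<lambda>j. x j + t * e j)\<bar> \<le> L2 * (\<Sum>j\<le>J. \<bar>(x j + s * e j) - (x j + t * e j)\<bar>)"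
      by (rule B2)
    also have "\<dots> \<le> L2 * (\<Sum>j\<le>J. \<bar>s - t\<bar>)"
    proof (intro mult_left_mono sum_mono)
      fix j
      have "\<bar>(x j + s * e j) - (x j + t * e j)\<bar> = \<bar>s - t\<bar> * \<bar>e j\<bar>"
        by (simp add: abs_mult[symmetric] algebra_simps)
      also have "\<dots> \<le> \<bar>s - t\<bar> * 1" by (intro mult_left_mono e) auto
      finally show "\<bar>(x j + s * e j) - (x j + t * e j)\<bar> \<le> \<bar>s - t\<bar>" by simp
    qed (rule B2)
    finally show "\<bar>h2 (\<lambda>j. x j + s * e j) - h2 (\<lambda>j. x j + t * e j)\<bar> \<le> L2 * real (Suc J) * \<bar>s - t\<bar>"
      by (simp add: algebra_simps)
  qed
  hence t: "\<bar>dbox \<delta> e (dbox \<delta> e h) (\<lambda>j. x j + y * e j) - dbox \<delta> e (dbox \<delta> e h) x - y * h1 x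
     - y\<^sup>2 / 2 * h2 x\<bar> \<le> (L2 * real (Suc J)) * \<bar>y\<bar> ^ 3" for x y by simp
  \<comment> \<open>One constant has to serve both as bound of \<open>h2\<close> and as factor of
    the cubic remainder.\<close>
  define C where "C = B2 + L2 * real (Suc J)"
  have C: "B2 \<le> C" "L2 * real (Suc J) \<le> C" "C \<ge> 0" using B2 unfolding C_def by (auto simp: add_nonneg_nonneg)
  have "dsmooth J C e (dbox \<delta> e (dbox \<delta> e h)) h1 h2"
    unfolding dsmooth_def
  proof (intro conjI allI)
    show "\<bar>h2 x\<bar> \<le> C" for x using B2(3)[of x] C by linarith
    show "\<bar>dbox \<delta> e (dbox \<delta> e h) (\<lambda>j. x j + y * e j) - dbox \<delta> e (dbox \<delta> e h) x - y * h1 x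
     - y\<^sup>2 / 2 * h2 x\<bar> \<le> C * \<bar>y\<bar> ^ 3" for x y
      using t[of x y] mult_right_mono[OF C(2), of "\<bar>y\<bar>^3"] by (meson order_trans zero_le_power abs_ge_zero)
  qed (intro blip_dbox h bh1 bh2)+
  thus ?thesis using C by blast
qed

lemma dsmooth_mono:
  assumes "dsmooth J C e h h1 h2" "C \<le> C'" shows "dsmooth J C' e h h1 h2"
proof -
  have "C * \<bar>y\<bar> ^ 3 \<le> C' * \<bar>y\<bar> ^ 3" for y :: real by (intro mult_right_mono assms) simp
  thus ?thesis using assms unfolding dsmooth_def by (meson order_trans)
qed

text \<open>Directions are treated one after another: averaging twice along \<open>e m\<close>
  creates smoothness there, and \<open>dsmooth_dbox\<close> preserves it along the earlier ones. The
  budget is \<epsilon>/2 for the earlier directions and \<epsilon>/4 for each of the two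
  averagings.\<close>

lemma smooth_approximation:
  assumes h: "blip J h" and e: "\<And>i j. \<bar>e i j\<bar> \<le> 1" and "\<epsilon> > 0"
  shows "\<exists>h'. blip J h' \<and> (\<forall>x. \<bar>h' x - h x\<bar> \<le> \<epsilon>) \<and> (\<exists>C\<ge>0. \<forall>i<(m::nat). \<exists>h1 h2. dsmooth J C (e i) h' h1 h2)"
  using \<open>\<epsilon> > 0\<close>
proof (induction m arbitrary: \<epsilon>)
  case 0
  show ?case by (rule exI[of _ h]) (use h 0 in auto)
next
  case (Suc m)
  have "\<epsilon> / 2 > 0" using Suc.prems by simp
  from Suc.IH[OF this] obtain g C where g: "blip J g" "\<And>x. \<bar>g x - h x\<bar> \<le> \<epsilon> / 2" "C \<ge> 0"
      "\<And>i. i < m \<Longrightarrow> \<exists>h1 h2. dsmooth J C (e i) g h1 h2"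
    by blast
  obtain L where L: "L \<ge> 0" "\<And>x y. \<bar>g x - g y\<bar> \<le> L * (\<Sum>j\<le>J. \<bar>x j - y j\<bar>)"
    using blipD[OF g(1)] by blast
  \<comment> \<open>\<open>L + 1\<close> instead of \<open>L\<close> keeps the denominator of
    \<delta> positive when \<open>L = 0\<close>.\<close>
  define P where "P = (L + 1) * real (Suc J)"
  have P: "P > 0" using L(1) unfolding P_def by simp
  define \<delta> where "\<delta> = \<epsilon> / (4 * P)"
  have d: "\<delta> > 0" using Suc.prems P unfolding \<delta>_def by simp
  have "L * (real (Suc J) * \<delta>) \<le> (L + 1) * (real (Suc J) * \<delta>)" using d by (intro mult_right_mono) auto
  also have "\<dots> = P * \<delta>" by (simp add: P_def)
  also have "\<dots> = \<epsilon> / 4" using P unfolding \<delta>_def by simp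
  finally have Ld: "L * (real (Suc J) * \<delta>) \<le> \<epsilon> / 4" .
  define k where "k = dbox \<delta> (e m) (dbox \<delta> (e m) g)"
  have "\<bar>dbox \<delta> (e m) g x - g x\<bar> \<le> 0 + L * (real (Suc J) * \<delta>)" for x
    by (rule dbox_close[OF g(1)]) (use L d e in auto)
  hence c1: "\<bar>dbox \<delta> (e m) g x - g x\<bar> \<le> \<epsilon> / 4" for x by (rule order_trans) (use Ld in simp)
  have c2: "\<bar>k x - g x\<bar> \<le> \<epsilon> / 4 + L * (real (Suc J) * \<delta>)" for x
    unfolding k_def by (rule dbox_close[OF blip_dbox[OF g(1)] c1]) (use L d e in auto)
  have kc: "\<bar>k x - h x\<bar> \<le> \<epsilon>" for x using Ld g(2)[of x] c2[of x] by linarith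
  obtain C' h1 h2 where C': "C' \<ge> 0" "dsmooth J C' (e m) k h1 h2"
    using dsmooth_dbox_dbox[where e="e m", OF g(1) d e] unfolding k_def by blast
  have "\<exists>h1 h2. dsmooth J (max C C') (e i) k h1 h2" if "i < Suc m" for i
  proof (cases "i = m")
    case True thus ?thesis using dsmooth_mono[OF C'(2)] by (meson max.cobounded2)
  next
    case False
    with that obtain h1 h2 where "dsmooth J C (e i) g h1 h2" using g(4)[of i] by auto
    from dsmooth_dbox[OF dsmooth_dbox[OF this g(3)] g(3)]
    have "dsmooth J (max C C') (e i) k (dbox \<delta> (e m) (dbox \<delta> (e m) h1)) (dbox \<delta> (e m) (dbox \<delta> (e m) h2))"
      unfolding k_def by (rule dsmooth_mono) simp
    thus ?thesis by blast
  qed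
  moreover have "blip J k" unfolding k_def by (intro blip_dbox g)
  moreover have "max C C' \<ge> 0" using C'(1) by simp
  ultimately show ?case using kc by blast
qed

section \<open>Lindeberg replacement by a Brownian motion\<close>

text \<open>Applied to the martingale increment and to the Brownian increment alike: both turn into
  the same second order expression, so in their difference only errors survive. Independence of X
  and \<xi> is replaced by zero correlation of \<xi> with \<open>h1 (X)\<close> and small
  correlation of \<xi>^2 - v with \<open>h2 (X)\<close>.\<close>

lemma (in prob_space) taylor_swap:
  assumes ds: "dsmooth J C e h h1 h2" and C: "C \<ge> 0"
    and X: "\<And>j. (\<lambda>\<omega>. X \<omega> j) \<in> borel_measurable M" and \<xi>: "\<xi> \<in> borel_measurable M"
    and i1: "integrable M \<xi>" and i2: "integrable M (\<lambda>\<omega>. (\<xi> \<omega>)\<^sup>2)" and i3: "integrable M (\<lambda>\<omega>. \<bar>\<xi> \<omega>\<bar> ^ 3)"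
    and m1: "expectation (\<lambda>\<omega>. h1 (X \<omega>) * \<xi> \<omega>) = 0"
    and m2: "\<bar>expectation (\<lambda>\<omega>. h2 (X \<omega>) * ((\<xi> \<omega>)\<^sup>2 - v))\<bar> \<le> k"
  shows "\<bar>expectation (\<lambda>\<omega>. h (\<lambda>j. X \<omega> j + \<xi> \<omega> * e j)) - expectation (\<lambda>\<omega>. h (X \<omega>)) - v / 2 * expectation (\<lambda>\<omega>. h2 (X \<omega>))\<bar>
    \<le> C * expectation (\<lambda>\<omega>. \<bar>\<xi> \<omega>\<bar> ^ 3) + k"
proof -
  have b: "blip J h" "blip J h1" "blip J h2"
    and t: "\<And>x y. \<bar>h (\<lambda>j. x j + y * e j) - h x - y * h1 x - y\<^sup>2 / 2 * h2 x\<bar> \<le> C * \<bar>y\<bar> ^ 3"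
    using ds unfolding dsmooth_def by blast+
  have ih: "integrable M (\<lambda>\<omega>. h (\<lambda>j. X \<omega> j + \<xi> \<omega> * e j))"
    by (rule blip_integrable[OF b(1)]) (use X \<xi> in measurable)
  have iX: "integrable M (\<lambda>\<omega>. g (X \<omega>))" if "blip J g" for g
    by (rule blip_integrable[OF that X])
  have ig: "integrable M (\<lambda>\<omega>. g (X \<omega>) * f \<omega>)" if g: "blip J g" and f: "integrable M f" for g and f :: "'a \<Rightarrow> real"
  proof -
    obtain B where B: "\<And>x. \<bar>g x\<bar> \<le> B" using blipD[OF g] by blast
    have [measurable]: "(\<lambda>\<omega>. g (X \<omega>)) \<in> borel_measurable M" by (rule blip_measurable[OF g X])
    show ?thesis
    proof (rule Bochner_Integration.integrable_bound)
      show "integrable M (\<lambda>\<omega>. B * f \<omega>)" using f by simp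
      show "(\<lambda>\<omega>. g (X \<omega>) * f \<omega>) \<in> borel_measurable M" using f by measurable
      have "\<bar>g x\<bar> * \<bar>f \<omega>\<bar> \<le> \<bar>B\<bar> * \<bar>f \<omega>\<bar>" for x \<omega>
        using B[of x] by (intro mult_right_mono) auto
      thus "AE \<omega> in M. norm (g (X \<omega>) * f \<omega>) \<le> norm (B * f \<omega>)"
        by (simp add: abs_mult)
    qed
  qed
  define R where "R = (\<lambda>\<omega>. h (\<lambda>j. X \<omega> j + \<xi> \<omega> * e j) - h (X \<omega>) - h1 (X \<omega>) * \<xi> \<omega> - h2 (X \<omega>) * (\<xi> \<omega>)\<^sup>2 / 2)"
  have "expectation R = expectation (\<lambda>\<omega>. h (\<lambda>j. X \<omega> j + \<xi> \<omega> * e j)) - expectation (\<lambda>\<omega>. h (X \<omega>))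
     - expectation (\<lambda>\<omega>. h2 (X \<omega>) * (\<xi> \<omega>)\<^sup>2) / 2"
    unfolding R_def using ih iX[OF b(1)] ig[OF b(2) i1] ig[OF b(3) i2] m1 by simp
  moreover have "expectation (\<lambda>\<omega>. h2 (X \<omega>) * ((\<xi> \<omega>)\<^sup>2 - v)) = expectation (\<lambda>\<omega>. h2 (X \<omega>) * (\<xi> \<omega>)\<^sup>2) - v * expectation (\<lambda>\<omega>. h2 (X \<omega>))"
    using ig[OF b(3) i2] iX[OF b(3)] by (simp add: algebra_simps)
  moreover have "\<bar>expectation R\<bar> \<le> C * expectation (\<lambda>\<omega>. \<bar>\<xi> \<omega>\<bar> ^ 3)"
  proof -
    have iR: "integrable M R" unfolding R_def using ih iX[OF b(1)] ig[OF b(2) i1] ig[OF b(3) i2] by simp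
    have "\<bar>expectation R\<bar> \<le> expectation (\<lambda>\<omega>. \<bar>R \<omega>\<bar>)" by (rule integral_abs_bound)
    also have "\<dots> \<le> expectation (\<lambda>\<omega>. C * \<bar>\<xi> \<omega>\<bar> ^ 3)"
      by (rule integral_mono) (use iR i3 t[of "X _" "\<xi> _"] in \<open>auto simp: R_def algebra_simps\<close>)
    finally show ?thesis by simp
  qed
  moreover have "k \<ge> 0" using m2 by linarith
  ultimately show ?thesis using m2 by (simp add: field_simps)
qed

lemma normal_moments:
  assumes "prob_space P" and X: "distributed P lborel X (normal_density 0 \<sigma>)" and s: "\<sigma> > 0"
  shows "integrable P X" "integrable P (\<lambda>\<omega>. (X \<omega>)\<^sup>2)" "integrable P (\<lambda>\<omega>. \<bar>X \<omega>\<bar> ^ 3)"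
    "(\<integral>\<omega>. X \<omega> \<partial>P) = 0" "(\<integral>\<omega>. (X \<omega>)\<^sup>2 \<partial>P) = \<sigma>\<^sup>2" "(\<integral>\<omega>. \<bar>X \<omega>\<bar> ^ 3 \<partial>P) \<le> 2 * \<sigma> ^ 3"
proof -
  have nn: "\<And>x. x \<in> space lborel \<Longrightarrow> 0 \<le> normal_density 0 \<sigma> x" by simp
  note di = distributed_integrable[OF X _ nn] and de = distributed_integral[OF X _ nn]
  show "integrable P X" using di[of "\<lambda>x. x"] integrable_normal_moment[OF s, of 0 1] by simp
  show "integrable P (\<lambda>\<omega>. (X \<omega>)\<^sup>2)" using di[of "\<lambda>x. x\<^sup>2"] integrable_normal_moment[OF s, of 0 2] by simp
  show "integrable P (\<lambda>\<omega>. \<bar>X \<omega>\<bar> ^ 3)" using di[of "\<lambda>x. \<bar>x\<bar>^3"] integrable_normal_moment_abs[OF s, of 0 3] by simp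
  show "(\<integral>\<omega>. X \<omega> \<partial>P) = 0" using de[of "\<lambda>x. x"] integral_normal_moment_odd[OF s, of 0 0] by simp
  show "(\<integral>\<omega>. (X \<omega>)\<^sup>2 \<partial>P) = \<sigma>\<^sup>2" using de[of "\<lambda>x. x\<^sup>2"] integral_normal_moment_even[OF s, of 0 1] by simp
  have "(\<integral>\<omega>. \<bar>X \<omega>\<bar> ^ 3 \<partial>P) = 2 * \<sigma> ^ 3 * sqrt (2 / pi)"
    using de[of "\<lambda>x. \<bar>x\<bar>^3"] integral_normal_moment_abs_odd[OF s, of 0 1] by simp
  also have "\<dots> \<le> 2 * \<sigma> ^ 3 * 1"
    using s pi_gt3 by (intro mult_left_mono) auto
  finally show "(\<integral>\<omega>. \<bar>X \<omega>\<bar> ^ 3 \<partial>P) \<le> 2 * \<sigma> ^ 3" by simp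
qed

text \<open>The definition of Brownian motion gives a density only for s < t. The degenerate case is
  included because the variances of single steps may vanish.\<close>

lemma brownian_increment:
  assumes W: "brownian_motion P W" and st: "0 \<le> s" "s \<le> t"
  shows "integrable P (\<lambda>\<omega>. W t \<omega> - W s \<omega>)" "integrable P (\<lambda>\<omega>. (W t \<omega> - W s \<omega>)\<^sup>2)" "integrable P (\<lambda>\<omega>. \<bar>W t \<omega> - W s \<omega>\<bar> ^ 3)"
    "(\<integral>\<omega>. W t \<omega> - W s \<omega> \<partial>P) = 0" "(\<integral>\<omega>. (W t \<omega> - W s \<omega>)\<^sup>2 \<partial>P) = t - s" "(\<integral>\<omega>. \<bar>W t \<omega> - W s \<omega>\<bar> ^ 3 \<partial>P) \<le> 2 * sqrt (t - s) ^ 3"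
proof -
  have P: "prob_space P" using W unfolding brownian_motion_def by blast
  have "integrable P (\<lambda>\<omega>. W t \<omega> - W s \<omega>) \<and> integrable P (\<lambda>\<omega>. (W t \<omega> - W s \<omega>)\<^sup>2) \<and> integrable P (\<lambda>\<omega>. \<bar>W t \<omega> - W s \<omega>\<bar> ^ 3) \<and>
    (\<integral>\<omega>. W t \<omega> - W s \<omega> \<partial>P) = 0 \<and> (\<integral>\<omega>. (W t \<omega> - W s \<omega>)\<^sup>2 \<partial>P) = t - s \<and> (\<integral>\<omega>. \<bar>W t \<omega> - W s \<omega>\<bar> ^ 3 \<partial>P) \<le> 2 * sqrt (t - s) ^ 3"
  proof (cases "s = t")
    case False
    hence "distributed P lborel (\<lambda>\<omega>. W t \<omega> - W s \<omega>) (normal_density 0 (sqrt (t - s)))" "sqrt (t - s) > 0"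
      using W st unfolding brownian_motion_def by auto
    from normal_moments[OF P this] st show ?thesis by simp
  qed simp
  thus "integrable P (\<lambda>\<omega>. W t \<omega> - W s \<omega>)" "integrable P (\<lambda>\<omega>. (W t \<omega> - W s \<omega>)\<^sup>2)" "integrable P (\<lambda>\<omega>. \<bar>W t \<omega> - W s \<omega>\<bar> ^ 3)"
    "(\<integral>\<omega>. W t \<omega> - W s \<omega> \<partial>P) = 0" "(\<integral>\<omega>. (W t \<omega> - W s \<omega>)\<^sup>2 \<partial>P) = t - s" "(\<integral>\<omega>. \<bar>W t \<omega> - W s \<omega>\<bar> ^ 3 \<partial>P) \<le> 2 * sqrt (t - s) ^ 3"
    by blast+
qed

text \<open>Y is built from Brownian increments after step k and \<eta> is the increment of step k,
  so the expectations factor and the centred factor gives 0.\<close>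

lemma brownian_increment_indep:
  fixes k :: nat
  assumes W: "brownian_motion P W" and \<tau>: "mono \<tau>" "0 \<le> \<tau> (0::nat)"
    and \<kappa>: "\<And>j. \<kappa> j \<le> (m::nat)" and g: "blip J g"
  defines "Y \<equiv> \<lambda>\<omega> j. W (\<tau> (max (\<kappa> j) (Suc k))) \<omega> - W (\<tau> (Suc k)) \<omega>"
    and "\<eta> \<equiv> \<lambda>\<omega>. W (\<tau> (Suc k)) \<omega> - W (\<tau> k) \<omega>"
  shows "(\<integral>\<omega>. g (Y \<omega>) * \<eta> \<omega> \<partial>P) = 0"
    "(\<integral>\<omega>. g (Y \<omega>) * ((\<eta> \<omega>)\<^sup>2 - (\<tau> (Suc k) - \<tau> k)) \<partial>P) = 0"
proof -
  interpret prob_space P using W unfolding brownian_motion_def by blast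
  have \<tau>0: "0 \<le> \<tau> i" for i using \<tau>(2) monoD[OF \<tau>(1), of 0 i] by simp
  have Wm[measurable]: "W (\<tau> i) \<in> borel_measurable P" for i
    using W \<tau>0 unfolding brownian_motion_def by blast
  \<comment> \<open>Times are shifted by k, so that \<open>D 0\<close> is \<eta> and every
    coordinate of Y is a sum of \<open>D i\<close> with i \<ge> 1.\<close>
  define D where "D = (\<lambda>i \<omega>. W (\<tau> (k + Suc i)) \<omega> - W (\<tau> (k + i)) \<omega>)"
  define n where "n = Suc (m + 2)"
  have ind: "indep_vars (\<lambda>_. borel) D {..<n}"
  proof -
    have "\<forall>ts::nat \<Rightarrow> real. \<forall>n. 0 \<le> ts 0 \<and> (\<forall>j. ts j \<le> ts (Suc j)) \<longrightarrow>
        indep_vars (\<lambda>_. borel) (\<lambda>j \<omega>. W (ts (Suc j)) \<omega> - W (ts j) \<omega>) {..<n}"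
      using W unfolding brownian_motion_def by (elim conjE)
    from this[rule_format, of "\<lambda>i. \<tau> (k + i)" n] show ?thesis
      unfolding D_def using \<tau>0 \<tau>(1) by (simp add: monoD)
  qed
  \<comment> \<open>For \<open>\<kappa> j \<le> Suc k\<close> the sum is empty, in agreement with
    \<open>Y \<omega> j = 0\<close>.\<close>
  define S where "S = (\<lambda>(f :: nat \<Rightarrow> real) j. \<Sum>i = 1..<max (\<kappa> j) (Suc k) - k. f i)"
  have Yeq: "Y \<omega> = S (\<lambda>i\<in>{1..<n}. D i \<omega>)" for \<omega>
  proof
    fix j
    have sub: "{1..<max (\<kappa> j) (Suc k) - k} \<subseteq> {1..<n}" using \<kappa>[of j] unfolding n_def by auto
    have "S (\<lambda>i\<in>{1..<n}. D i \<omega>) j = (\<Sum>i = 1..<max (\<kappa> j) (Suc k) - k. D i \<omega>)"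
      unfolding S_def by (rule sum.cong) (use sub in auto)
    also have "\<dots> = W (\<tau> (k + (max (\<kappa> j) (Suc k) - k))) \<omega> - W (\<tau> (k + 1)) \<omega>"
      unfolding D_def by (rule sum_Suc_diff') auto
    also have "\<dots> = Y \<omega> j" unfolding Y_def by simp
    finally show "Y \<omega> j = S (\<lambda>i\<in>{1..<n}. D i \<omega>) j" ..
  qed
  have Sm: "(\<lambda>f. g (S f)) \<in> borel_measurable (PiM {1..<n} (\<lambda>_. borel))"
  proof (rule blip_measurable[OF g])
    fix j
    have sub: "{1..<max (\<kappa> j) (Suc k) - k} \<subseteq> {1..<n}" using \<kappa>[of j] unfolding n_def by auto
    show "(\<lambda>f. S f j) \<in> borel_measurable (PiM {1..<n} (\<lambda>_. borel))"
      unfolding S_def using sub by (intro borel_measurable_sum measurable_component_singleton) auto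
  qed
  have gY: "integrable P (\<lambda>\<omega>. g (Y \<omega>))"
    by (rule blip_integrable[OF g]) (simp add: Y_def)
  have prod: "expectation (\<lambda>\<omega>. g (Y \<omega>) * f (\<eta> \<omega>)) = expectation (\<lambda>\<omega>. g (Y \<omega>)) * expectation (\<lambda>\<omega>. f (\<eta> \<omega>))"
     "integrable P (\<lambda>\<omega>. g (Y \<omega>) * f (\<eta> \<omega>))"
    if f: "f \<in> borel_measurable borel" "integrable P (\<lambda>\<omega>. f (\<eta> \<omega>))" for f :: "real \<Rightarrow> real"
  proof -
    have "indep_var (PiM {1..<n} (\<lambda>_. borel)) (\<lambda>\<omega>. \<lambda>i\<in>{1..<n}. D i \<omega>) (PiM {0} (\<lambda>_. borel)) (\<lambda>\<omega>. \<lambda>i\<in>{0}. D i \<omega>)"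
      by (rule indep_var_restrict[OF ind]) (auto simp: n_def)
    hence "indep_var borel ((\<lambda>f. g (S f)) \<circ> (\<lambda>\<omega>. \<lambda>i\<in>{1..<n}. D i \<omega>)) borel ((\<lambda>x. f (x 0)) \<circ> (\<lambda>\<omega>. \<lambda>i\<in>{0}. D i \<omega>))"
    proof (rule indep_var_compose[OF _ Sm])
      show "(\<lambda>x. f (x 0)) \<in> borel_measurable (Pi\<^sub>M {0} (\<lambda>_. borel))"
        using f(1) by (rule measurable_compose[rotated]) (rule measurable_component_singleton, simp)
    qed
    moreover have "((\<lambda>f. g (S f)) \<circ> (\<lambda>\<omega>. \<lambda>i\<in>{1..<n}. D i \<omega>)) = (\<lambda>\<omega>. g (Y \<omega>))" by (auto simp: Yeq)
    moreover have "((\<lambda>x. f (x 0)) \<circ> (\<lambda>\<omega>. \<lambda>i\<in>{0}. D i \<omega>)) = (\<lambda>\<omega>. f (\<eta> \<omega>))" by (auto simp: D_def \<eta>_def)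
    ultimately have "indep_var borel (\<lambda>\<omega>. g (Y \<omega>)) borel (\<lambda>\<omega>. f (\<eta> \<omega>))" by simp
    from indep_var_lebesgue_integral[OF this gY f(2)] indep_var_integrable[OF this gY f(2)]
    show "expectation (\<lambda>\<omega>. g (Y \<omega>) * f (\<eta> \<omega>)) = expectation (\<lambda>\<omega>. g (Y \<omega>)) * expectation (\<lambda>\<omega>. f (\<eta> \<omega>))"
     "integrable P (\<lambda>\<omega>. g (Y \<omega>) * f (\<eta> \<omega>))" by auto
  qed
  have m: "0 \<le> \<tau> k" "\<tau> k \<le> \<tau> (Suc k)" using \<tau>0 \<tau>(1) by (auto intro: monoD)
  note bi = brownian_increment[OF W m, folded \<eta>_def]
  show "(\<integral>\<omega>. g (Y \<omega>) * \<eta> \<omega> \<partial>P) = 0" using prod(1)[of "\<lambda>x. x"] bi by (simp add: \<eta>_def)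
  have i2: "integrable P (\<lambda>\<omega>. (\<eta> \<omega>)\<^sup>2)" using bi(2) unfolding \<eta>_def .
  have "(\<integral>\<omega>. g (Y \<omega>) * ((\<eta> \<omega>)\<^sup>2 - (\<tau> (Suc k) - \<tau> k)) \<partial>P)
    = expectation (\<lambda>\<omega>. g (Y \<omega>)) * expectation (\<lambda>\<omega>. (\<eta> \<omega>)\<^sup>2 - (\<tau> (Suc k) - \<tau> k))"
    by (rule prod(1)[of "\<lambda>x. x\<^sup>2 - (\<tau> (Suc k) - \<tau> k)"]) (use i2 in auto)
  also have "expectation (\<lambda>\<omega>. (\<eta> \<omega>)\<^sup>2 - (\<tau> (Suc k) - \<tau> k)) = 0"
    using i2 bi(5) by (simp add: prob_space \<eta>_def)
  finally show "(\<integral>\<omega>. g (Y \<omega>) * ((\<eta> \<omega>)\<^sup>2 - (\<tau> (Suc k) - \<tau> k)) \<partial>P) = 0" by simp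
qed

text \<open>Increment k moves coordinate j exactly when \<open>k < \<kappa> j\<close>; by
  monotonicity these j form a final segment, so h has to be smooth only along indicators of final
  segments. In the error, \<open>d k\<close> accounts for the conditional variance,
  \<open>b k ^ 3\<close> for the third moment of the martingale step and
  \<open>2 * sqrt (v k) ^ 3\<close> for that of the Gaussian step.\<close>

lemma (in prob_space) lindeberg_replacement:
  fixes \<xi> :: "nat \<Rightarrow> 'a \<Rightarrow> real" and \<kappa> :: "nat \<Rightarrow> nat"
  assumes W: "brownian_motion P W"
    and \<xi>[measurable]: "\<And>k. \<xi> k \<in> borel_measurable M" and b: "\<And>k \<omega>. \<omega> \<in> space M \<Longrightarrow> \<bar>\<xi> k \<omega>\<bar> \<le> b k"
    and v: "\<And>k. v k \<ge> 0" and \<kappa>: "mono \<kappa>" "\<And>j. \<kappa> j \<le> \<kappa> (J::nat)"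
    and m1: "\<And>k g. k < \<kappa> J \<Longrightarrow> blip J g \<Longrightarrow> expectation (\<lambda>\<omega>. g (\<lambda>j. \<Sum>l<min k (\<kappa> j). \<xi> l \<omega>) * \<xi> k \<omega>) = 0"
    and m2: "\<And>k g B. k < \<kappa> J \<Longrightarrow> blip J g \<Longrightarrow> (\<And>x. \<bar>g x\<bar> \<le> B) \<Longrightarrow>
      \<bar>expectation (\<lambda>\<omega>. g (\<lambda>j. \<Sum>l<min k (\<kappa> j). \<xi> l \<omega>) * ((\<xi> k \<omega>)\<^sup>2 - v k))\<bar> \<le> B * d k"
    and C: "C \<ge> 0" and h: "blip J h" "\<And>i. i \<le> J \<Longrightarrow> \<exists>h1 h2. dsmooth J C (\<lambda>j. if i \<le> j then 1 else 0) h h1 h2"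
  shows "\<bar>expectation (\<lambda>\<omega>. h (\<lambda>j. \<Sum>l<\<kappa> j. \<xi> l \<omega>)) - (\<integral>\<omega>. h (\<lambda>j. W (\<Sum>l<\<kappa> j. v l) \<omega>) \<partial>P)\<bar>
    \<le> C * (\<Sum>k<\<kappa> J. d k + b k ^ 3 + 2 * sqrt (v k) ^ 3)"
proof -
  interpret P: prob_space P using W unfolding brownian_motion_def by blast
  define \<tau> where "\<tau> = (\<lambda>k::nat. \<Sum>l<k. v l)"
  have \<tau>: "mono \<tau>" "0 \<le> \<tau> 0" "\<tau> 0 = 0" "\<tau> (Suc k) - \<tau> k = v k" for k
    unfolding \<tau>_def by (auto intro!: monoI sum_mono2 v)
  have \<tau>0: "0 \<le> \<tau> i" for i using \<tau>(2) monoD[OF \<tau>(1), of 0 i] by simp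
  have Wm[measurable]: "W (\<tau> i) \<in> borel_measurable P" for i
    using W \<tau>0 unfolding brownian_motion_def by blast
  have W0: "W (\<tau> 0) \<omega> = 0" if "\<omega> \<in> space P" for \<omega>
    using W that unfolding brownian_motion_def \<tau>(3) by blast
  define X where "X = (\<lambda>k \<omega> j. \<Sum>l<min k (\<kappa> j). \<xi> l \<omega>)"
  have Xm: "(\<lambda>\<omega>. X k \<omega> j) \<in> borel_measurable M" for k j unfolding X_def by measurable
  \<comment> \<open>The first k steps come from the martingale, the later ones from the Brownian motion. Using iterated
    integrals keeps the two sources independent without constructing a product space.\<close>
  define Q where "Q = (\<lambda>k. expectation (\<lambda>\<omega>. \<integral>\<omega>'. h (\<lambda>j. X k \<omega> j + (W (\<tau> (max (\<kappa> j) k)) \<omega>' - W (\<tau> k) \<omega>')) \<partial>P))"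
  have step: "\<bar>Q (Suc k) - Q k\<bar> \<le> C * (d k + b k ^ 3 + 2 * sqrt (v k) ^ 3)" if k: "k < \<kappa> J" for k
  proof -
    \<comment> \<open>The first coordinate moved by increment k; it is at most J because
      \<open>k < \<kappa> J\<close>.\<close>
    define i where "i = (LEAST j. k < \<kappa> j)"
    have i: "k < \<kappa> i" "i \<le> J" unfolding i_def using k by (auto intro: LeastI Least_le)
    have ieq: "i \<le> j \<longleftrightarrow> k < \<kappa> j" for j
    proof
      assume "i \<le> j" thus "k < \<kappa> j" using i(1) monoD[OF \<kappa>(1), of i j] by linarith
    next
      assume "k < \<kappa> j" thus "i \<le> j" unfolding i_def by (rule Least_le)
    qed
    define e where "e = (\<lambda>j. if i \<le> j then 1 else 0 :: real)"
    obtain h1 h2 where ds: "dsmooth J C e h h1 h2" using h(2)[OF i(2)] unfolding e_def by blast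
    have bl: "blip J h1" "blip J h2" "\<And>x. \<bar>h2 x\<bar> \<le> C" using ds unfolding dsmooth_def by blast+
    define Y where "Y = (\<lambda>\<omega> j. W (\<tau> (max (\<kappa> j) (Suc k))) \<omega> - W (\<tau> (Suc k)) \<omega>)"
    define \<eta> where "\<eta> = (\<lambda>\<omega>. W (\<tau> (Suc k)) \<omega> - W (\<tau> k) \<omega>)"
    have Ym[measurable]: "(\<lambda>\<omega>. Y \<omega> j) \<in> borel_measurable P" for j unfolding Y_def by measurable
    have \<eta>m[measurable]: "\<eta> \<in> borel_measurable P" unfolding \<eta>_def by measurable
    have "0 \<le> \<tau> k" "\<tau> k \<le> \<tau> (Suc k)" using \<tau>0 \<tau>(1) by (auto intro: monoD)
    note bi = brownian_increment[OF W this]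
    note ii = brownian_increment_indep[where \<kappa>=\<kappa> and m="\<kappa> J" and k=k, OF W \<tau>(1,2) \<kappa>(2)]
    \<comment> \<open>\<open>H\<close> integrates out the Brownian steps after k, \<open>q\<close>
      those from k on. Both \<open>Q k\<close> and \<open>Q (Suc k)\<close> are expanded around
      \<open>H h (X k)\<close>, where the terms \<open>v k / 2 * H h2 (X k)\<close> cancel.\<close>
    define H where "H = (\<lambda>(g :: (nat \<Rightarrow> real) \<Rightarrow> real) x. \<integral>\<omega>. g (\<lambda>j. x j + Y \<omega> j) \<partial>P)"
    define q where "q = (\<lambda>x. \<integral>\<omega>. h (\<lambda>j. x j + (Y \<omega> j + \<eta> \<omega> * e j)) \<partial>P)"
    have dsH: "dsmooth J C e (H h) (H h1) (H h2)"
      unfolding H_def by (rule P.dsmooth_average[OF ds C Ym])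
    have blq: "blip J q" unfolding q_def by (rule P.blip_average[OF h(1)]) measurable
    have qd: "\<bar>q x - H h x - v k / 2 * H h2 x\<bar> \<le> C * (2 * sqrt (v k) ^ 3)" for x
    proof -
      have "\<bar>P.expectation (\<lambda>\<omega>. h (\<lambda>j. (Y \<omega> j + x j) + \<eta> \<omega> * e j)) - P.expectation (\<lambda>\<omega>. h (\<lambda>j. Y \<omega> j + x j))
         - v k / 2 * P.expectation (\<lambda>\<omega>. h2 (\<lambda>j. Y \<omega> j + x j))\<bar>
        \<le> C * P.expectation (\<lambda>\<omega>. \<bar>\<eta> \<omega>\<bar> ^ 3) + 0"
      proof (rule P.taylor_swap[OF ds C])
        show "P.expectation (\<lambda>\<omega>. h1 (\<lambda>j. Y \<omega> j + x j) * \<eta> \<omega>) = 0"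
          using ii(1)[OF blip_shift[OF bl(1), of x]] unfolding Y_def \<eta>_def .
        show "\<bar>P.expectation (\<lambda>\<omega>. h2 (\<lambda>j. Y \<omega> j + x j) * ((\<eta> \<omega>)\<^sup>2 - v k))\<bar> \<le> 0"
          using ii(2)[OF blip_shift[OF bl(2), of x]] unfolding Y_def \<eta>_def \<tau>(4) by simp
      qed (use bi in \<open>auto simp: \<eta>_def\<close>)
      also have "\<dots> \<le> C * (2 * sqrt (v k) ^ 3)"
        using bi(6) \<tau>(4)[of k] C by (simp add: mult_left_mono \<eta>_def)
      finally show ?thesis by (simp add: q_def H_def add.commute add.left_commute)
    qed
    have blH: "blip J (H h)" "blip J (H h2)" and H2C: "\<And>x. \<bar>H h2 x\<bar> \<le> C" using dsH unfolding dsmooth_def by blast+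
    have XS: "X (Suc k) \<omega> = (\<lambda>j. X k \<omega> j + \<xi> k \<omega> * e j)" for \<omega>
    proof
      fix j show "X (Suc k) \<omega> j = X k \<omega> j + \<xi> k \<omega> * e j"
        using ieq[of j] unfolding X_def e_def by (cases "k < \<kappa> j") (auto simp: min_def)
    qed
    have Q1: "Q (Suc k) = expectation (\<lambda>\<omega>. H h (\<lambda>j. X k \<omega> j + \<xi> k \<omega> * e j))"
      unfolding Q_def H_def Y_def XS ..
    have Q0: "Q k = expectation (\<lambda>\<omega>. q (X k \<omega>))"
    proof -
      have "W (\<tau> (max (\<kappa> j) k)) \<omega>' - W (\<tau> k) \<omega>' = Y \<omega>' j + \<eta> \<omega>' * e j" for j \<omega>'
        using ieq[of j] unfolding Y_def \<eta>_def e_def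
        by (cases "k < \<kappa> j") (auto simp: max_def not_less le_Suc_eq)
      thus ?thesis unfolding Q_def q_def by simp
    qed
    have iq: "integrable M (\<lambda>\<omega>. g (X k \<omega>))" if "blip J g" for g by (rule blip_integrable[OF that Xm])
    have "\<bar>expectation (\<lambda>\<omega>. q (X k \<omega>) - H h (X k \<omega>) - v k / 2 * H h2 (X k \<omega>))\<bar> \<le> C * (2 * sqrt (v k) ^ 3)"
      by (rule abs_expectation_le) (use qd C v in auto)
    hence A: "\<bar>Q k - expectation (\<lambda>\<omega>. H h (X k \<omega>)) - v k / 2 * expectation (\<lambda>\<omega>. H h2 (X k \<omega>))\<bar> \<le> C * (2 * sqrt (v k) ^ 3)"
      unfolding Q0 using iq[OF blq] iq[OF blH(1)] iq[OF blH(2)] by simp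
    have bb: "integrable M (\<lambda>\<omega>. f (\<xi> k \<omega>))" if "f \<in> borel_measurable borel" "\<And>x. \<bar>x\<bar> \<le> b k \<Longrightarrow> \<bar>f x\<bar> \<le> c"
      for f :: "real \<Rightarrow> real" and c
    proof (rule integrable_const_bound[where B=c])
      show "AE x in M. norm (f (\<xi> k x)) \<le> c" using that(2) b by (intro AE_I2) auto
      show "(\<lambda>x. f (\<xi> k x)) \<in> borel_measurable M" using that(1) by measurable
    qed
    have i3: "integrable M (\<lambda>\<omega>. \<bar>\<xi> k \<omega>\<bar> ^ 3)"
      by (rule bb[of "\<lambda>x. \<bar>x\<bar>^3" "b k ^ 3"]) (auto intro: power_mono)
    have i2: "integrable M (\<lambda>\<omega>. (\<xi> k \<omega>)\<^sup>2)"
      by (rule bb[of "\<lambda>x. x\<^sup>2" "(b k)\<^sup>2"]) (auto intro: abs_le_square_iff[THEN iffD1])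
    have i1: "integrable M (\<xi> k)"
      by (rule bb[of "\<lambda>x. x" "b k"]) auto
    have B: "\<bar>expectation (\<lambda>\<omega>. H h (\<lambda>j. X k \<omega> j + \<xi> k \<omega> * e j)) - expectation (\<lambda>\<omega>. H h (X k \<omega>)) - v k / 2 * expectation (\<lambda>\<omega>. H h2 (X k \<omega>))\<bar>
      \<le> C * expectation (\<lambda>\<omega>. \<bar>\<xi> k \<omega>\<bar> ^ 3) + C * d k"
    proof (rule taylor_swap[OF dsH C Xm \<xi> i1 i2 i3])
      show "expectation (\<lambda>\<omega>. H h1 (X k \<omega>) * \<xi> k \<omega>) = 0"
        unfolding X_def by (rule m1[OF k]) (use dsH in \<open>auto simp: dsmooth_def\<close>)
      show "\<bar>expectation (\<lambda>\<omega>. H h2 (X k \<omega>) * ((\<xi> k \<omega>)\<^sup>2 - v k))\<bar> \<le> C * d k"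
        unfolding X_def by (rule m2[OF k blH(2) H2C])
    qed
    have "expectation (\<lambda>\<omega>. \<bar>\<xi> k \<omega>\<bar> ^ 3) \<le> expectation (\<lambda>\<omega>. b k ^ 3)"
      by (rule integral_mono) (use i3 b in \<open>auto intro: power_mono\<close>)
    hence "C * expectation (\<lambda>\<omega>. \<bar>\<xi> k \<omega>\<bar> ^ 3) \<le> C * b k ^ 3" using C by (simp add: prob_space mult_left_mono)
    thus ?thesis using A B unfolding Q1 by (simp add: algebra_simps)
  qed
  have tel: "\<bar>Q n - Q 0\<bar> \<le> C * (\<Sum>k<n. d k + b k ^ 3 + 2 * sqrt (v k) ^ 3)" if "n \<le> \<kappa> J" for n
    using that
  proof (induction n)
    case (Suc n)
    thus ?case using step[of n] by (simp add: algebra_simps)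
  qed simp
  \<comment> \<open>At \<open>\<kappa> J\<close> nothing Brownian is left, at 0 nothing of the
    martingale; there \<open>W 0 = 0\<close> enters.\<close>
  have "Q (\<kappa> J) = expectation (\<lambda>\<omega>. h (\<lambda>j. \<Sum>l<\<kappa> j. \<xi> l \<omega>))"
    unfolding Q_def X_def using \<kappa>(2) by (simp add: max_absorb2 min_absorb2 P.prob_space)
  moreover have "Q 0 = (\<integral>\<omega>. h (\<lambda>j. W (\<tau> (\<kappa> j)) \<omega>) \<partial>P)"
    unfolding Q_def X_def by (simp add: prob_space W0 cong: Bochner_Integration.integral_cong)
  ultimately show ?thesis using tel[of "\<kappa> J"] unfolding \<tau>_def by simp
qed

section \<open>A criterion for weak convergence in the Skorohod space\<close>

text \<open>Taking the infimum over admissible \<delta>, instead of summing suprema over [0, m], avoids having to know that cadlag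
  paths are locally bounded.\<close>

definition ludist :: "(real \<Rightarrow> real) \<Rightarrow> (real \<Rightarrow> real) \<Rightarrow> real" where
  "ludist x y = Inf {\<delta>. \<delta> > 0 \<and> (\<delta> < 1 \<longrightarrow> (\<forall>t\<in>{0..1/\<delta>}. \<bar>x t - y t\<bar> \<le> \<delta>))}"

lemma bdd_below_pos:
  shows "bdd_below {\<delta>::real. \<delta> > 0 \<and> P \<delta>}"
  by (rule bdd_belowI[of _ 0]) auto

lemma ludist_le:
  assumes "\<delta> > 0" "\<And>t. 0 \<le> t \<Longrightarrow> t \<le> 1/\<delta> \<Longrightarrow> \<bar>x t - y t\<bar> \<le> \<delta>"
  shows "ludist x y \<le> \<delta>"
  unfolding ludist_def by (rule cInf_lower[OF _ bdd_below_pos]) (use assms in auto)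

lemma ludist_le_one: "ludist x y \<le> 1"
  unfolding ludist_def by (rule cInf_lower[OF _ bdd_below_pos]) auto

lemma ludist_nonneg: "0 \<le> ludist x y"
  unfolding ludist_def by (rule cInf_greatest) (auto intro!: exI[of _ 1])

lemma ludist_le_sup:
  assumes "\<And>t. 0 \<le> t \<Longrightarrow> \<bar>x t - y t\<bar> \<le> a"
  shows "ludist x y \<le> a"
proof (rule field_le_epsilon)
  fix e :: real assume "e > 0"
  moreover have "a \<ge> 0" using assms[of 0] by simp
  ultimately show "ludist x y \<le> a + e"
    using assms by (intro ludist_le) (auto intro: order_trans[OF assms])
qed

lemma ludist_self: "ludist x x = 0"
  using ludist_le_sup[of x x 0] ludist_nonneg[of x x] by simp

lemma ludist_commute: "ludist x y = ludist y x"
  unfolding ludist_def by (simp add: abs_minus_commute)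

lemma ludist_less_imp:
  assumes "ludist x y < \<delta>" "\<delta> \<le> 1" "0 \<le> t" "t \<le> 1/\<delta>"
  shows "\<bar>x t - y t\<bar> \<le> \<delta>"
proof -
  have "{\<delta>. \<delta> > 0 \<and> (\<delta> < 1 \<longrightarrow> (\<forall>t\<in>{0..1/\<delta>}. \<bar>x t - y t\<bar> \<le> \<delta>))} \<noteq> {}" by (auto intro!: exI[of _ 1])
  from cInf_lessD[OF this assms(1)[unfolded ludist_def]]
  obtain d where d: "d > 0" "d < \<delta>" "\<And>t. d < 1 \<Longrightarrow> t \<in> {0..1/d} \<Longrightarrow> \<bar>x t - y t\<bar> \<le> d" by blast
  have "1/\<delta> \<le> 1/d" using d by (simp add: frac_le)
  hence "\<bar>x t - y t\<bar> \<le> d" using d(2) assms by (intro d(3)) auto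
  thus ?thesis using d by simp
qed

text \<open>The window up to 1/(a + b) lies in the windows up to 1/a and 1/b. If a + b \<ge> 1, the
  cap of the distance at 1 settles the claim.\<close>

lemma ludist_triangle: "ludist x z \<le> ludist x y + ludist y z"
proof (rule field_le_epsilon)
  fix e :: real assume e: "e > 0"
  define a where "a = ludist x y + e/2"
  define b where "b = ludist y z + e/2"
  have ab: "a > 0" "b > 0" using e ludist_nonneg[of x y] ludist_nonneg[of y z] unfolding a_def b_def by auto
  have "ludist x z \<le> a + b"
  proof (cases "a + b < 1")
    case True
    show ?thesis
    proof (rule ludist_le)
      fix t assume t: "0 \<le> t" "t \<le> 1/(a+b)"
      have "1/(a+b) \<le> 1/a" "1/(a+b) \<le> 1/b" using ab by (auto simp: frac_le)
      hence "t \<le> 1/a" "t \<le> 1/b" using t by linarith+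
      moreover have "ludist x y < a" "ludist y z < b" using e unfolding a_def b_def by auto
      ultimately have "\<bar>x t - y t\<bar> \<le> a" "\<bar>y t - z t\<bar> \<le> b"
        using t True ab by (auto intro: ludist_less_imp[of x y a t] ludist_less_imp[of y z b t])
      thus "\<bar>x t - z t\<bar> \<le> a + b" by linarith
    qed (use ab in simp)
  next
    case False thus ?thesis using ludist_le_one[of x z] by linarith
  qed
  thus "ludist x z \<le> ludist x y + ludist y z + e" unfolding a_def b_def by simp
qed

text \<open>Identity time changes suffice. Hence a Skorohod continuous functional is continuous for
  the finer locally uniform topology, and the metric \<open>ludist\<close> can stand in for a
  Skorohod metric.\<close>

lemma sk_converges_locally_uniformly:
  assumes "\<And>m e. e > 0 \<Longrightarrow> \<forall>\<^sub>F n in sequentially. \<forall>t\<in>{0..m}. \<bar>xs n t - x t\<bar> \<le> e"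
  shows "sk_converges xs x"
  unfolding sk_converges_def
proof (intro exI[of _ "\<lambda>_ t. t"] conjI allI impI)
  show "time_change (\<lambda>t. t)" unfolding time_change_def by (auto simp: strict_mono_on_def)
qed (use assms in auto)

lemma sk_converges_ludist:
  assumes "(\<lambda>n. ludist (xs n) x) \<longlonglongrightarrow> 0"
  shows "sk_converges xs x"
proof (rule sk_converges_locally_uniformly)
  fix m e :: real assume e: "e > 0"
  obtain m' where m': "m' \<ge> 1" "m \<le> m'" using max.cobounded1 max.cobounded2 by blast
  define d where "d = min 1 (min e (1 / m'))"
  have d: "d > 0" "d \<le> 1" "d \<le> e" using e m' unfolding d_def by auto
  have "m \<le> 1/d"
  proof -
    have "d \<le> 1 / m'" unfolding d_def by auto
    hence "m' \<le> 1/d" using d m' by (simp add: field_simps)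
    thus ?thesis using m'(2) by (rule order_trans[rotated])
  qed
  have "\<forall>\<^sub>F n in sequentially. ludist (xs n) x < d" using assms d(1) by (rule order_tendstoD)
  thus "\<forall>\<^sub>F n in sequentially. \<forall>t\<in>{0..m}. \<bar>xs n t - x t\<bar> \<le> e"
  proof eventually_elim
    case (elim n)
    show ?case
    proof
      fix t assume "t \<in> {0..m}"
      hence "\<bar>xs n t - x t\<bar> \<le> d" using \<open>m \<le> 1/d\<close> by (intro ludist_less_imp[OF elim d(2)]) auto
      thus "\<bar>xs n t - x t\<bar> \<le> e" using d by simp
    qed
  qed
qed

text \<open>Inf-convolution: Lipschitz minorants increasing to the bounded continuous functional f. They are
  defined on all functions, so that discretised paths need not be checked to be cadlag.\<close>

definition infconv :: "((real \<Rightarrow> real) \<Rightarrow> real) \<Rightarrow> real \<Rightarrow> (real \<Rightarrow> real) \<Rightarrow> real" where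
  "infconv f L x = (INF y\<in>{y. cadlag y}. f y + L * ludist x y)"

lemma cadlag_const: "cadlag (\<lambda>_. a)"
  unfolding cadlag_def by auto

lemma sk_test_bound:
  assumes "sk_test f" obtains B where "B \<ge> 0" "\<And>x. cadlag x \<Longrightarrow> \<bar>f x\<bar> \<le> B"
proof -
  from assms obtain B where B: "\<And>x. cadlag x \<Longrightarrow> \<bar>f x\<bar> \<le> B" unfolding sk_test_def by blast
  have "B \<ge> 0" using B[OF cadlag_const[of 0]] by linarith
  thus ?thesis using B that by blast
qed

context
  fixes f :: "(real \<Rightarrow> real) \<Rightarrow> real" and B :: real
  assumes f: "sk_test f" and B: "\<And>x. cadlag x \<Longrightarrow> \<bar>f x\<bar> \<le> B"
begin

lemma infconv_bdd: "L \<ge> 0 \<Longrightarrow> bdd_below ((\<lambda>y. f y + L * ludist x y) ` {y. cadlag y})"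
  by (rule bdd_belowI2[of _ "-B"]) (use B ludist_nonneg in \<open>fastforce intro: add_increasing2 simp: abs_le_iff\<close>)

lemma infconv_lower: "L \<ge> 0 \<Longrightarrow> cadlag y \<Longrightarrow> infconv f L x \<le> f y + L * ludist x y"
  unfolding infconv_def by (rule cINF_lower[OF infconv_bdd]) auto

lemma infconv_le: "L \<ge> 0 \<Longrightarrow> cadlag x \<Longrightarrow> infconv f L x \<le> f x"
  using infconv_lower[of L x x] by (simp add: ludist_self)

lemma infconv_greatest: "(\<And>y. cadlag y \<Longrightarrow> a \<le> f y + L * ludist x y) \<Longrightarrow> a \<le> infconv f L x"
  unfolding infconv_def using cadlag_const by (intro cINF_greatest) auto

lemma infconv_ge: "L \<ge> 0 \<Longrightarrow> - B \<le> infconv f L x"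
  by (rule infconv_greatest) (use B ludist_nonneg in \<open>fastforce intro: add_increasing2 simp: abs_le_iff\<close>)

lemma infconv_upper:
  assumes "L \<ge> 0" shows "infconv f L x \<le> B + L"
proof -
  have "L * ludist x (\<lambda>_. 0) \<le> L * 1" by (intro mult_left_mono ludist_le_one assms)
  thus ?thesis using infconv_lower[OF assms cadlag_const[of 0], of x] B[OF cadlag_const[of 0]] by linarith
qed

lemma infconv_Lipschitz:
  assumes "L \<ge> 0" shows "infconv f L x \<le> infconv f L x' + L * ludist x x'"
proof -
  have "infconv f L x - L * ludist x x' \<le> infconv f L x'"
  proof (rule infconv_greatest)
    fix y assume "cadlag y"
    have "L * ludist x y \<le> L * (ludist x x' + ludist x' y)" by (intro mult_left_mono ludist_triangle assms)
    thus "infconv f L x - L * ludist x x' \<le> f y + L * ludist x' y"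
      using infconv_lower[OF assms \<open>cadlag y\<close>, of x] by (simp add: algebra_simps)
  qed
  thus ?thesis by simp
qed

text \<open>A near-minimiser \<open>ys n\<close> pays n times its distance to x, while its total
  cost stays bounded. So the distance is at most (2 B + 1)/n, and continuity of f at x finishes. The
  slack 1/(n + 1) is there because the infimum need not be attained.\<close>

lemma infconv_tendsto:
  assumes x: "cadlag x"
  shows "(\<lambda>n. infconv f (real n) x) \<longlonglongrightarrow> f x"
proof -
  have "\<exists>y. cadlag y \<and> f y + real n * ludist x y < infconv f (real n) x + 1 / (real n + 1)" for n
  proof (rule ccontr)
    assume "\<not> ?thesis"
    hence "infconv f (real n) x + 1 / (real n + 1) \<le> infconv f (real n) x"
      by (intro infconv_greatest) (auto simp: not_less)
    moreover have "1 / (real n + 1) > 0" by simp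
    ultimately show False by linarith
  qed
  then obtain ys where ys: "\<And>n. cadlag (ys n)" "\<And>n. f (ys n) + real n * ludist x (ys n) < infconv f (real n) x + 1 / (real n + 1)"
    by metis
  have "ludist (ys n) x \<le> (2 * B + 1) / real n" if "n \<ge> 1" for n
  proof -
    have "1 / (real n + 1) \<le> 1" by simp
    hence "real n * ludist x (ys n) \<le> 2 * B + 1"
      using ys(2)[of n] infconv_le[of "real n", OF _ x] abs_le_D1[OF B[OF x]] abs_le_D2[OF B[OF ys(1)[of n]]]
      by linarith
    thus ?thesis using that by (simp add: field_simps ludist_commute)
  qed
  moreover have "(\<lambda>n. (2 * B + 1) / real n) \<longlonglongrightarrow> 0" by (rule lim_const_over_n)
  ultimately have "(\<lambda>n. ludist (ys n) x) \<longlonglongrightarrow> 0"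
    using ludist_nonneg
    by (intro real_tendsto_sandwich[where f="\<lambda>_. 0" and h="\<lambda>n. (2 * B + 1) / real n" and g="\<lambda>n. ludist (ys n) x"]
        eventually_sequentiallyI[of 1] tendsto_const) blast+
  hence "sk_converges ys x" by (rule sk_converges_ludist)
  moreover have "\<forall>xs x. cadlag x \<and> (\<forall>n. cadlag (xs n)) \<and> sk_converges xs x \<longrightarrow> (\<lambda>n. f (xs n)) \<longlonglongrightarrow> f x"
    using f unfolding sk_test_def by (elim conjE)
  ultimately have "(\<lambda>n. f (ys n)) \<longlonglongrightarrow> f x" using x ys(1) by simp
  moreover have "(\<lambda>n. 1 / (real n + 1)) \<longlonglongrightarrow> 0" using LIMSEQ_inverse_real_of_nat by (simp add: divide_inverse add.commute)
  ultimately have "(\<lambda>n. f (ys n) - 1 / (real n + 1)) \<longlonglongrightarrow> f x - 0" by (rule tendsto_diff)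
  moreover have "f (ys n) - 1 / (real n + 1) \<le> infconv f (real n) x" for n
    using ys(2)[of n] ludist_nonneg[of x "ys n"] mult_nonneg_nonneg[of "real n" "ludist x (ys n)"] by linarith
  moreover have "infconv f (real n) x \<le> f x" for n by (rule infconv_le) (auto simp: x)
  ultimately show ?thesis
    by (intro real_tendsto_sandwich[where f="\<lambda>n. f (ys n) - 1 / (real n + 1)" and h="\<lambda>_. f x" and g="\<lambda>n. infconv f (real n) x"]
        always_eventually tendsto_const allI) (simp, blast, simp)
qed

end

section \<open>Discretisation of paths\<close>

definition steps :: "nat \<Rightarrow> nat \<Rightarrow> (nat \<Rightarrow> real) \<Rightarrow> real \<Rightarrow> real" where
  "steps K J z t = z (min (nat \<lfloor>real K * t\<rfloor>) J)"

lemma ludist_steps: "ludist (steps K J z) (steps K J z') \<le> (\<Sum>j\<le>J. \<bar>z j - z' j\<bar>)"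
  by (rule ludist_le_sup) (auto simp: steps_def intro!: member_le_sum[where f="\<lambda>j. \<bar>z j - z' j\<bar>"])

text \<open>A step path frozen at \<open>z J\<close> takes only the values z 0, ..., z J, so it
  depends on the sequence in a Lipschitz way even for a distance that looks at unbounded time
  windows. A path functional thereby becomes a finite-dimensional test function.\<close>

lemma blip_infconv_steps:
  assumes "sk_test f" "L \<ge> 0"
  shows "blip J (\<lambda>z. infconv f L (steps K J z))"
proof -
  obtain B where B: "B \<ge> 0" "\<And>x. cadlag x \<Longrightarrow> \<bar>f x\<bar> \<le> B" using sk_test_bound[OF assms(1)] by blast
  note ic = infconv_ge[OF assms(1) B(2)] infconv_upper[OF assms(1) B(2)] infconv_Lipschitz[OF assms(1) B(2) assms(2)]
  show ?thesis
  proof (rule blipI)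
    show "\<bar>infconv f L (steps K J z)\<bar> \<le> B + L" for z
      using ic(1,2)[OF _ assms(2), of "steps K J z"] assms(2) B by (auto simp: abs_le_iff)
    fix z z'
    have "L * ludist (steps K J z) (steps K J z') \<le> L * (\<Sum>j\<le>J. \<bar>z j - z' j\<bar>)"
      by (intro mult_left_mono ludist_steps assms)
    thus "\<bar>infconv f L (steps K J z) - infconv f L (steps K J z')\<bar> \<le> L * (\<Sum>j\<le>J. \<bar>z j - z' j\<bar>)"
      using ic(3)[of "steps K J z" "steps K J z'"] ic(3)[of "steps K J z'" "steps K J z"]
      by (simp add: ludist_commute abs_le_iff) 
  qed
qed

text \<open>Uniform continuity on [0, 1/d]. Grid values up to index K * K with mesh 1/K follow y up
  to time K, which exceeds 1/d for large K.\<close>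

lemma ludist_steps_tendsto:
  fixes y :: "real \<Rightarrow> real"
  assumes y: "continuous_on {0..} y"
  shows "(\<lambda>K. ludist y (steps K (K * K) (\<lambda>j. y (real j / real K)))) \<longlonglongrightarrow> 0"
proof (rule LIMSEQ_I)
  fix r :: real assume r: "r > 0"
  define d where "d = r / 2"
  have d: "d > 0" "d < r" using r unfolding d_def by auto
  have "uniformly_continuous_on {0..1/d} y"
    by (rule compact_uniformly_continuous) (use y in \<open>auto intro: continuous_on_subset\<close>)
  then obtain e where e: "e > 0" "\<And>s t. s \<in> {0..1/d} \<Longrightarrow> t \<in> {0..1/d} \<Longrightarrow> dist s t < e \<Longrightarrow> dist (y s) (y t) < d"
    unfolding uniformly_continuous_on_def using d(1) by metis
  obtain K0 :: nat where K0: "real K0 > max (1/d) (1/e)" using reals_Archimedean2 by blast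
  have "norm (ludist y (steps K (K * K) (\<lambda>j. y (real j / real K))) - 0) < r" if K: "K \<ge> K0" for K
  proof -
    have Kr: "real K > 1/d" "real K > 1/e" using K0 K by auto
    have K0': "real K > 0" using Kr(1) d(1) by (meson less_trans zero_less_divide_1_iff)
    have "ludist y (steps K (K * K) (\<lambda>j. y (real j / real K))) \<le> d"
    proof (rule ludist_le[OF d(1)])
      fix t assume t: "0 \<le> t" "t \<le> 1/d"
      have f0: "0 \<le> \<lfloor>real K * t\<rfloor>" using t K0' by simp
      have "real_of_int \<lfloor>real K * t\<rfloor> \<le> real K * real K"
        using t Kr(1) K0' by (meson less_imp_le mult_left_mono of_int_floor_le order_trans)
      hence "nat \<lfloor>real K * t\<rfloor> \<le> K * K" using f0 by (metis nat_le_iff of_int_le_iff of_int_of_nat_eq of_nat_mult)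
      hence st: "steps K (K * K) (\<lambda>j. y (real j / real K)) t = y (real_of_int \<lfloor>real K * t\<rfloor> / real K)"
        using f0 unfolding steps_def by simp
      have l: "real_of_int \<lfloor>real K * t\<rfloor> / real K \<le> t" using K0' by (simp add: field_simps)
      have "real K * t < real_of_int \<lfloor>real K * t\<rfloor> + 1" by linarith
      hence "(real K * t - real_of_int \<lfloor>real K * t\<rfloor>) / real K < 1 / real K"
        using K0' by (intro divide_strict_right_mono) linarith+
      hence "t - real_of_int \<lfloor>real K * t\<rfloor> / real K < 1 / real K" using K0' by (simp add: diff_divide_distrib)
      also have "\<dots> < e" using Kr(2) e(1) K0' by (simp add: field_simps)
      finally have "dist t (real_of_int \<lfloor>real K * t\<rfloor> / real K) < e" using l by (simp add: dist_real_def)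
      moreover have "real_of_int \<lfloor>real K * t\<rfloor> / real K \<ge> 0" using f0 K0' by simp
      ultimately have "dist (y t) (y (real_of_int \<lfloor>real K * t\<rfloor> / real K)) < d"
        using t l by (intro e(2)) auto
      thus "\<bar>y t - steps K (K * K) (\<lambda>j. y (real j / real K)) t\<bar> \<le> d" unfolding st dist_real_def by simp
    qed
    thus ?thesis using d(2) ludist_nonneg by simp
  qed
  thus "\<exists>no. \<forall>n\<ge>no. norm (ludist y (steps n (n * n) (\<lambda>j. y (real j / real n))) - 0) < r" by blast
qed


lemma infconv_steps_tendsto:
  assumes f: "sk_test f" and L: "L \<ge> 0" and y: "continuous_on {0..} y"
  shows "(\<lambda>K. infconv f L (steps K (K * K) (\<lambda>j. y (real j / real K)))) \<longlonglongrightarrow> infconv f L y"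
proof -
  obtain B where B: "B \<ge> 0" "\<And>x. cadlag x \<Longrightarrow> \<bar>f x\<bar> \<le> B" using sk_test_bound[OF f] by blast
  note ic = infconv_Lipschitz[OF f B(2) L]
  define s where "s = (\<lambda>K. steps K (K * K) (\<lambda>j. y (real j / real K)))"
  have lim: "(\<lambda>K. L * ludist y (s K)) \<longlonglongrightarrow> 0"
    using tendsto_mult_left[OF ludist_steps_tendsto[OF y], of L] unfolding s_def by simp
  have "\<bar>infconv f L (s K) - infconv f L y\<bar> \<le> L * ludist y (s K)" for K
    using ic[of y "s K"] ic[of "s K" y] by (simp add: ludist_commute abs_le_iff)
  hence "(\<lambda>K. infconv f L (s K) - infconv f L y) \<longlonglongrightarrow> 0"
    by (intro Lim_null_comparison[OF always_eventually lim]) simp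
  thus ?thesis unfolding s_def by (rule LIM_zero_cancel)
qed

lemma continuous_cadlag:
  assumes "continuous_on {0..} y" shows "cadlag y"
proof -
  have r: "(y \<longlongrightarrow> y t) (at t within {0..})" if "t \<ge> 0" for t
    using assms that by (auto simp: continuous_on_def)
  show ?thesis
    unfolding cadlag_def
  proof (intro conjI allI impI exI)
    fix t :: real assume "t \<ge> 0"
    thus "(y \<longlongrightarrow> y t) (at_right t)" by (intro tendsto_within_subset[OF r]) auto
  next
    fix t :: real assume t: "t > 0"
    have "(y \<longlongrightarrow> y t) (at t within {0<..})" using t by (intro tendsto_within_subset[OF r]) auto
    hence "(y \<longlongrightarrow> y t) (at t)" using t by (simp add: at_within_open[of t "{0<..}"])
    thus "(y \<longlongrightarrow> y t) (at_left t)" by (rule tendsto_within_subset) auto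
  qed
qed

lemma sk_test_uminus: "sk_test f \<Longrightarrow> sk_test (\<lambda>x. - f x)"
  unfolding sk_test_def by (auto intro: tendsto_minus)

section \<open>Weak convergence from grid marginals and small oscillation\<close>

context
  fixes M :: "'a measure" and P :: "'b measure" and X :: "nat \<Rightarrow> 'a \<Rightarrow> real \<Rightarrow> real"
    and X' :: "nat \<Rightarrow> real \<Rightarrow> 'a \<Rightarrow> real" and Y :: "'b \<Rightarrow> real \<Rightarrow> real"
  assumes M: "prob_space M" and P: "prob_space P"
    and Xm: "\<And>f n. sk_test f \<Longrightarrow> n \<ge> 1 \<Longrightarrow> (\<lambda>\<omega>. f (X n \<omega>)) \<in> borel_measurable M"
    and Xc: "\<And>n \<omega>. n \<ge> 1 \<Longrightarrow> \<omega> \<in> space M \<Longrightarrow> cadlag (X n \<omega>)"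
    and X'm: "\<And>n t. t \<ge> 0 \<Longrightarrow> X' n t \<in> borel_measurable M"
    and Ym: "\<And>t. t \<ge> 0 \<Longrightarrow> (\<lambda>\<omega>. Y \<omega> t) \<in> borel_measurable P"
    and Yc: "\<And>\<omega>. \<omega> \<in> space P \<Longrightarrow> continuous_on {0..} (Y \<omega>)"
    and fdd: "\<And>K J h. K \<ge> 1 \<Longrightarrow> blip J h \<Longrightarrow>
      (\<lambda>n. \<integral>\<omega>. h (\<lambda>j. X' n (real j / real K) \<omega>) \<partial>M) \<longlonglongrightarrow> (\<integral>\<omega>. h (\<lambda>j. Y \<omega> (real j / real K)) \<partial>P)"
    and osc: "\<And>T \<epsilon> \<delta>. T > 0 \<Longrightarrow> \<epsilon> > 0 \<Longrightarrow> \<delta> > 0 \<Longrightarrow> \<exists>K0. \<forall>K\<ge>K0. \<forall>\<^sub>F n in sequentially.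
      \<exists>A\<in>sets M. measure M A \<le> \<delta> \<and> (\<forall>\<omega>\<in>space M - A. \<forall>t\<in>{0..T}. \<bar>X n \<omega> t - X' n (real_of_int \<lfloor>real K * t\<rfloor> / real K) \<omega>\<bar> \<le> \<epsilon>)"
begin

text \<open>An infimum over all cadlag paths is not visibly measurable. It is recovered as a
  pointwise limit over finer grids, each term depending on finitely many values of Y; boundedness
  then moves the limit through the integral.\<close>

lemma infconv_steps_limit:
  assumes f: "sk_test f" and L: "L \<ge> 0"
  shows "(\<lambda>\<omega>. infconv f L (Y \<omega>)) \<in> borel_measurable P"
    "(\<lambda>K. \<integral>\<omega>. infconv f L (steps K (K * K) (\<lambda>j. Y \<omega> (real j / real K))) \<partial>P) \<longlonglongrightarrow> (\<integral>\<omega>. infconv f L (Y \<omega>) \<partial>P)"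
proof -
  interpret P: prob_space P by (rule P)
  obtain B where B: "B \<ge> 0" "\<And>x. cadlag x \<Longrightarrow> \<bar>f x\<bar> \<le> B" using sk_test_bound[OF f] by blast
  define g where "g = (\<lambda>K \<omega>. infconv f L (steps K (K * K) (\<lambda>j. Y \<omega> (real j / real K))))"
  have gm: "g K \<in> borel_measurable P" for K
    unfolding g_def by (rule blip_measurable[OF blip_infconv_steps[OF f L]]) (rule Ym, simp)
  have lim: "(\<lambda>K. g K \<omega>) \<longlonglongrightarrow> infconv f L (Y \<omega>)" if "\<omega> \<in> space P" for \<omega>
    unfolding g_def by (rule infconv_steps_tendsto[OF f L Yc[OF that]])
  show m: "(\<lambda>\<omega>. infconv f L (Y \<omega>)) \<in> borel_measurable P"
    by (rule borel_measurable_LIMSEQ_real[OF lim gm])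
  have "(\<lambda>K. integral\<^sup>L P (g K)) \<longlonglongrightarrow> (\<integral>\<omega>. infconv f L (Y \<omega>) \<partial>P)"
  proof (rule integral_dominated_convergence[where w="\<lambda>_. B + L"])
    show "AE \<omega> in P. (\<lambda>K. g K \<omega>) \<longlonglongrightarrow> infconv f L (Y \<omega>)" using lim by (rule AE_I2)
    have "\<bar>g K \<omega>\<bar> \<le> B + L" for K \<omega>
      unfolding g_def
      using infconv_ge[OF f B(2) L] infconv_upper[OF f B(2) L] L
      by (smt (verit, best))
    thus "AE \<omega> in P. norm (g K \<omega>) \<le> B + L" for K by (intro AE_I2) simp
  qed (use m gm in auto)
  thus "(\<lambda>K. \<integral>\<omega>. infconv f L (steps K (K * K) (\<lambda>j. Y \<omega> (real j / real K))) \<partial>P) \<longlonglongrightarrow> (\<integral>\<omega>. infconv f L (Y \<omega>) \<partial>P)"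
    unfolding g_def .
qed

lemma infconv_limit:
  assumes f: "sk_test f"
  shows "(\<lambda>\<omega>. f (Y \<omega>)) \<in> borel_measurable P"
    "(\<lambda>n. \<integral>\<omega>. infconv f (real n) (Y \<omega>) \<partial>P) \<longlonglongrightarrow> (\<integral>\<omega>. f (Y \<omega>) \<partial>P)"
proof -
  interpret P: prob_space P by (rule P)
  obtain B where B: "B \<ge> 0" "\<And>x. cadlag x \<Longrightarrow> \<bar>f x\<bar> \<le> B" using sk_test_bound[OF f] by blast
  have c: "cadlag (Y \<omega>)" if "\<omega> \<in> space P" for \<omega> using Yc[OF that] by (rule continuous_cadlag)
  have gm: "(\<lambda>\<omega>. infconv f (real n) (Y \<omega>)) \<in> borel_measurable P" for n
    by (rule infconv_steps_limit[OF f]) simp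
  have lim: "(\<lambda>n. infconv f (real n) (Y \<omega>)) \<longlonglongrightarrow> f (Y \<omega>)" if "\<omega> \<in> space P" for \<omega>
    by (rule infconv_tendsto[OF f B(2) c[OF that]])
  show m: "(\<lambda>\<omega>. f (Y \<omega>)) \<in> borel_measurable P"
    by (rule borel_measurable_LIMSEQ_real[OF lim gm])
  show "(\<lambda>n. \<integral>\<omega>. infconv f (real n) (Y \<omega>) \<partial>P) \<longlonglongrightarrow> (\<integral>\<omega>. f (Y \<omega>) \<partial>P)"
  proof (rule integral_dominated_convergence[where w="\<lambda>_. B"])
    show "AE \<omega> in P. (\<lambda>n. infconv f (real n) (Y \<omega>)) \<longlonglongrightarrow> f (Y \<omega>)" using lim by (rule AE_I2)
    have "\<bar>infconv f (real n) (Y \<omega>)\<bar> \<le> B" if w: "\<omega> \<in> space P" for n \<omega>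
      using infconv_ge[OF f B(2), of "real n" "Y \<omega>"] infconv_le[OF f B(2), of "real n" "Y \<omega>", OF _ _ c[OF w]]
        abs_le_D1[OF B(2)[OF c[OF w]]] by (simp add: abs_le_iff)
    thus "AE \<omega> in P. norm (infconv f (real n) (Y \<omega>)) \<le> B" for n by (intro AE_I2) simp
  qed (use m gm in auto)
qed

text \<open>f dominates \<open>infconv f L\<close>, and off a small set X n is close to the step
  path through the grid values of X' n, so \<open>f (X n)\<close> exceeds a finite-dimensional
  function up to L d. The choices are made in the order L, d, K, n. A lower bound is enough, because
  -f is again a test functional.\<close>

lemma sk_lower_bound:
  assumes f: "sk_test f" and e: "e > 0"
  shows "\<forall>\<^sub>F n in sequentially. (\<integral>\<omega>. f (X n \<omega>) \<partial>M) \<ge> (\<integral>\<omega>. f (Y \<omega>) \<partial>P) - e"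
proof -
  interpret M: prob_space M by (rule M)
  interpret P: prob_space P by (rule P)
  obtain B where B: "B \<ge> 0" "\<And>x. cadlag x \<Longrightarrow> \<bar>f x\<bar> \<le> B" using sk_test_bound[OF f] by blast
  have "\<forall>\<^sub>F n in sequentially. (\<integral>\<omega>. infconv f (real n) (Y \<omega>) \<partial>P) > (\<integral>\<omega>. f (Y \<omega>) \<partial>P) - e / 4"
    by (rule order_tendstoD[OF infconv_limit(2)[OF f]]) (use e in simp)
  then obtain n0 where n0: "(\<integral>\<omega>. infconv f (real n0) (Y \<omega>) \<partial>P) > (\<integral>\<omega>. f (Y \<omega>) \<partial>P) - e / 4"
    by (auto simp: eventually_sequentially)
  define L where "L = real n0"
  have L: "L \<ge> 0" unfolding L_def by simp
  \<comment> \<open>On the exceptional set h is at most B + L while f is at least -B, hence a loss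
    of 2 B + L. \<open>d\<close> and \<open>d'\<close> limit the two losses to e/8 each; the three
    limits take e/4 each.\<close>
  define d where "d = e / (8 * (L + 1))"
  define d' where "d' = e / (8 * (2 * B + L + 1))"
  have d: "d > 0" "d' > 0" "L * d \<le> e / 8" "(2 * B + L) * d' \<le> e / 8"
    using e L B(1) unfolding d_def d'_def by (auto simp: field_simps)
  obtain K0 where K0: "\<And>K. K \<ge> K0 \<Longrightarrow> \<forall>\<^sub>F n in sequentially.
      \<exists>A\<in>sets M. measure M A \<le> d' \<and> (\<forall>\<omega>\<in>space M - A. \<forall>t\<in>{0..1/d}. \<bar>X n \<omega> t - X' n (real_of_int \<lfloor>real K * t\<rfloor> / real K) \<omega>\<bar> \<le> d)"
    using osc[of "1/d" d d'] d by auto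
  have "\<forall>\<^sub>F K in sequentially. (\<integral>\<omega>. infconv f L (steps K (K * K) (\<lambda>j. Y \<omega> (real j / real K))) \<partial>P) > (\<integral>\<omega>. infconv f L (Y \<omega>) \<partial>P) - e / 4"
    by (rule order_tendstoD[OF infconv_steps_limit(2)[OF f L]]) (use e in simp)
  moreover have "\<forall>\<^sub>F K in sequentially. K \<ge> max (max K0 1) (nat \<lceil>1/d\<rceil>)" by (rule eventually_ge_at_top)
  ultimately have "\<forall>\<^sub>F K in sequentially. (\<integral>\<omega>. infconv f L (steps K (K * K) (\<lambda>j. Y \<omega> (real j / real K))) \<partial>P) > (\<integral>\<omega>. infconv f L (Y \<omega>) \<partial>P) - e / 4
     \<and> K \<ge> max (max K0 1) (nat \<lceil>1/d\<rceil>)" by (rule eventually_conj)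
  then obtain K where K: "(\<integral>\<omega>. infconv f L (steps K (K * K) (\<lambda>j. Y \<omega> (real j / real K))) \<partial>P) > (\<integral>\<omega>. infconv f L (Y \<omega>) \<partial>P) - e / 4"
     "K \<ge> K0" "K \<ge> 1" "K \<ge> nat \<lceil>1/d\<rceil>" by (auto simp: eventually_sequentially)
  have Kd: "1/d \<le> real K" using K(4) by linarith
  define h where "h = (\<lambda>z. infconv f L (steps K (K * K) z))"
  have bh: "blip (K * K) h" unfolding h_def by (rule blip_infconv_steps[OF f L])
  have "\<forall>\<^sub>F n in sequentially. (\<integral>\<omega>. h (\<lambda>j. X' n (real j / real K) \<omega>) \<partial>M) > (\<integral>\<omega>. h (\<lambda>j. Y \<omega> (real j / real K)) \<partial>P) - e / 4"
    by (rule order_tendstoD[OF fdd[OF K(3) bh]]) (use e in simp)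
  moreover note K0[OF K(2)]
  moreover have "\<forall>\<^sub>F n in sequentially. n \<ge> (1::nat)" by (rule eventually_ge_at_top)
  ultimately show ?thesis
  proof eventually_elim
    case (elim n)
    from elim(2) obtain A where A: "A \<in> sets M" "measure M A \<le> d'"
      "\<And>\<omega> t. \<omega> \<in> space M - A \<Longrightarrow> t \<in> {0..1/d} \<Longrightarrow> \<bar>X n \<omega> t - X' n (real_of_int \<lfloor>real K * t\<rfloor> / real K) \<omega>\<bar> \<le> d" by blast
    define z where "z = (\<lambda>\<omega> j. X' n (real j / real K) \<omega>)"
    have zi: "integrable M (\<lambda>\<omega>. h (z \<omega>))"
      unfolding z_def by (rule M.blip_integrable[OF bh]) (rule X'm, simp)
    have fi: "integrable M (\<lambda>\<omega>. f (X n \<omega>))"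
      by (rule M.integrable_const_bound[where B=B]) (use B Xc[OF elim(3)] Xm[OF f elim(3)] in auto)
    have pt: "h (z \<omega>) - L * d - (2 * B + L) * indicator A \<omega> \<le> f (X n \<omega>)" if w: "\<omega> \<in> space M" for \<omega>
    proof (cases "\<omega> \<in> A")
      case True
      have "h (z \<omega>) \<le> B + L" unfolding h_def by (rule infconv_upper[OF f B(2) L])
      moreover have "f (X n \<omega>) \<ge> - B" using B(2)[OF Xc[OF elim(3) w]] by linarith
      moreover have "L * d \<ge> 0" using L d by simp
      ultimately show ?thesis using True by simp
    next
      case False
      have "ludist (steps K (K * K) (z \<omega>)) (X n \<omega>) \<le> d"
      proof (rule ludist_le[OF d(1)])
        fix t assume t: "0 \<le> t" "t \<le> 1/d"
        have f0: "0 \<le> \<lfloor>real K * t\<rfloor>" using t by simp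
        have "real K * t \<le> real K * real K" using t Kd by (intro mult_left_mono) auto
        hence "real_of_int \<lfloor>real K * t\<rfloor> \<le> real (K * K)" by (simp add: order_trans[OF of_int_floor_le])
        hence "nat \<lfloor>real K * t\<rfloor> \<le> K * K" using f0 by linarith
        hence "steps K (K * K) (z \<omega>) t = X' n (real_of_int \<lfloor>real K * t\<rfloor> / real K) \<omega>"
          using f0 unfolding steps_def z_def by simp
        thus "\<bar>steps K (K * K) (z \<omega>) t - X n \<omega> t\<bar> \<le> d" using A(3)[of \<omega> t] w False t by (simp add: abs_minus_commute)
      qed
      hence "L * ludist (steps K (K * K) (z \<omega>)) (X n \<omega>) \<le> L * d" using L by (rule mult_left_mono)
      moreover have "h (z \<omega>) \<le> infconv f L (X n \<omega>) + L * ludist (steps K (K * K) (z \<omega>)) (X n \<omega>)"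
        unfolding h_def by (rule infconv_Lipschitz[OF f B(2) L])
      moreover have "infconv f L (X n \<omega>) \<le> f (X n \<omega>)" by (rule infconv_le[OF f B(2) L Xc[OF elim(3) w]])
      ultimately show ?thesis using False by simp
    qed
    have "(\<integral>\<omega>. h (z \<omega>) - L * d - (2 * B + L) * indicator A \<omega> \<partial>M) \<le> (\<integral>\<omega>. f (X n \<omega>) \<partial>M)"
      by (rule integral_mono) (use zi fi A(1) pt in \<open>auto simp: M.emeasure_eq_measure\<close>)
    moreover have "(\<integral>\<omega>. h (z \<omega>) - L * d - (2 * B + L) * indicator A \<omega> \<partial>M) = (\<integral>\<omega>. h (z \<omega>) \<partial>M) - L * d - (2 * B + L) * measure M A"
      using zi A(1) by (simp add: M.emeasure_eq_measure M.prob_space)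
    moreover have "(2 * B + L) * measure M A \<le> (2 * B + L) * d'" using A(2) B(1) L by (intro mult_left_mono) auto
    ultimately show ?case using elim(1) K(1) n0 d(3,4) unfolding z_def h_def L_def[symmetric] by linarith
  qed
qed

lemma sk_conv_dist_criterion: "sk_conv_dist M X P Y"
  unfolding sk_conv_dist_def
proof (intro allI impI)
  fix f assume f: "sk_test f"
  have "\<forall>\<^sub>F n in sequentially. \<bar>(\<integral>\<omega>. f (X n \<omega>) \<partial>M) - (\<integral>\<omega>. f (Y \<omega>) \<partial>P)\<bar> < e" if e: "e > 0" for e
  proof -
    have "e / 2 > 0" using e by simp
    from sk_lower_bound[OF f this] sk_lower_bound[OF sk_test_uminus[OF f] this] show ?thesis
      by eventually_elim (use e in auto)
  qed
  thus "(\<lambda>n. \<integral>\<omega>. f (X n \<omega>) \<partial>M) \<longlonglongrightarrow> (\<integral>\<omega>. f (Y \<omega>) \<partial>P)"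
    by (auto simp: tendsto_iff dist_real_def)
qed

end

section \<open>Bounded martingale differences\<close>

text \<open>Boundedness is required on all of \<open>space M\<close>, so products of such functions
  are integrable at once. M supplies only the sample space; F ranges over its sub-sigma-algebras and
  M itself.\<close>

definition bfun :: "'a measure \<Rightarrow> 'a measure \<Rightarrow> ('a \<Rightarrow> real) \<Rightarrow> bool" where
  "bfun M F f \<longleftrightarrow> f \<in> borel_measurable F \<and> (\<exists>B. \<forall>\<omega>\<in>space M. \<bar>f \<omega>\<bar> \<le> B)"

lemma bfunI: "f \<in> borel_measurable F \<Longrightarrow> (\<And>\<omega>. \<omega> \<in> space M \<Longrightarrow> \<bar>f \<omega>\<bar> \<le> B) \<Longrightarrow> bfun M F f"
  unfolding bfun_def by blast

lemma bfun_const: "bfun M F (\<lambda>_. c)"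
  by (rule bfunI[where B="\<bar>c\<bar>"]) auto

lemma bfun_add:
  assumes "bfun M F f" "bfun M F g" shows "bfun M F (\<lambda>\<omega>. f \<omega> + g \<omega>)"
proof -
  obtain B C where "\<forall>\<omega>\<in>space M. \<bar>f \<omega>\<bar> \<le> B" "\<forall>\<omega>\<in>space M. \<bar>g \<omega>\<bar> \<le> C" using assms unfolding bfun_def by blast
  hence "\<bar>f \<omega> + g \<omega>\<bar> \<le> B + C" if "\<omega> \<in> space M" for \<omega> using that by (meson abs_triangle_ineq add_mono order_trans)
  moreover have "(\<lambda>\<omega>. f \<omega> + g \<omega>) \<in> borel_measurable F" using assms unfolding bfun_def by auto
  ultimately show ?thesis by (rule bfunI[rotated])
qed

lemma bfun_mult:
  assumes "bfun M F f" "bfun M F g" shows "bfun M F (\<lambda>\<omega>. f \<omega> * g \<omega>)"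
proof -
  obtain B C where BC: "\<forall>\<omega>\<in>space M. \<bar>f \<omega>\<bar> \<le> B" "\<forall>\<omega>\<in>space M. \<bar>g \<omega>\<bar> \<le> C" using assms unfolding bfun_def by blast
  have "\<bar>f \<omega> * g \<omega>\<bar> \<le> B * C" if "\<omega> \<in> space M" for \<omega>
    using BC that unfolding abs_mult by (intro mult_mono) (auto intro: order_trans[OF abs_ge_zero])
  moreover have "(\<lambda>\<omega>. f \<omega> * g \<omega>) \<in> borel_measurable F" using assms unfolding bfun_def by auto
  ultimately show ?thesis by (rule bfunI[rotated])
qed

lemma bfun_cmult: "bfun M F f \<Longrightarrow> bfun M F (\<lambda>\<omega>. c * f \<omega>)"
  by (rule bfun_mult[OF bfun_const])

lemma bfun_diff: "bfun M F f \<Longrightarrow> bfun M F g \<Longrightarrow> bfun M F (\<lambda>\<omega>. f \<omega> - g \<omega>)"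
  using bfun_add[of M F f "\<lambda>\<omega>. (-1) * g \<omega>"] bfun_cmult[of M F g "-1"] by simp

lemma bfun_power: "bfun M F f \<Longrightarrow> bfun M F (\<lambda>\<omega>. f \<omega> ^ n)"
  by (induction n) (auto intro: bfun_const bfun_mult)

lemma bfun_sum: "(\<And>i. i \<in> I \<Longrightarrow> bfun M F (f i)) \<Longrightarrow> bfun M F (\<lambda>\<omega>. \<Sum>i\<in>I. f i \<omega>)"
  by (induction I rule: infinite_finite_induct) (auto intro: bfun_const bfun_add)

lemma bfun_prod: "(\<And>i. i \<in> I \<Longrightarrow> bfun M F (f i)) \<Longrightarrow> bfun M F (\<lambda>\<omega>. \<Prod>i\<in>I. f i \<omega>)"
  by (induction I rule: infinite_finite_induct) (auto intro: bfun_const bfun_mult)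

lemmas bfun_intros = bfun_const bfun_add bfun_mult bfun_diff bfun_power bfun_sum

lemma bfun_subalgebra: "subalgebra M F \<Longrightarrow> bfun M F f \<Longrightarrow> bfun M M f"
  unfolding bfun_def using measurable_from_subalg by blast

lemma (in prob_space) bfun_integrable: "bfun M M f \<Longrightarrow> integrable M f"
  unfolding bfun_def by (auto intro!: integrable_const_bound AE_I2)

text \<open>The martingale property is encoded as orthogonality to bounded
  \<open>F k\<close>-measurable factors; \<open>\<xi> k\<close> is known from time k + 1 on. The
  factor 2 in the bound anticipates |\<zeta>| \<le> 2 for the noise of the process.\<close>

definition mdiff :: "'a measure \<Rightarrow> (nat \<Rightarrow> 'a measure) \<Rightarrow> (nat \<Rightarrow> real) \<Rightarrow> (nat \<Rightarrow> 'a \<Rightarrow> real) \<Rightarrow> bool" where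
  "mdiff M F a \<xi> \<longleftrightarrow> (\<forall>k. subalgebra M (F k)) \<and> (\<forall>k l. l < k \<longrightarrow> \<xi> l \<in> borel_measurable (F k)) \<and>
     (\<forall>l. \<forall>\<omega>\<in>space M. \<bar>\<xi> l \<omega>\<bar> \<le> 2 * a l) \<and> (\<forall>k g. bfun M (F k) g \<longrightarrow> (\<integral>\<omega>. g \<omega> * \<xi> k \<omega> \<partial>M) = 0)"

context prob_space
begin

context
  fixes F :: "nat \<Rightarrow> 'a measure" and a :: "nat \<Rightarrow> real" and \<xi> :: "nat \<Rightarrow> 'a \<Rightarrow> real"
  assumes md: "mdiff M F a \<xi>"
begin

lemma mdiff_facts:
  shows "subalgebra M (F k)" "l < k \<Longrightarrow> bfun M (F k) (\<xi> l)" "bfun M M (\<xi> l)"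
    "\<omega> \<in> space M \<Longrightarrow> \<bar>\<xi> l \<omega>\<bar> \<le> 2 * a l" "bfun M (F k) g \<Longrightarrow> expectation (\<lambda>\<omega>. g \<omega> * \<xi> k \<omega>) = 0" "0 \<le> a l"
proof -
  show s: "subalgebra M (F k)" for k using md unfolding mdiff_def by blast
  show b: "\<omega> \<in> space M \<Longrightarrow> \<bar>\<xi> l \<omega>\<bar> \<le> 2 * a l" for l \<omega> using md unfolding mdiff_def by blast
  show x: "l < k \<Longrightarrow> bfun M (F k) (\<xi> l)" for k l
    by (rule bfunI[OF _ b]) (use md in \<open>auto simp: mdiff_def\<close>)
  show "bfun M M (\<xi> l)" using bfun_subalgebra[OF s[of "Suc l"] x[of l "Suc l"]] by simp
  show "bfun M (F k) g \<Longrightarrow> expectation (\<lambda>\<omega>. g \<omega> * \<xi> k \<omega>) = 0" using md unfolding mdiff_def by blast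
  obtain \<omega> where "\<omega> \<in> space M" using not_empty by blast
  from b[OF this, of l] show "0 \<le> a l" by linarith
qed

lemma mdiff_moment2:
  "expectation (\<lambda>\<omega>. (\<Sum>l=p..<k. \<xi> l \<omega>)\<^sup>2) \<le> 4 * (\<Sum>l=p..<k. (a l)\<^sup>2)"
proof (induction k)
  case (Suc k)
  show ?case
  proof (cases "p \<le> k")
    case True
    define S where "S = (\<lambda>\<omega>. \<Sum>l=p..<k. \<xi> l \<omega>)"
    have S: "bfun M (F k) S" unfolding S_def by (intro bfun_sum mdiff_facts) auto
    have bS: "bfun M M S" by (rule bfun_subalgebra[OF mdiff_facts(1) S])
    note i = bfun_integrable[OF bfun_power[OF bS, of 2]] bfun_integrable[OF bfun_mult[OF bfun_cmult[OF bS, of 2] mdiff_facts(3)[of k]]]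
    have "expectation (\<lambda>\<omega>. (S \<omega> + \<xi> k \<omega>)\<^sup>2) \<le> expectation (\<lambda>\<omega>. (S \<omega>)\<^sup>2 + 2 * S \<omega> * \<xi> k \<omega> + 4 * (a k)\<^sup>2)"
    proof (rule integral_mono)
      show "integrable M (\<lambda>\<omega>. (S \<omega> + \<xi> k \<omega>)\<^sup>2)" by (intro bfun_integrable bfun_power bfun_add bS mdiff_facts)
      show "integrable M (\<lambda>\<omega>. (S \<omega>)\<^sup>2 + 2 * S \<omega> * \<xi> k \<omega> + 4 * (a k)\<^sup>2)" using i by simp
      fix \<omega> assume "\<omega> \<in> space M"
      hence "(\<xi> k \<omega>)\<^sup>2 \<le> (2 * a k)\<^sup>2" using mdiff_facts(4)[of \<omega> k] mdiff_facts(6)[of k] by (intro abs_le_square_iff[THEN iffD1]) auto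
      thus "(S \<omega> + \<xi> k \<omega>)\<^sup>2 \<le> (S \<omega>)\<^sup>2 + 2 * S \<omega> * \<xi> k \<omega> + 4 * (a k)\<^sup>2" by (simp add: power2_sum power_mult_distrib)
    qed
    also have "\<dots> = expectation (\<lambda>\<omega>. (S \<omega>)\<^sup>2) + 4 * (a k)\<^sup>2"
      using i mdiff_facts(5)[OF bfun_cmult[OF S, of 2]] by (simp add: prob_space)
    finally show ?thesis using Suc True by (simp add: S_def)
  qed simp
qed simp

lemma mdiff_moment4:
  "expectation (\<lambda>\<omega>. (\<Sum>l=p..<k. \<xi> l \<omega>) ^ 4) \<le> 64 * (\<Sum>l=p..<k. (a l)\<^sup>2)\<^sup>2"
proof (induction k)
  case (Suc k)
  show ?case
  proof (cases "p \<le> k")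
    case True
    define S where "S = (\<lambda>\<omega>. \<Sum>l=p..<k. \<xi> l \<omega>)"
    define V where "V = (\<Sum>l=p..<k. (a l)\<^sup>2)"
    have S: "bfun M (F k) S" unfolding S_def by (intro bfun_sum mdiff_facts) auto
    have bS: "bfun M M S" by (rule bfun_subalgebra[OF mdiff_facts(1) S])
    note i = bfun_integrable[OF bfun_power[OF bS, of 4]] bfun_integrable[OF bfun_power[OF bS, of 2]]
      bfun_integrable[OF bfun_mult[OF bfun_cmult[OF bfun_power[OF bS, of 3], of 4] mdiff_facts(3)[of k]]]
    have "expectation (\<lambda>\<omega>. (S \<omega> + \<xi> k \<omega>) ^ 4) \<le> expectation (\<lambda>\<omega>. S \<omega> ^ 4 + 4 * S \<omega> ^ 3 * \<xi> k \<omega> + (32 * (a k)\<^sup>2) * (S \<omega>)\<^sup>2 + 48 * (a k) ^ 4)"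
    proof (rule integral_mono)
      show "integrable M (\<lambda>\<omega>. (S \<omega> + \<xi> k \<omega>) ^ 4)" by (intro bfun_integrable bfun_power bfun_add bS mdiff_facts)
      show "integrable M (\<lambda>\<omega>. S \<omega> ^ 4 + 4 * S \<omega> ^ 3 * \<xi> k \<omega> + (32 * (a k)\<^sup>2) * (S \<omega>)\<^sup>2 + 48 * (a k) ^ 4)" using i by simp
      fix \<omega> assume "\<omega> \<in> space M"
      hence x: "\<bar>\<xi> k \<omega>\<bar> \<le> 2 * a k" by (rule mdiff_facts)
      have x2: "(\<xi> k \<omega>)\<^sup>2 \<le> 4 * (a k)\<^sup>2" using x mdiff_facts(6)[of k] abs_le_square_iff[of "\<xi> k \<omega>" "2 * a k"] by (simp add: power_mult_distrib)
      hence "((\<xi> k \<omega>)\<^sup>2)\<^sup>2 \<le> (4 * (a k)\<^sup>2)\<^sup>2" by (intro power_mono) auto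
      hence x4: "\<xi> k \<omega> ^ 4 \<le> 16 * a k ^ 4" by (simp add: power_mult_distrib)
      \<comment> \<open>The added square cancels 4 S \<xi>^3, whose sign is unknown. What is left, 8
        S^2 \<xi>^2 + 3 \<xi>^4, yields 32 = 8 * 4 and 48 = 3 * 16.\<close>
      have "(S \<omega> + \<xi> k \<omega>) ^ 4 + 2 * (\<xi> k \<omega>)\<^sup>2 * (S \<omega> - \<xi> k \<omega>)\<^sup>2 = S \<omega> ^ 4 + 4 * S \<omega> ^ 3 * \<xi> k \<omega> + 8 * ((\<xi> k \<omega>)\<^sup>2 * (S \<omega>)\<^sup>2) + 3 * \<xi> k \<omega> ^ 4"
        by (simp add: power2_eq_square power4_eq_xxxx power3_eq_cube algebra_simps)
      moreover have "2 * (\<xi> k \<omega>)\<^sup>2 * (S \<omega> - \<xi> k \<omega>)\<^sup>2 \<ge> 0" by simp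
      moreover have "(\<xi> k \<omega>)\<^sup>2 * (S \<omega>)\<^sup>2 \<le> 4 * (a k)\<^sup>2 * (S \<omega>)\<^sup>2" using x2 by (intro mult_right_mono) auto
      ultimately show "(S \<omega> + \<xi> k \<omega>) ^ 4 \<le> S \<omega> ^ 4 + 4 * S \<omega> ^ 3 * \<xi> k \<omega> + (32 * (a k)\<^sup>2) * (S \<omega>)\<^sup>2 + 48 * (a k) ^ 4"
        using x4 by linarith
    qed
    also have "\<dots> = expectation (\<lambda>\<omega>. S \<omega> ^ 4) + 32 * (a k)\<^sup>2 * expectation (\<lambda>\<omega>. (S \<omega>)\<^sup>2) + 48 * (a k) ^ 4"
      using i mdiff_facts(5)[OF bfun_cmult[OF bfun_power[OF S, of 3], of 4]] by (simp add: prob_space)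
    also have "\<dots> \<le> 64 * V\<^sup>2 + 32 * (a k)\<^sup>2 * (4 * V) + 48 * (a k) ^ 4"
      using Suc mdiff_moment2[of p k] unfolding S_def V_def by (intro add_mono mult_left_mono) auto
    \<comment> \<open>The middle term 32 * 4 is exactly the cross term 2 * 64, and 48 \<le> 64; this
      is what makes 64 reproduce itself in the induction.\<close>
    also have "\<dots> \<le> 64 * (V + (a k)\<^sup>2)\<^sup>2"
      using mdiff_facts(6)[of k] by (simp add: power2_sum power4_eq_xxxx power2_eq_square algebra_simps zero_le_mult_iff)
    finally show ?thesis using True by (simp add: S_def V_def)
  qed simp
qed simp

end

text \<open>Fourth moments make the bound quadratic in the variance of the block. Summed over the
  cells of a grid it is then small for a fine grid, whereas a bound linear in the variance would add
  up to the total variance.\<close>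

lemma mdiff_maximal:
  fixes p m :: nat
  assumes md: "mdiff M F a \<xi>" and \<epsilon>: "\<epsilon> > 0"
  defines "A \<equiv> {\<omega>\<in>space M. \<exists>k\<in>{p..m}. \<bar>\<Sum>l=p..<k. \<xi> l \<omega>\<bar> \<ge> \<epsilon>}"
  shows "A \<in> sets M" "prob A \<le> 64 * (\<Sum>l=p..<m. (a l)\<^sup>2)\<^sup>2 / \<epsilon> ^ 4"
proof -
  note mf = mdiff_facts[OF md]
  define S where "S = (\<lambda>k \<omega>. \<Sum>l=p..<k. \<xi> l \<omega>)"
  define T where "T = (\<lambda>l. {\<omega>\<in>space M. \<forall>j\<in>{p..l}. \<bar>S j \<omega>\<bar> < \<epsilon>})"
  \<comment> \<open>Stopping at the first exceedance preserves the hypotheses, so the moment bound applies to the stopped sum,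
    which stays beyond \<epsilon> on A.\<close>
  define \<xi>' where "\<xi>' = (\<lambda>l \<omega>. indicator (T l) \<omega> * \<xi> l \<omega>)"
  have Sb: "S j \<in> borel_measurable (F k)" if "j \<le> k" for j k
    unfolding S_def using bfun_sum[of "{p..<j}" M "F k" \<xi>] mf(2) that by (auto simp: bfun_def)
  have sp: "space (F k) = space M" for k using mf(1)[of k] by (simp add: subalgebra_def)
  have Tm: "T l \<in> sets (F k)" if "l \<le> k" for k l
  proof -
    have "T l = {\<omega>\<in>space (F k). \<forall>j\<in>{p..l}. \<bar>S j \<omega>\<bar> < \<epsilon>}" unfolding T_def sp ..
    also have "\<dots> \<in> sets (F k)"
    proof (rule sets.sets_Collect_finite_All)
      fix j assume "j \<in> {p..l}"
      hence [measurable]: "S j \<in> borel_measurable (F k)" using that by (intro Sb) auto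
      show "{\<omega> \<in> space (F k). \<bar>S j \<omega>\<bar> < \<epsilon>} \<in> sets (F k)" by measurable
    qed auto
    finally show ?thesis .
  qed
  have bT: "bfun M (F k) (indicator (T l))" if "l \<le> k" for k l
    by (rule bfunI[where B=1]) (use Tm[OF that] in \<open>auto simp: indicator_def\<close>)
  have md': "mdiff M F a \<xi>'"
    unfolding mdiff_def
  proof (intro conjI allI impI ballI)
    show "subalgebra M (F k)" for k by (rule mf)
    show "\<xi>' l \<in> borel_measurable (F k)" if "l < k" for k l
      using bfun_mult[OF bT[of l k] mf(2)[OF that]] that unfolding \<xi>'_def bfun_def by auto
    show "\<bar>\<xi>' l \<omega>\<bar> \<le> 2 * a l" if "\<omega> \<in> space M" for l \<omega>
      using mf(4)[OF that, of l] mf(6)[of l] unfolding \<xi>'_def by (auto simp: indicator_def)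
    show "expectation (\<lambda>\<omega>. g \<omega> * \<xi>' k \<omega>) = 0" if "bfun M (F k) g" for k g
      using mf(5)[OF bfun_mult[OF that bT[of k k]]] unfolding \<xi>'_def by (simp add: mult.assoc)
  qed
  have A_eq: "A = space M - T m" unfolding A_def T_def S_def by (auto simp: not_less)
  show Am: "A \<in> sets M" unfolding A_eq using Tm[of m m] mf(1)[of m] by (auto simp: subalgebra_def)
  have hit: "\<epsilon> \<le> \<bar>\<Sum>l=p..<m. \<xi>' l \<omega>\<bar>" if w: "\<omega> \<in> A" for \<omega>
  proof -
    have sw: "\<omega> \<in> space M" using w unfolding A_def by simp
    define k where "k = (LEAST j. p \<le> j \<and> \<epsilon> \<le> \<bar>S j \<omega>\<bar>)"
    obtain j where j: "j \<in> {p..m}" "\<epsilon> \<le> \<bar>S j \<omega>\<bar>" using w unfolding A_def S_def by auto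
    hence k: "p \<le> k" "\<epsilon> \<le> \<bar>S k \<omega>\<bar>" "k \<le> m"
      unfolding k_def using LeastI[of "\<lambda>j. p \<le> j \<and> \<epsilon> \<le> \<bar>S j \<omega>\<bar>" j] Least_le[of "\<lambda>j. p \<le> j \<and> \<epsilon> \<le> \<bar>S j \<omega>\<bar>" j] by auto
    have lt: "\<bar>S j \<omega>\<bar> < \<epsilon>" if "p \<le> j" "j < k" for j
      using not_less_Least[of j "\<lambda>j. p \<le> j \<and> \<epsilon> \<le> \<bar>S j \<omega>\<bar>"] that unfolding k_def by auto
    have 1: "\<xi>' l \<omega> = \<xi> l \<omega>" if "l < k" for l
      using lt that sw unfolding \<xi>'_def T_def by (auto simp: indicator_def)
    have 2: "\<xi>' l \<omega> = 0" if "l \<ge> k" for l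
      using k that unfolding \<xi>'_def T_def by (auto simp: indicator_def not_less)
    have "(\<Sum>l=p..<m. \<xi>' l \<omega>) = (\<Sum>l=p..<k. \<xi>' l \<omega>) + (\<Sum>l=k..<m. \<xi>' l \<omega>)"
      using k by (simp add: sum.atLeastLessThan_concat)
    also have "\<dots> = S k \<omega>" unfolding S_def using 1 2 by simp
    finally show ?thesis using k(2) by simp
  qed
  have bx: "bfun M M (\<lambda>\<omega>. (\<Sum>l=p..<m. \<xi>' l \<omega>) ^ 4)"
    by (intro bfun_power bfun_sum mdiff_facts(3)[OF md'])
  have "expectation (\<lambda>\<omega>. \<epsilon> ^ 4 * indicator A \<omega>) \<le> expectation (\<lambda>\<omega>. (\<Sum>l=p..<m. \<xi>' l \<omega>) ^ 4)"
  proof (rule integral_mono)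
    show "integrable M (\<lambda>\<omega>. \<epsilon> ^ 4 * indicator A \<omega>)" using Am by (simp add: emeasure_eq_measure)
    show "integrable M (\<lambda>\<omega>. (\<Sum>l=p..<m. \<xi>' l \<omega>) ^ 4)" by (rule bfun_integrable[OF bx])
    fix \<omega>
    show "\<epsilon> ^ 4 * indicator A \<omega> \<le> (\<Sum>l=p..<m. \<xi>' l \<omega>) ^ 4"
    proof (cases "\<omega> \<in> A")
      case True
      have "\<epsilon> ^ 4 \<le> \<bar>\<Sum>l=p..<m. \<xi>' l \<omega>\<bar> ^ 4" using hit[OF True] \<epsilon> by (intro power_mono) auto
      thus ?thesis using True by (simp add: power_even_abs)
    qed simp
  qed
  also have "\<dots> \<le> 64 * (\<Sum>l=p..<m. (a l)\<^sup>2)\<^sup>2" by (rule mdiff_moment4[OF md'])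
  finally have "\<epsilon> ^ 4 * prob A \<le> 64 * (\<Sum>l=p..<m. (a l)\<^sup>2)\<^sup>2" using Am by simp
  thus "prob A \<le> 64 * (\<Sum>l=p..<m. (a l)\<^sup>2)\<^sup>2 / \<epsilon> ^ 4" using \<epsilon> by (simp add: field_simps)
qed

end

section \<open>Step sizes\<close>

text \<open>Subtracting \<epsilon> absorbs the source, since eventually e n \<le> \<epsilon> d n.
  The positive part then contracts by 1 - d n \<le> exp (-d n), and d n \<ge> \<theta>/(2 n) because
  \<gamma> \<le> 1. Multiplied by n^(\<theta>/2) it is eventually nonincreasing, so it decays at
  least like n^(-\<theta>/2).\<close>

lemma recursion_tendsto_zero:
  fixes y d e :: "nat \<Rightarrow> real"
  assumes g: "0 < \<gamma>" "\<gamma> \<le> 1" and th: "\<theta> > 0" and y: "\<And>n. y n \<ge> 0"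
    and rec: "\<forall>\<^sub>F n in sequentially. y (Suc n) \<le> (1 - d n) * y n + e n"
    and d: "(\<lambda>n. real n powr \<gamma> * d n) \<longlonglongrightarrow> \<theta>" and e: "(\<lambda>n. real n powr \<gamma> * e n) \<longlonglongrightarrow> 0"
  shows "y \<longlonglongrightarrow> 0"
proof (rule LIMSEQ_I)
  fix r :: real assume "r > 0"
  define \<epsilon> where "\<epsilon> = r / 2"
  have eps: "\<epsilon> > 0" using \<open>r > 0\<close> unfolding \<epsilon>_def by simp
  have inf: "filterlim (\<lambda>n. real n powr \<gamma>) at_top sequentially" using g by real_asymp
  have "(\<lambda>n. (real n powr \<gamma> * d n) / real n powr \<gamma>) \<longlonglongrightarrow> 0"
    by (rule tendsto_divide_0[OF d filterlim_at_top_imp_at_infinity[OF inf]])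
  hence "\<forall>\<^sub>F n in sequentially. (real n powr \<gamma> * d n) / real n powr \<gamma> < 1" by (rule order_tendstoD) simp
  moreover have "\<forall>\<^sub>F n in sequentially. real n powr \<gamma> * d n > \<theta> / 2" by (rule order_tendstoD[OF d]) (use th in simp)
  moreover have "\<forall>\<^sub>F n in sequentially. real n powr \<gamma> * e n < \<epsilon> * \<theta> / 2" by (rule order_tendstoD[OF e]) (use th eps in simp)
  moreover have "\<forall>\<^sub>F n in sequentially. n \<ge> (1::nat)" by (rule eventually_ge_at_top)
  ultimately have "\<forall>\<^sub>F n in sequentially. n \<ge> 1 \<and> max (y (Suc n) - \<epsilon>) 0 * real (Suc n) powr (\<theta>/2) \<le> max (y n - \<epsilon>) 0 * real n powr (\<theta>/2)"
    using rec
  proof eventually_elim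
    case (elim n)
    have n: "real n > 0" using elim(4) by simp
    hence p: "real n powr \<gamma> > 0" by simp
    have d1: "d n < 1" using elim(1) p by simp
    have "real n powr \<gamma> * e n \<le> \<epsilon> * (real n powr \<gamma> * d n)"
      using elim(3) mult_strict_left_mono[OF elim(2) eps] by linarith
    hence "real n powr \<gamma> * e n \<le> real n powr \<gamma> * (\<epsilon> * d n)" by (simp add: algebra_simps)
    hence "e n \<le> \<epsilon> * d n" using p by simp
    hence "y (Suc n) - \<epsilon> \<le> (1 - d n) * (y n - \<epsilon>)" using elim(5) by (simp add: algebra_simps)
    also have "\<dots> \<le> (1 - d n) * max (y n - \<epsilon>) 0" using d1 by (intro mult_left_mono) auto
    finally have z: "max (y (Suc n) - \<epsilon>) 0 \<le> (1 - d n) * max (y n - \<epsilon>) 0" using d1 by simp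
    have "real n powr \<gamma> \<le> real n powr 1" using elim(4) g by (intro powr_mono) auto
    moreover have "d n > 0" by (rule zero_less_mult_pos[OF _ p]) (use elim(2) th in linarith)
    ultimately have "real n powr \<gamma> * d n \<le> real n powr 1 * d n" by (intro mult_right_mono) auto
    hence "\<theta> / 2 < real n * d n" using elim(2) by simp
    hence dn: "\<theta> / 2 / real n \<le> d n" using n by (simp add: field_simps)
    have "1 - d n \<le> exp (- d n)" using exp_ge_add_one_self[of "- d n"] by simp
    also have "\<dots> \<le> exp (- (\<theta> / 2 * ln (real (Suc n) / real n)))"
    proof -
      have "ln (1 + 1 / real n) \<le> 1 / real n" using n by (intro ln_add_one_self_le_self) auto
      moreover have "1 + 1 / real n = real (Suc n) / real n" using n by (simp add: field_simps)
      ultimately have "\<theta> / 2 * ln (real (Suc n) / real n) \<le> \<theta> / 2 * (1 / real n)" using th by (intro mult_left_mono) auto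
      thus ?thesis using dn by simp
    qed
    also have "\<dots> = real n powr (\<theta>/2) / real (Suc n) powr (\<theta>/2)"
      using n by (simp add: powr_def ln_div exp_diff[symmetric] algebra_simps)
    finally have "(1 - d n) * max (y n - \<epsilon>) 0 \<le> real n powr (\<theta>/2) / real (Suc n) powr (\<theta>/2) * max (y n - \<epsilon>) 0"
      by (intro mult_right_mono) auto
    with z have "max (y (Suc n) - \<epsilon>) 0 \<le> real n powr (\<theta>/2) / real (Suc n) powr (\<theta>/2) * max (y n - \<epsilon>) 0" by linarith
    hence "max (y (Suc n) - \<epsilon>) 0 * real (Suc n) powr (\<theta>/2) \<le> (real n powr (\<theta>/2) / real (Suc n) powr (\<theta>/2) * max (y n - \<epsilon>) 0) * real (Suc n) powr (\<theta>/2)"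
      by (rule mult_right_mono) simp
    also have "\<dots> = max (y n - \<epsilon>) 0 * real n powr (\<theta>/2)" by simp
    finally show ?case using elim(4) by blast
  qed
  then obtain n0 where n0: "\<And>n. n \<ge> n0 \<Longrightarrow> n \<ge> 1 \<and> max (y (Suc n) - \<epsilon>) 0 * real (Suc n) powr (\<theta>/2) \<le> max (y n - \<epsilon>) 0 * real n powr (\<theta>/2)"
    by (auto simp: eventually_sequentially)
  define C where "C = max (y n0 - \<epsilon>) 0 * real n0 powr (\<theta>/2)"
  have C: "max (y n - \<epsilon>) 0 * real n powr (\<theta>/2) \<le> C" if "n \<ge> n0" for n
    using that
  proof (induction n rule: dec_induct)
    case base show ?case by (simp add: C_def)
  next
    case (step n) thus ?case using n0[of n] by simp
  qed
  have "(\<lambda>n. C * real n powr (-(\<theta>/2))) \<longlonglongrightarrow> 0" using th by real_asymp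
  hence "\<forall>\<^sub>F n in sequentially. C * real n powr (-(\<theta>/2)) < \<epsilon>" using eps by (rule order_tendstoD)
  then obtain n1 where n1: "\<And>n. n \<ge> n1 \<Longrightarrow> C * real n powr (-(\<theta>/2)) < \<epsilon>" by (auto simp: eventually_sequentially)
  have "norm (y n - 0) < r" if "n \<ge> max n0 n1" for n
  proof -
    have n: "real n > 0" using n0[of n] that by simp
    have "max (y n - \<epsilon>) 0 = (max (y n - \<epsilon>) 0 * real n powr (\<theta>/2)) * real n powr (-(\<theta>/2))"
      using n by (simp add: powr_minus)
    also have "\<dots> \<le> C * real n powr (-(\<theta>/2))" using C[of n] that by (intro mult_right_mono) auto
    also have "\<dots> < \<epsilon>" using n1 that by simp
    finally have "y n < 2 * \<epsilon>" by simp
    thus ?thesis using y[of n] unfolding \<epsilon>_def by simp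
  qed
  thus "\<exists>no. \<forall>n\<ge>no. norm (y n - 0) < r" by blast
qed

text \<open>At E/\<theta> the source E n^(-\<gamma>) balances the loss \<theta> n^(-\<gamma>) x. The
  distance to this point obeys the same recursion with a source of smaller order.\<close>

lemma recursion_tendsto:
  fixes x d e :: "nat \<Rightarrow> real"
  assumes g: "0 < \<gamma>" "\<gamma> \<le> 1" and th: "\<theta> > 0"
    and rec: "\<And>n. n \<ge> 1 \<Longrightarrow> x (Suc n) = (1 - d n) * x n + e n"
    and d: "(\<lambda>n. real n powr \<gamma> * d n) \<longlonglongrightarrow> \<theta>" and e: "(\<lambda>n. real n powr \<gamma> * e n) \<longlonglongrightarrow> E"
  shows "x \<longlonglongrightarrow> E / \<theta>"
proof -
  have inf: "filterlim (\<lambda>n. real n powr \<gamma>) at_top sequentially" using g by real_asymp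
  have "(\<lambda>n. \<bar>x n - E / \<theta>\<bar>) \<longlonglongrightarrow> 0"
  proof (rule recursion_tendsto_zero[OF g th _ _ d])
    have "(\<lambda>n. (real n powr \<gamma> * d n) / real n powr \<gamma>) \<longlonglongrightarrow> 0"
      by (rule tendsto_divide_0[OF d filterlim_at_top_imp_at_infinity[OF inf]])
    hence "\<forall>\<^sub>F n in sequentially. (real n powr \<gamma> * d n) / real n powr \<gamma> < 1" by (rule order_tendstoD) simp
    moreover have "\<forall>\<^sub>F n in sequentially. n \<ge> (1::nat)" by (rule eventually_ge_at_top)
    ultimately show "\<forall>\<^sub>F n in sequentially. \<bar>x (Suc n) - E / \<theta>\<bar> \<le> (1 - d n) * \<bar>x n - E / \<theta>\<bar> + \<bar>e n - d n * (E / \<theta>)\<bar>"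
    proof eventually_elim
      case (elim n)
      have "x (Suc n) - E / \<theta> = (1 - d n) * (x n - E / \<theta>) + (e n - d n * (E / \<theta>))"
        using rec[OF elim(2)] by (simp add: algebra_simps)
      also have "\<bar>\<dots>\<bar> \<le> \<bar>(1 - d n) * (x n - E / \<theta>)\<bar> + \<bar>e n - d n * (E / \<theta>)\<bar>" by (rule abs_triangle_ineq)
      also have "\<bar>(1 - d n) * (x n - E / \<theta>)\<bar> = (1 - d n) * \<bar>x n - E / \<theta>\<bar>" using elim by (simp add: abs_mult)
      finally show ?case .
    qed
    have "(\<lambda>n. \<bar>real n powr \<gamma> * e n - (real n powr \<gamma> * d n) * (E / \<theta>)\<bar>) \<longlonglongrightarrow> \<bar>E - \<theta> * (E / \<theta>)\<bar>"
      by (intro tendsto_intros d e)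
    moreover have "\<bar>real n powr \<gamma> * e n - (real n powr \<gamma> * d n) * (E / \<theta>)\<bar> = real n powr \<gamma> * \<bar>e n - d n * (E / \<theta>)\<bar>" for n
    proof -
      have "real n powr \<gamma> * e n - (real n powr \<gamma> * d n) * (E / \<theta>) = real n powr \<gamma> * (e n - d n * (E / \<theta>))"
        by (simp add: algebra_simps)
      thus ?thesis by (simp add: abs_mult)
    qed
    ultimately show "(\<lambda>n. real n powr \<gamma> * \<bar>e n - d n * (E / \<theta>)\<bar>) \<longlonglongrightarrow> 0" using th by simp
  qed simp
  thus ?thesis by (simp add: tendsto_rabs_zero_iff LIM_zero_iff)
qed

text \<open>The bracket in \<open>ulim\<close> is 1 - G (n + 1) / G n, so \<theta> is the relative
  rate of decrease of the normalisation G on the scale n^(-\<gamma>). The two regimes of the theorem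
  supply different values of \<theta>.\<close>

locale step_sizes =
  fixes r :: "nat \<Rightarrow> real" and c \<gamma> \<beta> \<theta> :: real
  assumes r: "\<And>n. 0 \<le> r n" "\<And>n. r n < 1" and \<gamma>: "0 < \<gamma>" "\<gamma> \<le> 1" and c: "c > 0"
    and rlim: "(\<lambda>n. real n powr \<gamma> * r n) \<longlonglongrightarrow> c" and \<beta>: "0 < \<beta>" "\<beta> \<le> 1" and \<theta>: "\<theta> > 0"
    and ulim: "(\<lambda>n. real n powr \<gamma> * (1 - (1 + 1 / real n) powr (\<gamma>/2) * (1 - \<beta> * r n))) \<longlonglongrightarrow> \<theta>"
begin

text \<open>Dividing the deviation at time n by A n turns it into a martingale; G n is the normalisation at time n.\<close>

definition A :: "nat \<Rightarrow> real" where "A n = (\<Prod>j<n. 1 - \<beta> * r j)"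

definition G :: "nat \<Rightarrow> real" where "G n = real n powr (\<gamma>/2) * A n"

lemma factor_pos: "1 - \<beta> * r n > 0"
  using r[of n] mult_right_mono[OF \<beta>(2), of "r n"] by linarith

lemma A_pos: "A n > 0"
  unfolding A_def using factor_pos by (intro prod_pos) auto

lemma A_Suc: "A (Suc n) = (1 - \<beta> * r n) * A n"
  unfolding A_def by simp

lemma powr_at_top: "filterlim (\<lambda>n. real n powr \<gamma>) at_top sequentially"
  using \<gamma> by real_asymp

lemma r_lim0: "r \<longlonglongrightarrow> 0"
proof -
  have "(\<lambda>n. (real n powr \<gamma> * r n) / real n powr \<gamma>) \<longlonglongrightarrow> 0"
    by (rule tendsto_divide_0[OF rlim filterlim_at_top_imp_at_infinity[OF powr_at_top]])
  thus ?thesis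
    by (rule Lim_transform_eventually) (auto simp: eventually_sequentially intro!: exI[of _ 1])
qed

definition u :: "nat \<Rightarrow> real" where "u n = (1 + 1 / real n) powr (\<gamma>/2) * (1 - \<beta> * r n)"

lemma G_Suc: "n \<ge> 1 \<Longrightarrow> G (Suc n) = u n * G n"
proof -
  assume n: "n \<ge> 1"
  have "(1 + 1 / real n) powr (\<gamma>/2) * real n powr (\<gamma>/2) = ((1 + 1 / real n) * real n) powr (\<gamma>/2)"
    using n by (subst powr_mult) auto
  also have "(1 + 1 / real n) * real n = real (Suc n)" using n by (simp add: field_simps)
  finally show ?thesis unfolding G_def u_def A_Suc by (simp add: algebra_simps)
qed

lemma G_lim0: "G \<longlonglongrightarrow> 0"
proof -
  have "G \<longlonglongrightarrow> 0 / \<theta>"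
    by (rule recursion_tendsto[OF \<gamma> \<theta>, where d="\<lambda>n. 1 - u n" and e="\<lambda>_. 0"])
       (use ulim G_Suc in \<open>auto simp: u_def\<close>)
  thus ?thesis by simp
qed

text \<open>Precise asymptotics of A are bypassed: the normalised sum satisfies a linear recursion
  with loss 1 - u^p, about p \<theta> n^(-\<gamma>). The power 2 serves for variances and 3 for the
  Lindeberg error; the weight g makes room for the decaying deviation from q.\<close>

lemma power_sum_tendsto:
  assumes p: "p \<ge> 1" and E: "(\<lambda>n. real n powr \<gamma> * ((real (Suc n) powr (\<gamma>/2) * r n) ^ p * g n)) \<longlonglongrightarrow> E"
  shows "(\<lambda>n. G n ^ p * (\<Sum>k<n. (r k / A (Suc k)) ^ p * g k)) \<longlonglongrightarrow> E / (real p * \<theta>)"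
proof (rule recursion_tendsto[OF \<gamma> _ _ _ E, where d="\<lambda>n. 1 - u n ^ p"])
  show "real p * \<theta> > 0" using p \<theta> by simp
  show "G (Suc n) ^ p * (\<Sum>k<Suc n. (r k / A (Suc k)) ^ p * g k)
      = (1 - (1 - u n ^ p)) * (G n ^ p * (\<Sum>k<n. (r k / A (Suc k)) ^ p * g k)) + (real (Suc n) powr (\<gamma>/2) * r n) ^ p * g n"
    if "n \<ge> 1" for n
  proof -
    have "G (Suc n) ^ p * ((r n / A (Suc n)) ^ p * g n) = (real (Suc n) powr (\<gamma>/2) * r n) ^ p * g n"
      using A_pos[of "Suc n"] unfolding G_def by (simp add: power_mult_distrib[symmetric] flip: mult.assoc)
    moreover have "G (Suc n) ^ p = u n ^ p * G n ^ p" using G_Suc[OF that] by (simp add: power_mult_distrib)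
    ultimately show ?thesis by (simp add: algebra_simps)
  qed
  have ul: "(\<lambda>n. real n powr \<gamma> * (1 - u n)) \<longlonglongrightarrow> \<theta>" using ulim unfolding u_def .
  have "(\<lambda>n. (real n powr \<gamma> * (1 - u n)) / real n powr \<gamma>) \<longlonglongrightarrow> 0"
    by (rule tendsto_divide_0[OF ul filterlim_at_top_imp_at_infinity[OF powr_at_top]])
  hence "(\<lambda>n. 1 - u n) \<longlonglongrightarrow> 0"
    by (rule Lim_transform_eventually) (auto simp: eventually_sequentially intro!: exI[of _ 1])
  from tendsto_diff[OF tendsto_const[of 1] this] have u1: "u \<longlonglongrightarrow> 1" by simp
  \<comment> \<open>Factorisation of 1 - u^p; since u tends to 1, the geometric sum contributes the
    factor p.\<close>
  have "(\<lambda>n. (real n powr \<gamma> * (1 - u n)) * (\<Sum>i<p. u n ^ i)) \<longlonglongrightarrow> \<theta> * (\<Sum>i<p. 1 ^ i)"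
    by (intro tendsto_mult ul tendsto_sum tendsto_power u1)
  thus "(\<lambda>n. real n powr \<gamma> * (1 - u n ^ p)) \<longlonglongrightarrow> real p * \<theta>"
    by (simp add: one_diff_power_eq mult.commute mult.left_commute)
qed

text \<open>H is a primitive of x powr (-\<gamma>), up to asymptotic equivalence.\<close>

lemma log_A_ratio:
  assumes inc: "\<And>n. n \<ge> 1 \<Longrightarrow> H n < H (Suc n)" and Hl: "(\<lambda>n. real n powr \<gamma> * (H (Suc n) - H n)) \<longlonglongrightarrow> 1" and e: "\<epsilon> > 0"
  shows "\<forall>\<^sub>F n in sequentially. \<forall>k\<ge>n. \<bar>ln (A n / A k) - c * \<beta> * (H k - H n)\<bar> \<le> \<epsilon> * (H k - H n)"
proof -
  define l where "l = (\<lambda>n. - ln (1 - \<beta> * r n))"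
  have br: "(\<lambda>n. real n powr \<gamma> * (\<beta> * r n)) \<longlonglongrightarrow> \<beta> * c"
    using tendsto_mult_left[OF rlim, of \<beta>] by (simp add: algebra_simps)
  have "(\<lambda>n. real n powr \<gamma> * (\<beta> * r n) / (1 - \<beta> * r n)) \<longlonglongrightarrow> \<beta> * c / (1 - \<beta> * 0)"
    by (intro tendsto_divide br tendsto_diff tendsto_const tendsto_mult r_lim0) simp
  hence br2: "(\<lambda>n. real n powr \<gamma> * (\<beta> * r n) / (1 - \<beta> * r n)) \<longlonglongrightarrow> \<beta> * c" by simp
  have l1: "real n powr \<gamma> * (\<beta> * r n) \<le> real n powr \<gamma> * l n" for n
    using ln_le_minus_one[OF factor_pos[of n]] unfolding l_def by (intro mult_left_mono) auto
  have l2: "real n powr \<gamma> * l n \<le> real n powr \<gamma> * (\<beta> * r n) / (1 - \<beta> * r n)" for n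
  proof -
    have "l n = ln (1 / (1 - \<beta> * r n))" using factor_pos[of n] unfolding l_def by (simp add: ln_div)
    also have "\<dots> \<le> 1 / (1 - \<beta> * r n) - 1" using factor_pos[of n] by (intro ln_le_minus_one) auto
    also have "\<dots> = (\<beta> * r n) / (1 - \<beta> * r n)" using factor_pos[of n] by (simp add: field_simps)
    finally have "real n powr \<gamma> * l n \<le> real n powr \<gamma> * ((\<beta> * r n) / (1 - \<beta> * r n))" by (intro mult_left_mono) auto
    thus ?thesis by simp
  qed
  have ll: "(\<lambda>n. real n powr \<gamma> * l n) \<longlonglongrightarrow> \<beta> * c"
    by (rule real_tendsto_sandwich[OF _ _ br br2]) (intro always_eventually allI l1 l2)+
  \<comment> \<open>Increments of -ln A are compared with those of H one at a time. A relative error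
    per step adds up to \<epsilon> (H k - H n), uniformly in k.\<close>
  have "(\<lambda>n. (real n powr \<gamma> * l n) / (real n powr \<gamma> * (H (Suc n) - H n))) \<longlonglongrightarrow> \<beta> * c / 1"
    by (intro tendsto_divide ll Hl) simp
  hence "\<forall>\<^sub>F n in sequentially. dist ((real n powr \<gamma> * l n) / (real n powr \<gamma> * (H (Suc n) - H n))) (\<beta> * c / 1) < \<epsilon>"
    using e by (rule tendstoD)
  moreover have "\<forall>\<^sub>F n in sequentially. n \<ge> (1::nat)" by (rule eventually_ge_at_top)
  ultimately have "\<forall>\<^sub>F n in sequentially. \<bar>l n - c * \<beta> * (H (Suc n) - H n)\<bar> \<le> \<epsilon> * (H (Suc n) - H n)"
  proof eventually_elim
    case (elim n)
    have p: "real n powr \<gamma> > 0" "H (Suc n) - H n > 0" using elim(2) inc[OF elim(2)] by auto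
    hence "\<bar>l n / (H (Suc n) - H n) - \<beta> * c\<bar> < \<epsilon>" using elim(1) by (simp add: dist_real_def)
    hence "\<bar>l n / (H (Suc n) - H n) - \<beta> * c\<bar> * (H (Suc n) - H n) \<le> \<epsilon> * (H (Suc n) - H n)"
      using p by (intro mult_right_mono) auto
    moreover have "\<bar>l n / (H (Suc n) - H n) - \<beta> * c\<bar> * (H (Suc n) - H n) = \<bar>(l n / (H (Suc n) - H n) - \<beta> * c) * (H (Suc n) - H n)\<bar>"
      using p by (simp add: abs_mult)
    moreover have "(l n / (H (Suc n) - H n) - \<beta> * c) * (H (Suc n) - H n) = l n - c * \<beta> * (H (Suc n) - H n)"
    proof -
      have "(l n / x - \<beta> * c) * x = l n - c * \<beta> * x" if "x > 0" for x using that by (simp add: left_diff_distrib)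
      thus ?thesis using p(2) .
    qed
    ultimately show ?case by simp
  qed
  then obtain n0 where n0: "\<And>n. n \<ge> n0 \<Longrightarrow> \<bar>l n - c * \<beta> * (H (Suc n) - H n)\<bar> \<le> \<epsilon> * (H (Suc n) - H n)"
    by (auto simp: eventually_sequentially)
  have "\<bar>ln (A n / A k) - c * \<beta> * (H k - H n)\<bar> \<le> \<epsilon> * (H k - H n)" if "n \<ge> n0" "k \<ge> n" for n k
    using that(2)
  proof (induction k rule: dec_induct)
    case base show ?case using A_pos[of n] by simp
  next
    case (step k)
    have "ln (A n / A (Suc k)) = ln (A n / A k) + l k"
      using A_pos[of n] A_pos[of k] factor_pos[of k] unfolding A_Suc l_def by (simp add: ln_div ln_mult)
    moreover have "\<bar>l k - c * \<beta> * (H (Suc k) - H k)\<bar> \<le> \<epsilon> * (H (Suc k) - H k)" using n0[of k] step that(1) by simp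
    moreover have "c * \<beta> * (H (Suc k) - H n) = c * \<beta> * (H k - H n) + c * \<beta> * (H (Suc k) - H k)" 
      "\<epsilon> * (H (Suc k) - H n) = \<epsilon> * (H k - H n) + \<epsilon> * (H (Suc k) - H k)" by (simp_all add: algebra_simps)
    ultimately show ?case using step.IH by linarith
  qed
  thus ?thesis unfolding eventually_sequentially by blast
qed

text \<open>\<open>\<psi> t\<close> is the limiting time elapsed between n and
  \<open>\<kappa> n t\<close> on the clock H: t itself for \<gamma> < 1, and ln (1 + t) for \<gamma>
  = 1. Closeness of logarithms is exponentiated; uniformity in t is required because whole paths are
  compared.\<close>

lemma A_weight_uniform:
  fixes \<kappa> :: "nat \<Rightarrow> real \<Rightarrow> nat"
  assumes inc: "\<And>n. n \<ge> 1 \<Longrightarrow> H n < H (Suc n)" and Hl: "(\<lambda>n. real n powr \<gamma> * (H (Suc n) - H n)) \<longlonglongrightarrow> 1"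
    and \<kappa>: "\<And>n t. t \<ge> 0 \<Longrightarrow> \<kappa> n t \<ge> n"
    and D: "\<And>t. t \<in> {0..T} \<Longrightarrow> \<bar>\<psi> t\<bar> \<le> D"
    and un: "\<And>\<epsilon>. \<epsilon> > 0 \<Longrightarrow> \<forall>\<^sub>F n in sequentially. \<forall>t\<in>{0..T}. \<bar>H (\<kappa> n t) - H n - \<psi> t\<bar> \<le> \<epsilon>"
    and e: "\<epsilon> > 0"
  shows "\<forall>\<^sub>F n in sequentially. \<forall>t\<in>{0..T}. \<bar>exp (c * \<beta> * \<psi> t) * A (\<kappa> n t) / A n - 1\<bar> \<le> \<epsilon>"
proof -
  have "(exp \<longlongrightarrow> exp 0) (at (0::real))" using isCont_exp[of "0::real"] by (simp only: isCont_def)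
  from tendstoD[OF this e] obtain d where d: "d > 0" "\<And>x::real. x \<noteq> 0 \<Longrightarrow> dist x 0 < d \<Longrightarrow> dist (exp x) (exp 0) < \<epsilon>"
    unfolding eventually_at by blast
  have d': "\<bar>exp x - 1\<bar> \<le> \<epsilon>" if "\<bar>x\<bar> < d" for x :: real
    using d(2)[of x] that e by (cases "x = 0") (auto simp: dist_real_def)
  define D' where "D' = \<bar>D\<bar> + 1"
  \<comment> \<open>The exponent is off by at most \<eta> c \<beta>, from replacing H k - H n by
    \<open>\<psi> t\<close>, plus \<eta> D', from \<open>log_A_ratio\<close> with H k - H n \<le>
    D'; \<open>d\<close> is the continuity radius of exp at 0.\<close>
  define \<eta> where "\<eta> = min 1 (d / (2 * (c * \<beta> + D')))"
  have cD: "c * \<beta> + D' > 0" using c \<beta> unfolding D'_def by (simp add: add_pos_nonneg)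
  have eta: "\<eta> > 0" "\<eta> \<le> 1" "\<eta> * (c * \<beta> + D') < d"
  proof -
    show "\<eta> > 0" "\<eta> \<le> 1" using d(1) cD unfolding \<eta>_def by auto
    have "\<eta> * (c * \<beta> + D') \<le> d / (2 * (c * \<beta> + D')) * (c * \<beta> + D')" using cD unfolding \<eta>_def by (intro mult_right_mono) auto
    also have "\<dots> = d / 2"
    proof -
      have "d / (2 * x) * x = d / 2" if "x > 0" for x using that by (simp add: field_simps)
      thus ?thesis using cD .
    qed
    finally show "\<eta> * (c * \<beta> + D') < d" using d(1) by simp
  qed
  have lr: "\<forall>\<^sub>F n in sequentially. \<forall>k\<ge>n. \<bar>ln (A n / A k) - c * \<beta> * (H k - H n)\<bar> \<le> \<eta> * (H k - H n)"
    by (rule log_A_ratio) (use inc Hl eta(1) in auto)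
  show ?thesis using un[OF eta(1)] lr
  proof eventually_elim
    case (elim n)
    show ?case
    proof
      fix t assume t: "t \<in> {0..T}"
      define k where "k = \<kappa> n t"
      have 1: "\<bar>H k - H n - \<psi> t\<bar> \<le> \<eta>" using elim(1) t unfolding k_def by blast
      have 2: "\<bar>ln (A n / A k) - c * \<beta> * (H k - H n)\<bar> \<le> \<eta> * (H k - H n)" using elim(2) \<kappa>[of t n] t unfolding k_def by auto
      have "H k - H n \<le> D'" using 1 D[OF t] eta(2) unfolding D'_def by linarith
      hence 3: "\<eta> * (H k - H n) \<le> \<eta> * D'" using eta(1) by (intro mult_left_mono) auto
      have "\<bar>c * \<beta> * (H k - H n) - c * \<beta> * \<psi> t\<bar> = c * \<beta> * \<bar>H k - H n - \<psi> t\<bar>"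
        using c \<beta> by (simp add: right_diff_distrib[symmetric] abs_mult)
      also have "\<dots> \<le> c * \<beta> * \<eta>" using 1 c \<beta> by (intro mult_left_mono) auto
      finally have "\<bar>c * \<beta> * \<psi> t - ln (A n / A k)\<bar> \<le> \<eta> * (c * \<beta> + D')" using 2 3 by (simp add: algebra_simps)
      hence "\<bar>exp (c * \<beta> * \<psi> t - ln (A n / A k)) - 1\<bar> \<le> \<epsilon>" using eta(3) by (intro d') linarith
      moreover have "exp (c * \<beta> * \<psi> t - ln (A n / A k)) = exp (c * \<beta> * \<psi> t) * A k / A n"
        using A_pos[of n] A_pos[of k] by (simp add: exp_diff)
      ultimately show "\<bar>exp (c * \<beta> * \<psi> t) * A (\<kappa> n t) / A n - 1\<bar> \<le> \<epsilon>" unfolding k_def by simp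
    qed
  qed
qed

end

context step_sizes
begin

lemma floor_ratio_tendsto:
  assumes t: "t \<ge> 0" and lim: "(\<lambda>n. (real n + real n powr \<gamma> * t) / real n) \<longlonglongrightarrow> x" and x: "x > 0"
  shows "(\<lambda>n. real n / real (nat \<lfloor>real n + real n powr \<gamma> * t\<rfloor>)) \<longlonglongrightarrow> 1 / x"
proof -
  define k where "k = (\<lambda>n. nat \<lfloor>real n + real n powr \<gamma> * t\<rfloor>)"
  have rk: "real (k n) = real_of_int \<lfloor>real n + real n powr \<gamma> * t\<rfloor>" for n
    unfolding k_def using t by simp
  have "(\<lambda>n. 1 / real n) \<longlonglongrightarrow> 0" by real_asymp
  from tendsto_diff[OF lim this] have lo: "(\<lambda>n. (real n + real n powr \<gamma> * t) / real n - 1 / real n) \<longlonglongrightarrow> x" by simp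
  have "(\<lambda>n. real (k n) / real n) \<longlonglongrightarrow> x"
  proof (rule real_tendsto_sandwich[OF _ _ lo lim])
    have "(real n + real n powr \<gamma> * t) / real n - 1 / real n \<le> real (k n) / real n" for n
      unfolding diff_divide_distrib[symmetric] rk by (intro divide_right_mono) linarith+
    thus "\<forall>\<^sub>F n in sequentially. (real n + real n powr \<gamma> * t) / real n - 1 / real n \<le> real (k n) / real n" by simp
    have "real (k n) / real n \<le> (real n + real n powr \<gamma> * t) / real n" for n
      unfolding rk by (intro divide_right_mono) linarith+
    thus "\<forall>\<^sub>F n in sequentially. real (k n) / real n \<le> (real n + real n powr \<gamma> * t) / real n" by simp
  qed
  from tendsto_divide[OF tendsto_const[of 1] this] x show ?thesis unfolding k_def by simp
qed

text \<open>G n / G k splits into (n/k)^(\<gamma>/2) and A n / A k, the latter tending to the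
  weight. The former matters only when \<gamma> = 1, where k is of the order (1 + t) n.\<close>

lemma G_ratio_tendsto:
  fixes wt :: "real \<Rightarrow> real" and t :: real
  assumes t: "t \<ge> 0" and w: "\<And>\<epsilon>. \<epsilon> > 0 \<Longrightarrow> \<forall>\<^sub>F n in sequentially. \<forall>s\<in>{0..t}. \<bar>wt s * A (k n s) / A n - 1\<bar> \<le> \<epsilon>"
    and wt: "wt t > 0" and k: "(\<lambda>n. real n / real (k n t)) \<longlonglongrightarrow> x" and x: "x > 0"
  shows "(\<lambda>n. G n / G (k n t)) \<longlonglongrightarrow> x powr (\<gamma>/2) * wt t"
proof -
  have "(\<lambda>n. wt t * A (k n t) / A n) \<longlonglongrightarrow> 1"
  proof (rule tendstoI)
    fix e :: real assume "e > 0"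
    hence "e / 2 > 0" by simp
    from w[OF this] show "\<forall>\<^sub>F n in sequentially. dist (wt t * A (k n t) / A n) 1 < e"
    proof eventually_elim
      case (elim n)
      hence "\<bar>wt t * A (k n t) / A n - 1\<bar> \<le> e / 2" by (rule bspec) (use t in simp)
      thus ?case using \<open>e > 0\<close> unfolding dist_real_def by linarith
    qed
  qed
  from tendsto_divide[OF tendsto_const[of "wt t"] this] have l: "(\<lambda>n. wt t / (wt t * A (k n t) / A n)) \<longlonglongrightarrow> wt t" by simp
  have "wt t / (wt t * A (k n t) / A n) = A n / A (k n t)" for n
    using wt A_pos[of "k n t"] A_pos[of n] by (simp add: field_simps)
  hence l: "(\<lambda>n. A n / A (k n t)) \<longlonglongrightarrow> wt t" using l by simp
  have "(\<lambda>n. (real n / real (k n t)) powr (\<gamma>/2) * (A n / A (k n t))) \<longlonglongrightarrow> x powr (\<gamma>/2) * wt t"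
    by (intro tendsto_mult tendsto_powr k l tendsto_const) (use x in simp)
  moreover have "(real n / real (k n t)) powr (\<gamma>/2) * (A n / A (k n t)) = G n / G (k n t)" for n
    unfolding G_def by (simp add: powr_divide)
  ultimately show ?thesis by simp
qed

end

section \<open>Decay rate and time scale in the two regimes\<close>

lemma ulim_subcritical:
  assumes g: "0 < \<gamma>" "\<gamma> < 1" and rl: "(\<lambda>n. real n powr \<gamma> * r n) \<longlonglongrightarrow> c"
  shows "(\<lambda>n. real n powr \<gamma> * (1 - (1 + 1 / real n) powr (\<gamma>/2) * (1 - \<beta> * r n))) \<longlonglongrightarrow> c * \<beta>"
proof -
  have 1: "(\<lambda>n. real n powr \<gamma> * (1 - (1 + 1 / real n) powr (\<gamma>/2))) \<longlonglongrightarrow> 0" using g by real_asymp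
  have 2: "(\<lambda>n. (1 + 1 / real n) powr (\<gamma>/2)) \<longlonglongrightarrow> 1" by real_asymp
  have "(\<lambda>n. real n powr \<gamma> * (1 - (1 + 1 / real n) powr (\<gamma>/2)) + (1 + 1 / real n) powr (\<gamma>/2) * (\<beta> * (real n powr \<gamma> * r n))) \<longlonglongrightarrow> 0 + 1 * (\<beta> * c)"
    by (intro tendsto_add tendsto_mult tendsto_const 1 2 rl)
  thus ?thesis by (simp add: algebra_simps)
qed

text \<open>n (1 - sqrt (1 + 1/n)) tends to -1/2: at \<gamma> = 1 the growth of n^(1/2) competes
  with the decay of A at the same order. This produces the threshold 2 c \<beta> = 1.\<close>

lemma ulim_critical:
  assumes rl: "(\<lambda>n. real n powr 1 * r n) \<longlonglongrightarrow> c"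
  shows "(\<lambda>n. real n powr 1 * (1 - (1 + 1 / real n) powr (1/2) * (1 - \<beta> * r n))) \<longlonglongrightarrow> c * \<beta> - 1/2"
proof -
  have 1: "(\<lambda>n. real n powr 1 * (1 - (1 + 1 / real n) powr (1/2))) \<longlonglongrightarrow> - 1/2" by real_asymp
  have 2: "(\<lambda>n. (1 + 1 / real n) powr (1/2)) \<longlonglongrightarrow> 1" by real_asymp
  have "(\<lambda>n. real n powr 1 * (1 - (1 + 1 / real n) powr (1/2)) + (1 + 1 / real n) powr (1/2) * (\<beta> * (real n powr 1 * r n))) \<longlonglongrightarrow> - 1/2 + 1 * (\<beta> * c)"
    by (intro tendsto_add tendsto_mult tendsto_const 1 2 rl)
  thus ?thesis by (simp add: algebra_simps)
qed

lemma powr_primitive_bounds: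
  fixes x y \<gamma> :: real
  assumes g: "0 < \<gamma>" "\<gamma> < 1" and xy: "0 < x" "x \<le> y"
  shows "(y - x) * y powr (-\<gamma>) \<le> y powr (1-\<gamma>) / (1-\<gamma>) - x powr (1-\<gamma>) / (1-\<gamma>)"
    "y powr (1-\<gamma>) / (1-\<gamma>) - x powr (1-\<gamma>) / (1-\<gamma>) \<le> (y - x) * x powr (-\<gamma>)"
proof -
  have "(y - x) * y powr (-\<gamma>) \<le> y powr (1-\<gamma>) / (1-\<gamma>) - x powr (1-\<gamma>) / (1-\<gamma>) \<and>
    y powr (1-\<gamma>) / (1-\<gamma>) - x powr (1-\<gamma>) / (1-\<gamma>) \<le> (y - x) * x powr (-\<gamma>)"
  proof (cases "x = y")
    case False
    hence "x < y" using xy by simp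
    moreover have "((\<lambda>z. z powr (1-\<gamma>) / (1-\<gamma>)) has_real_derivative z powr (-\<gamma>)) (at z)" if "x \<le> z" for z
      using that xy g by (auto intro!: derivative_eq_intros)
    ultimately obtain z where z: "x < z" "z < y" "y powr (1-\<gamma>) / (1-\<gamma>) - x powr (1-\<gamma>) / (1-\<gamma>) = (y - x) * z powr (-\<gamma>)"
      using MVT2[of x y "\<lambda>z. z powr (1-\<gamma>) / (1-\<gamma>)" "\<lambda>z. z powr (-\<gamma>)"] by blast
    have "y powr (-\<gamma>) \<le> z powr (-\<gamma>)" "z powr (-\<gamma>) \<le> x powr (-\<gamma>)" using z xy g by (auto intro!: powr_mono2')
    thus ?thesis unfolding z(3) using xy by (auto intro!: mult_left_mono)
  qed simp
  thus "(y - x) * y powr (-\<gamma>) \<le> y powr (1-\<gamma>) / (1-\<gamma>) - x powr (1-\<gamma>) / (1-\<gamma>)"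
    "y powr (1-\<gamma>) / (1-\<gamma>) - x powr (1-\<gamma>) / (1-\<gamma>) \<le> (y - x) * x powr (-\<gamma>)" by blast+
qed

lemma floor_index_bounds:
  fixes n :: nat and \<gamma> t T :: real
  assumes t: "0 \<le> t" "t \<le> T"
  defines "k \<equiv> nat \<lfloor>real n + real n powr \<gamma> * t\<rfloor>"
  shows "real n \<le> real k" "real k \<le> real n + real n powr \<gamma> * t" "real n + real n powr \<gamma> * t - 1 \<le> real k"
    "real k \<le> real n + real n powr \<gamma> * T"
proof -
  have p: "real n powr \<gamma> * t \<ge> 0" "real n powr \<gamma> * t \<le> real n powr \<gamma> * T" using t by (auto intro: mult_left_mono)
  have rk: "real k = real_of_int \<lfloor>real n + real n powr \<gamma> * t\<rfloor>" unfolding k_def using p by simp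
  have "real n \<le> real n + real n powr \<gamma> * t" using p by simp
  hence "n \<le> k" unfolding k_def by (rule le_nat_floor)
  thus "real n \<le> real k" by simp
  show "real k \<le> real n + real n powr \<gamma> * t" "real n + real n powr \<gamma> * t - 1 \<le> real k" unfolding rk by linarith+
  thus "real k \<le> real n + real n powr \<gamma> * T" using p by linarith
qed

text \<open>As n^\<gamma> T is of smaller order than n, the derivative x^(-\<gamma>) of the clock is
  nearly n^(-\<gamma>) on the whole window, so n^\<gamma> t steps advance the clock by t.\<close>

lemma time_scale_subcritical:
  assumes g: "0 < \<gamma>" "\<gamma> < 1" and T: "T > 0" and e: "\<epsilon> > 0"
  shows "\<forall>\<^sub>F n in sequentially. \<forall>t\<in>{0..T}.
    \<bar>real (nat \<lfloor>real n + real n powr \<gamma> * t\<rfloor>) powr (1-\<gamma>) / (1-\<gamma>) - real n powr (1-\<gamma>) / (1-\<gamma>) - t\<bar> \<le> \<epsilon>"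
proof -
  \<comment> \<open>Smallest value of the derivative on the window, which makes the estimate uniform
    in t. The error is T (1 - n^\<gamma> Q n) from its variation and Q n from the floor.\<close>
  define Q where "Q = (\<lambda>n. (real n + real n powr \<gamma> * T) powr (-\<gamma>))"
  have "(\<lambda>n. T * (1 - real n powr \<gamma> * Q n) + Q n) \<longlonglongrightarrow> 0" unfolding Q_def using g T by real_asymp
  hence "\<forall>\<^sub>F n in sequentially. T * (1 - real n powr \<gamma> * Q n) + Q n < \<epsilon>" using e by (rule order_tendstoD)
  moreover have "\<forall>\<^sub>F n in sequentially. n \<ge> (1::nat)" by (rule eventually_ge_at_top)
  ultimately show ?thesis
  proof eventually_elim
    case (elim n)
    show ?case
    proof
      fix t assume t: "t \<in> {0..T}"
      define k where "k = nat \<lfloor>real n + real n powr \<gamma> * t\<rfloor>"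
      have n: "real n > 0" using elim(2) by simp
      have tb: "0 \<le> t" "t \<le> T" using t by auto
      note kb = floor_index_bounds[OF tb, where n=n and \<gamma>=\<gamma>, folded k_def]
      note pb = powr_primitive_bounds[OF g n kb(1)]
      have nn: "real n powr \<gamma> * real n powr (-\<gamma>) = 1" using n by (simp add: powr_add[symmetric])
      have "(real k - real n) * real n powr (-\<gamma>) \<le> (real n powr \<gamma> * t) * real n powr (-\<gamma>)"
        using kb(2) by (intro mult_right_mono) auto
      also have "\<dots> = t" using nn by (simp add: mult.commute mult.left_commute)
      finally have up: "real k powr (1-\<gamma>) / (1-\<gamma>) - real n powr (1-\<gamma>) / (1-\<gamma>) \<le> t" using pb(2) by linarith
      have Q0: "0 \<le> Q n" unfolding Q_def by simp
      have Qk: "Q n \<le> real k powr (-\<gamma>)" unfolding Q_def using kb n g by (intro powr_mono2') auto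
      have "(real n powr \<gamma> * t - 1) * Q n \<le> (real k - real n) * Q n" using kb(3) Q0 by (intro mult_right_mono) auto
      also have "\<dots> \<le> (real k - real n) * real k powr (-\<gamma>)" using kb(1) Qk by (intro mult_left_mono) auto
      finally have lo: "(real n powr \<gamma> * t - 1) * Q n \<le> real k powr (1-\<gamma>) / (1-\<gamma>) - real n powr (1-\<gamma>) / (1-\<gamma>)" using pb(1) by linarith
      have "real n powr \<gamma> * Q n \<le> real n powr \<gamma> * real n powr (-\<gamma>)"
        unfolding Q_def using n g T by (intro mult_left_mono powr_mono2') auto
      hence "1 - real n powr \<gamma> * Q n \<ge> 0" using nn by simp
      hence "t * (1 - real n powr \<gamma> * Q n) \<le> T * (1 - real n powr \<gamma> * Q n)" using tb by (intro mult_right_mono) auto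
      moreover have "t - (real n powr \<gamma> * t - 1) * Q n = t * (1 - real n powr \<gamma> * Q n) + Q n" by (simp add: algebra_simps)
      ultimately have "t - (real n powr \<gamma> * t - 1) * Q n < \<epsilon>" using elim(1) by linarith
      thus "\<bar>real (nat \<lfloor>real n + real n powr \<gamma> * t\<rfloor>) powr (1-\<gamma>) / (1-\<gamma>) - real n powr (1-\<gamma>) / (1-\<gamma>) - t\<bar> \<le> \<epsilon>"
        using up lo e unfolding k_def[symmetric] by linarith
    qed
  qed
qed

text \<open>Without the floor the difference of logarithms is exactly ln (1 + t). The floor lowers
  the argument by at most 1, hence the logarithm by at most 1/n, for all t at once.\<close>

lemma time_scale_critical:
  assumes e: "\<epsilon> > 0"
  shows "\<forall>\<^sub>F n in sequentially. \<forall>t\<in>{0..T}. \<bar>ln (real (nat \<lfloor>real n + real n powr 1 * t\<rfloor>)) - ln (real n) - ln (1 + t)\<bar> \<le> \<epsilon>"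
proof -
  have "(\<lambda>n. 1 / real n) \<longlonglongrightarrow> 0" by real_asymp
  hence "\<forall>\<^sub>F n in sequentially. 1 / real n < \<epsilon>" using e by (rule order_tendstoD)
  moreover have "\<forall>\<^sub>F n in sequentially. n \<ge> (1::nat)" by (rule eventually_ge_at_top)
  ultimately show ?thesis
  proof eventually_elim
    case (elim n)
    show ?case
    proof
      fix t assume t: "t \<in> {0..T}"
      define k where "k = nat \<lfloor>real n + real n powr 1 * t\<rfloor>"
      have n: "real n > 0" using elim(2) by simp
      have tb: "0 \<le> t" "t \<le> T" using t by auto
      note kb = floor_index_bounds[OF tb, where n=n and \<gamma>=1, folded k_def]
      have k: "real k > 0" using kb(1) n by linarith
      have m: "real n * (1 + t) = real n + real n powr 1 * t" by (simp add: distrib_left)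
      have pos: "real n * (1 + t) > 0" using n tb by simp
      have eq: "ln (real n) + ln (1 + t) = ln (real n * (1 + t))" using n tb by (simp add: ln_mult)
      have "ln (real k) \<le> ln (real n * (1 + t))" unfolding m using kb(2) k by (intro ln_mono) auto
      moreover have "ln (real n * (1 + t)) - ln (real k) \<le> 1 / real n"
      proof -
        have "ln (real n * (1 + t)) - ln (real k) = ln (real n * (1 + t) / real k)"
        proof -
          have "ln y - ln x = ln (y / x)" if "y > 0" "x > 0" for x y :: real using that by (simp add: ln_div)
          thus ?thesis using pos k .
        qed
        also have "\<dots> \<le> real n * (1 + t) / real k - 1" using pos k by (intro ln_le_minus_one) simp
        also have "\<dots> = (real n * (1 + t) - real k) / real k" using k by (simp add: field_simps)
        also have "\<dots> \<le> 1 / real k" using kb(3) k unfolding m by (intro divide_right_mono) auto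
        also have "\<dots> \<le> 1 / real n" using kb(1) n by (intro divide_left_mono) auto
        finally show ?thesis .
      qed
      ultimately show "\<bar>ln (real (nat \<lfloor>real n + real n powr 1 * t\<rfloor>)) - ln (real n) - ln (1 + t)\<bar> \<le> \<epsilon>"
        using elim(1) eq unfolding k_def[symmetric] by linarith
    qed
  qed
qed

section \<open>The reinforced process\<close>

locale reinforcement = prob_space M for M :: "'a measure" +
  fixes Z I :: "nat \<Rightarrow> nat \<Rightarrow> 'a \<Rightarrow> real" and N :: nat and \<rho> \<alpha> q :: real and r :: "nat \<Rightarrow> real" and i :: nat
  assumes N: "N \<ge> 1" and rho: "0 \<le> \<rho>" "\<rho> < 1" and alpha: "0 \<le> \<alpha>" "\<alpha> \<le> 1" and q: "0 < q" "q < 1"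
    and r: "\<And>n. 0 \<le> r n \<and> r n < 1"
    and Zmeas: "\<And>n j. j \<in> {1..N} \<Longrightarrow> Z n j \<in> borel_measurable M"
    and Zrange: "\<And>n j \<omega>. j \<in> {1..N} \<Longrightarrow> \<omega> \<in> space M \<Longrightarrow> 0 \<le> Z n j \<omega> \<and> Z n j \<omega> \<le> 1"
    and Imeas: "\<And>n j. j \<in> {1..N} \<Longrightarrow> I (Suc n) j \<in> borel_measurable M"
    and Irange: "\<And>n j \<omega>. j \<in> {1..N} \<Longrightarrow> \<omega> \<in> space M \<Longrightarrow> I (Suc n) j \<omega> \<in> {0, 1}"
    and recur: "\<And>n j \<omega>. j \<in> {1..N} \<Longrightarrow> \<omega> \<in> space M \<Longrightarrow>
        Z (Suc n) j \<omega> = (1 - r n) * Z n j \<omega> + r n * (\<rho> * I (Suc n) j \<omega> + (1 - \<rho>) * q)"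
    and condindep: "\<And>n S (a :: nat \<Rightarrow> real). S \<subseteq> {1..N} \<Longrightarrow>
        AE \<omega> in M. real_cond_exp M (Filt M N Z n)
            (\<lambda>\<omega>. \<Prod>j\<in>S. indicator {\<omega>. I (Suc n) j \<omega> = a j} \<omega>) \<omega>
          = (\<Prod>j\<in>S. real_cond_exp M (Filt M N Z n) (indicator {\<omega>. I (Suc n) j \<omega> = a j}) \<omega>)"
    and condprob: "\<And>n j. j \<in> {1..N} \<Longrightarrow>
        AE \<omega> in M. real_cond_exp M (Filt M N Z n) (indicator {\<omega>. I (Suc n) j \<omega> = 1}) \<omega>
          = (1 - \<alpha>) * Z n j \<omega> + \<alpha> * Zbar N Z n \<omega>"
    and i: "i \<in> {1..N}"
begin

abbreviation F :: "nat \<Rightarrow> 'a measure" where "F \<equiv> Filt M N Z"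

definition p :: "nat \<Rightarrow> nat \<Rightarrow> 'a \<Rightarrow> real" where "p n j \<omega> = (1 - \<alpha>) * Z n j \<omega> + \<alpha> * Zbar N Z n \<omega>"

lemma subalgebra_F: "subalgebra M (F n)"
proof -
  have sub: "{Z k j -` B \<inter> space M | k j B. k \<le> n \<and> j \<in> {1..N} \<and> B \<in> sets borel} \<subseteq> sets M"
    using Zmeas by (auto intro: measurable_sets)
  hence "{Z k j -` B \<inter> space M | k j B. k \<le> n \<and> j \<in> {1..N} \<and> B \<in> sets borel} \<subseteq> Pow (space M)"
    using sets.sets_into_space by blast
  thus ?thesis unfolding subalgebra_def Filt_def
    using sets.sigma_sets_subset[OF sub] by (simp add: sets_measure_of space_measure_of)
qed

lemma space_F [simp]: "space (F n) = space M"
  using subalgebra_F[of n] by (simp add: subalgebra_def)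

lemma bfun_Z:
  assumes "k \<le> n" "j \<in> {1..N}" shows "bfun M (F n) (Z k j)"
proof (rule bfunI[where B=1])
  have P: "{Z k j -` B \<inter> space M | k j B. k \<le> n \<and> j \<in> {1..N} \<and> B \<in> sets borel} \<subseteq> Pow (space M)" by auto
  show "Z k j \<in> borel_measurable (F n)"
  proof (rule measurableI)
    fix B :: "real set" assume "B \<in> sets borel"
    hence "Z k j -` B \<inter> space M \<in> {Z k j -` B \<inter> space M | k j B. k \<le> n \<and> j \<in> {1..N} \<and> B \<in> sets borel}"
      using assms by blast
    thus "Z k j -` B \<inter> space (F n) \<in> sets (F n)"
      unfolding space_F unfolding Filt_def sets_measure_of[OF P] by (rule sigma_sets.Basic)
  qed simp
  show "\<bar>Z k j \<omega>\<bar> \<le> 1" if "\<omega> \<in> space M" for \<omega> using Zrange[OF assms(2) that, of k] by simp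
qed

lemma bfun_Zbar: "k \<le> n \<Longrightarrow> bfun M (F n) (Zbar N Z k)"
  using bfun_cmult[OF bfun_sum[of "{1..N}" M "F n" "Z k"], of "1 / real N"] bfun_Z
  unfolding Zbar_def by simp

lemma bfun_p: "k \<le> n \<Longrightarrow> j \<in> {1..N} \<Longrightarrow> bfun M (F n) (p k j)"
  unfolding p_def by (intro bfun_intros bfun_Z bfun_Zbar)

lemma bfun_I: "j \<in> {1..N} \<Longrightarrow> bfun M M (I (Suc n) j)"
proof (rule bfunI[where B=1, OF Imeas])
  fix \<omega> assume "j \<in> {1..N}" "\<omega> \<in> space M"
  from Irange[OF this, of n] show "\<bar>I (Suc n) j \<omega>\<bar> \<le> 1" by auto
qed

lemma Zbar_range: "\<omega> \<in> space M \<Longrightarrow> 0 \<le> Zbar N Z n \<omega> \<and> Zbar N Z n \<omega> \<le> 1"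
proof -
  assume w: "\<omega> \<in> space M"
  have "(\<Sum>j=1..N. Z n j \<omega>) \<le> (\<Sum>j=1..N. 1)" by (intro sum_mono) (use Zrange w in auto)
  moreover have "(\<Sum>j=1..N. Z n j \<omega>) \<ge> 0" by (intro sum_nonneg) (use Zrange w in auto)
  ultimately show ?thesis using N unfolding Zbar_def by (simp add: field_simps)
qed

lemma p_range: "\<omega> \<in> space M \<Longrightarrow> j \<in> {1..N} \<Longrightarrow> 0 \<le> p n j \<omega> \<and> p n j \<omega> \<le> 1"
proof -
  assume w: "\<omega> \<in> space M" "j \<in> {1..N}"
  note z = Zrange[OF w(2,1), of n] Zbar_range[OF w(1), of n]
  have "(1 - \<alpha>) * Z n j \<omega> \<le> (1 - \<alpha>) * 1" "\<alpha> * Zbar N Z n \<omega> \<le> \<alpha> * 1"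
    "0 \<le> (1 - \<alpha>) * Z n j \<omega>" "0 \<le> \<alpha> * Zbar N Z n \<omega>"
    using z alpha by (auto intro!: mult_left_mono simp del: mult_1_right)
  thus ?thesis unfolding p_def using add_mono[of "(1 - \<alpha>) * Z n j \<omega>" "(1 - \<alpha>) * 1" "\<alpha> * Zbar N Z n \<omega>" "\<alpha> * 1"] by simp
qed

text \<open>The passage from conditional expectations to plain expectations against bounded
  \<open>F n\<close>-measurable factors, as I is the indicator of I = 1. One-element S gives
  conditional means, two-element S covariances.\<close>

lemma cond_expectation:
  assumes g: "bfun M (F n) g" and S: "S \<subseteq> {1..N}"
  shows "expectation (\<lambda>\<omega>. g \<omega> * (\<Prod>j\<in>S. I (Suc n) j \<omega>)) = expectation (\<lambda>\<omega>. g \<omega> * (\<Prod>j\<in>S. p n j \<omega>))"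
proof -
  interpret fs: finite_measure_subalgebra M "F n" by unfold_locales (rule subalgebra_F)
  have fin: "finite S" using S by (rule finite_subset) simp
  define f where "f = (\<lambda>\<omega>. \<Prod>j\<in>S. indicator {\<omega>. I (Suc n) j \<omega> = 1} \<omega> :: real)"
  have ind: "indicator {\<omega>. I (Suc n) j \<omega> = 1} \<omega> = I (Suc n) j \<omega>" if "\<omega> \<in> space M" "j \<in> {1..N}" for \<omega> j
    using Irange[OF that(2,1), of n] by (auto simp: indicator_def)
  have fI: "f \<omega> = (\<Prod>j\<in>S. I (Suc n) j \<omega>)" if "\<omega> \<in> space M" for \<omega>
    unfolding f_def by (rule prod.cong) (use ind that S in auto)
  have "bfun M M (\<lambda>\<omega>. \<Prod>j\<in>S. I (Suc n) j \<omega>)"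
    by (rule bfun_prod) (use S in \<open>auto intro!: bfun_I\<close>)
  hence fm: "bfun M M f" unfolding bfun_def using fI by (auto cong: measurable_cong)
  have gM: "bfun M M g" by (rule bfun_subalgebra[OF subalgebra_F g])
  have bp: "bfun M (F n) (\<lambda>\<omega>. \<Prod>j\<in>S. p n j \<omega>)"
    by (rule bfun_prod) (use S in \<open>auto intro!: bfun_p\<close>)
  have bpM: "bfun M M (\<lambda>\<omega>. \<Prod>j\<in>S. p n j \<omega>)" by (rule bfun_subalgebra[OF subalgebra_F bp])
  have "expectation (\<lambda>\<omega>. g \<omega> * (\<Prod>j\<in>S. I (Suc n) j \<omega>)) = expectation (\<lambda>\<omega>. g \<omega> * f \<omega>)"
    by (rule Bochner_Integration.integral_cong) (auto simp: fI)
  also have "\<dots> = expectation (\<lambda>\<omega>. g \<omega> * real_cond_exp M (F n) f \<omega>)"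
    by (rule fs.real_cond_exp_intg(2)[symmetric])
       (use bfun_integrable[OF bfun_mult[OF gM fm]] g fm in \<open>auto simp: bfun_def\<close>)
  also have "\<dots> = expectation (\<lambda>\<omega>. g \<omega> * (\<Prod>j\<in>S. p n j \<omega>))"
  proof (rule integral_cong_AE)
    have "AE \<omega> in M. \<forall>j\<in>S. real_cond_exp M (F n) (indicator {\<omega>. I (Suc n) j \<omega> = 1}) \<omega> = p n j \<omega>"
      using fin S condprob unfolding p_def by (intro AE_finite_allI) auto
    moreover have "AE \<omega> in M. real_cond_exp M (F n) f \<omega> = (\<Prod>j\<in>S. real_cond_exp M (F n) (indicator {\<omega>. I (Suc n) j \<omega> = 1}) \<omega>)"
      unfolding f_def by (rule condindep[OF S])
    ultimately show "AE \<omega> in M. g \<omega> * real_cond_exp M (F n) f \<omega> = g \<omega> * (\<Prod>j\<in>S. p n j \<omega>)"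
      by eventually_elim simp
    show "(\<lambda>\<omega>. g \<omega> * real_cond_exp M (F n) f \<omega>) \<in> borel_measurable M"
      using gM by (auto simp: bfun_def)
    show "(\<lambda>\<omega>. g \<omega> * (\<Prod>j\<in>S. p n j \<omega>)) \<in> borel_measurable M"
      using bfun_mult[OF gM bpM] by (auto simp: bfun_def)
  qed
  finally show ?thesis .
qed

definition e :: "nat \<Rightarrow> nat \<Rightarrow> 'a \<Rightarrow> real" where "e n j \<omega> = I (Suc n) j \<omega> - p n j \<omega>"

lemma bfun_e: "j \<in> {1..N} \<Longrightarrow> bfun M M (e n j)"
  unfolding e_def by (intro bfun_diff bfun_I bfun_subalgebra[OF subalgebra_F bfun_p[OF order_refl]])

lemma e_mean:
  assumes g: "bfun M (F n) g" and j: "j \<in> {1..N}" shows "expectation (\<lambda>\<omega>. g \<omega> * e n j \<omega>) = 0"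
proof -
  note gM = bfun_subalgebra[OF subalgebra_F g] and pM = bfun_subalgebra[OF subalgebra_F bfun_p[OF order_refl j, of n]]
  have "expectation (\<lambda>\<omega>. g \<omega> * e n j \<omega>) = expectation (\<lambda>\<omega>. g \<omega> * I (Suc n) j \<omega>) - expectation (\<lambda>\<omega>. g \<omega> * p n j \<omega>)"
    unfolding e_def using bfun_integrable[OF bfun_mult[OF gM bfun_I[OF j]]] bfun_integrable[OF bfun_mult[OF gM pM]]
    by (simp add: right_diff_distrib)
  thus ?thesis using cond_expectation[OF g, of "{j}"] j by simp
qed

text \<open>On the diagonal I^2 = I produces the Bernoulli variance; off it, conditional
  independence makes the mixed moment factor.\<close>

lemma e_cov:
  assumes g: "bfun M (F n) g" and j: "j \<in> {1..N}" "k \<in> {1..N}"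
  shows "expectation (\<lambda>\<omega>. g \<omega> * (e n j \<omega> * e n k \<omega>)) = (if j = k then expectation (\<lambda>\<omega>. g \<omega> * (p n j \<omega> * (1 - p n j \<omega>))) else 0)"
proof -
  have gM: "bfun M M g" by (rule bfun_subalgebra[OF subalgebra_F g])
  have pF: "bfun M (F n) (p n l)" and pM: "bfun M M (p n l)" if "l \<in> {1..N}" for l
    using bfun_p[OF order_refl that, of n] bfun_subalgebra[OF subalgebra_F] by blast+
  have gp: "bfun M (F n) (\<lambda>\<omega>. g \<omega> * p n k \<omega>)" by (rule bfun_mult[OF g pF[OF j(2)]])
  have i1: "integrable M (\<lambda>\<omega>. g \<omega> * I (Suc n) j \<omega> * e n k \<omega>)"
    by (intro bfun_integrable bfun_mult gM bfun_I bfun_e j)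
  have i2: "integrable M (\<lambda>\<omega>. g \<omega> * p n j \<omega> * e n k \<omega>)"
    by (intro bfun_integrable bfun_mult gM pM bfun_e j)
  have z: "expectation (\<lambda>\<omega>. g \<omega> * p n j \<omega> * e n k \<omega>) = 0" by (rule e_mean[OF bfun_mult[OF g pF[OF j(1)]] j(2)])
  have s: "expectation (\<lambda>\<omega>. g \<omega> * p n k \<omega> * I (Suc n) j \<omega>) = expectation (\<lambda>\<omega>. g \<omega> * p n k \<omega> * p n j \<omega>)"
    using cond_expectation[OF gp, of "{j}"] j by simp
  have i3: "integrable M (\<lambda>\<omega>. g \<omega> * p n k \<omega> * I (Suc n) j \<omega>)"
    by (intro bfun_integrable bfun_mult gM pM bfun_I j)
  have i4: "integrable M (\<lambda>\<omega>. g \<omega> * (I (Suc n) j \<omega> * I (Suc n) k \<omega>))"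
    by (intro bfun_integrable bfun_mult gM bfun_I j)
  have "expectation (\<lambda>\<omega>. g \<omega> * (e n j \<omega> * e n k \<omega>)) = expectation (\<lambda>\<omega>. g \<omega> * I (Suc n) j \<omega> * e n k \<omega> - g \<omega> * p n j \<omega> * e n k \<omega>)"
    by (simp add: e_def algebra_simps)
  also have "\<dots> = expectation (\<lambda>\<omega>. g \<omega> * I (Suc n) j \<omega> * e n k \<omega>)" using i1 i2 z by simp
  also have "\<dots> = expectation (\<lambda>\<omega>. g \<omega> * (I (Suc n) j \<omega> * I (Suc n) k \<omega>) - g \<omega> * p n k \<omega> * I (Suc n) j \<omega>)"
    by (simp add: e_def algebra_simps)
  also have "\<dots> = expectation (\<lambda>\<omega>. g \<omega> * (I (Suc n) j \<omega> * I (Suc n) k \<omega>)) - expectation (\<lambda>\<omega>. g \<omega> * p n k \<omega> * p n j \<omega>)"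
    using i3 i4 s by simp
  finally have *: "expectation (\<lambda>\<omega>. g \<omega> * (e n j \<omega> * e n k \<omega>)) = \<dots>" .
  show ?thesis
  proof (cases "j = k")
    case True
    have "expectation (\<lambda>\<omega>. g \<omega> * (I (Suc n) j \<omega> * I (Suc n) k \<omega>)) = expectation (\<lambda>\<omega>. g \<omega> * I (Suc n) j \<omega>)"
      by (rule Bochner_Integration.integral_cong) (use Irange[OF j(1)] True in auto)
    also have "\<dots> = expectation (\<lambda>\<omega>. g \<omega> * p n j \<omega>)" using cond_expectation[OF g, of "{j}"] j by simp
    finally have "expectation (\<lambda>\<omega>. g \<omega> * (e n j \<omega> * e n k \<omega>)) = expectation (\<lambda>\<omega>. g \<omega> * p n j \<omega>) - expectation (\<lambda>\<omega>. g \<omega> * p n k \<omega> * p n j \<omega>)"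
      using * by simp
    also have "\<dots> = expectation (\<lambda>\<omega>. g \<omega> * p n j \<omega> - g \<omega> * p n k \<omega> * p n j \<omega>)"
      by (rule Bochner_Integration.integral_diff[symmetric]) (intro bfun_integrable bfun_mult gM pM j)+
    finally show ?thesis using True by (simp add: algebra_simps)
  next
    case False
    thus ?thesis using * cond_expectation[OF g, of "{j, k}"] j by (simp add: mult.assoc mult.commute mult.left_commute)
  qed
qed

end

section \<open>Mean-square convergence to q\<close>

lemma convex_square:
  fixes a x y :: real
  assumes "0 \<le> a" "a \<le> 1" shows "((1 - a) * x + a * y)\<^sup>2 \<le> (1 - a) * x\<^sup>2 + a * y\<^sup>2"
proof -
  have "(1 - a) * x\<^sup>2 + a * y\<^sup>2 - ((1 - a) * x + a * y)\<^sup>2 = a * (1 - a) * (x - y)\<^sup>2"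
    by (simp add: power2_eq_square algebra_simps)
  moreover have "\<dots> \<ge> 0" using assms by simp
  ultimately show ?thesis by linarith
qed

context reinforcement
begin

lemma p_diff_q: "p n j \<omega> - q = (1 - \<alpha>) * (Z n j \<omega> - q) + \<alpha> * (Zbar N Z n \<omega> - q)"
  unfolding p_def by (simp add: algebra_simps)

lemma Zbar_diff_q: "Zbar N Z n \<omega> - q = (\<Sum>j=1..N. Z n j \<omega> - q) / real N"
  unfolding Zbar_def using N by (simp add: sum_subtractf field_simps)

text \<open>p - q is a convex combination of Z - q and the mean b of these deviations. Convexity of
  the square does not increase the sum, and neither does averaging, by positivity of the sum of (Z -
  q - b)^2.\<close>

lemma sum_p_square: "(\<Sum>j=1..N. (p n j \<omega> - q)\<^sup>2) \<le> (\<Sum>j=1..N. (Z n j \<omega> - q)\<^sup>2)"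
proof -
  define S where "S = (\<Sum>j=1..N. (Z n j \<omega> - q)\<^sup>2)"
  define b where "b = Zbar N Z n \<omega> - q"
  have b: "real N * b = (\<Sum>j=1..N. Z n j \<omega> - q)" unfolding b_def Zbar_diff_q using N by simp
  have "0 \<le> (\<Sum>j=1..N. (Z n j \<omega> - q - b)\<^sup>2)" by (intro sum_nonneg) auto
  also have "\<dots> = S - 2 * b * (\<Sum>j=1..N. Z n j \<omega> - q) + real N * b\<^sup>2"
  proof -
    define y where "y = (\<lambda>j. Z n j \<omega> - q)"
    have "(y j - b)\<^sup>2 = (y j)\<^sup>2 - 2 * b * y j + b\<^sup>2" for j
      by (simp add: power2_eq_square algebra_simps)
    hence "(\<Sum>j=1..N. (y j - b)\<^sup>2) = (\<Sum>j=1..N. (y j)\<^sup>2) - 2 * b * (\<Sum>j=1..N. y j) + real N * b\<^sup>2"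
      by (simp add: sum.distrib sum_subtractf sum_distrib_left)
    thus ?thesis unfolding S_def y_def .
  qed
  also have "\<dots> = S - real N * b\<^sup>2" unfolding b[symmetric] by (simp add: power2_eq_square)
  finally have Nb: "real N * b\<^sup>2 \<le> S" by simp
  have "(\<Sum>j=1..N. (p n j \<omega> - q)\<^sup>2) \<le> (\<Sum>j=1..N. (1 - \<alpha>) * (Z n j \<omega> - q)\<^sup>2 + \<alpha> * b\<^sup>2)"
    unfolding p_diff_q b_def by (intro sum_mono convex_square alpha)
  also have "\<dots> = (1 - \<alpha>) * S + \<alpha> * (real N * b\<^sup>2)"
    unfolding S_def by (simp add: sum.distrib sum_distrib_left)
  also have "\<dots> \<le> (1 - \<alpha>) * S + \<alpha> * S" using Nb alpha by (intro add_left_mono mult_left_mono) auto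
  finally show ?thesis unfolding S_def by (simp add: algebra_simps)
qed

text \<open>The first-moment counterpart, by which the error in the conditional variance, naturally
  expressed through p, is controlled through Z.\<close>

lemma sum_p_abs: "(\<Sum>j=1..N. \<bar>p n j \<omega> - q\<bar>) \<le> (\<Sum>j=1..N. \<bar>Z n j \<omega> - q\<bar>)"
proof -
  define S where "S = (\<Sum>j=1..N. \<bar>Z n j \<omega> - q\<bar>)"
  define b where "b = Zbar N Z n \<omega> - q"
  have "real N * \<bar>b\<bar> = \<bar>\<Sum>j=1..N. Z n j \<omega> - q\<bar>" unfolding b_def Zbar_diff_q using N by (simp add: abs_mult)
  also have "\<dots> \<le> S" unfolding S_def by (rule sum_abs)
  finally have Nb: "real N * \<bar>b\<bar> \<le> S" .
  have "(\<Sum>j=1..N. \<bar>p n j \<omega> - q\<bar>) \<le> (\<Sum>j=1..N. (1 - \<alpha>) * \<bar>Z n j \<omega> - q\<bar> + \<alpha> * \<bar>b\<bar>)"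
  proof (rule sum_mono)
    fix j
    have "\<bar>p n j \<omega> - q\<bar> \<le> \<bar>(1 - \<alpha>) * (Z n j \<omega> - q)\<bar> + \<bar>\<alpha> * b\<bar>" unfolding p_diff_q b_def by (rule abs_triangle_ineq)
    thus "\<bar>p n j \<omega> - q\<bar> \<le> (1 - \<alpha>) * \<bar>Z n j \<omega> - q\<bar> + \<alpha> * \<bar>b\<bar>" using alpha by (simp add: abs_mult)
  qed
  also have "\<dots> = (1 - \<alpha>) * S + \<alpha> * (real N * \<bar>b\<bar>)"
    unfolding S_def by (simp add: sum.distrib sum_distrib_left)
  also have "\<dots> \<le> (1 - \<alpha>) * S + \<alpha> * S" using Nb alpha by (intro add_left_mono mult_left_mono) auto
  finally show ?thesis unfolding S_def by (simp add: algebra_simps)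
qed

definition \<Phi> :: "nat \<Rightarrow> real" where "\<Phi> n = (\<Sum>j=1..N. expectation (\<lambda>\<omega>. (Z n j \<omega> - q)\<^sup>2))"

lemma bfun_ZM: "j \<in> {1..N} \<Longrightarrow> bfun M M (Z n j)"
  using bfun_subalgebra[OF subalgebra_F bfun_Z[OF order_refl]] .

lemma bfun_pM: "j \<in> {1..N} \<Longrightarrow> bfun M M (p n j)"
  using bfun_subalgebra[OF subalgebra_F bfun_p[OF order_refl]] .

text \<open>Z(n+1) - q equals b + r \<rho> e, where b is the convex combination of Z - q and \<rho>
  (p - q), and e is centred given the past. Convexity bounds b^2, the cross term vanishes, and the
  noise costs only r^2. The pull towards q shows up as the positive rate 1 - \<rho>^2.\<close>

lemma \<Phi>_Suc: "\<Phi> (Suc n) \<le> (1 - (1 - \<rho>\<^sup>2) * r n) * \<Phi> n + real N * (r n)\<^sup>2"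
proof -
  have iZ: "integrable M (\<lambda>\<omega>. (Z n j \<omega> - q)\<^sup>2)" and ip: "integrable M (\<lambda>\<omega>. (p n j \<omega> - q)\<^sup>2)" if "j \<in> {1..N}" for j
    using that by (auto intro!: bfun_integrable bfun_intros bfun_ZM bfun_pM)
  have 1: "expectation (\<lambda>\<omega>. (Z (Suc n) j \<omega> - q)\<^sup>2)
      \<le> (1 - r n) * expectation (\<lambda>\<omega>. (Z n j \<omega> - q)\<^sup>2) + r n * \<rho>\<^sup>2 * expectation (\<lambda>\<omega>. (p n j \<omega> - q)\<^sup>2) + (r n)\<^sup>2"
    if j: "j \<in> {1..N}" for j
  proof -
    define b where "b = (\<lambda>\<omega>. (1 - r n) * (Z n j \<omega> - q) + r n * (\<rho> * (p n j \<omega> - q)))"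
    have bF: "bfun M (F n) (\<lambda>\<omega>. 2 * (r n * \<rho>) * b \<omega>)"
      unfolding b_def using j by (intro bfun_intros bfun_Z bfun_p) auto
    have ib: "integrable M (\<lambda>\<omega>. 2 * (r n * \<rho>) * b \<omega> * e n j \<omega>)"
      by (intro bfun_integrable bfun_mult[OF bfun_subalgebra[OF subalgebra_F bF] bfun_e[OF j]])
    have "expectation (\<lambda>\<omega>. (Z (Suc n) j \<omega> - q)\<^sup>2)
      \<le> expectation (\<lambda>\<omega>. (1 - r n) * (Z n j \<omega> - q)\<^sup>2 + r n * \<rho>\<^sup>2 * (p n j \<omega> - q)\<^sup>2 + 2 * (r n * \<rho>) * b \<omega> * e n j \<omega> + (r n)\<^sup>2)"
    proof (rule integral_mono)
      show "integrable M (\<lambda>\<omega>. (Z (Suc n) j \<omega> - q)\<^sup>2)" by (intro bfun_integrable bfun_intros bfun_ZM j)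
      show "integrable M (\<lambda>\<omega>. (1 - r n) * (Z n j \<omega> - q)\<^sup>2 + r n * \<rho>\<^sup>2 * (p n j \<omega> - q)\<^sup>2 + 2 * (r n * \<rho>) * b \<omega> * e n j \<omega> + (r n)\<^sup>2)"
        using iZ[OF j] ip[OF j] ib by simp
      fix \<omega> assume w: "\<omega> \<in> space M"
      have eq: "Z (Suc n) j \<omega> - q = b \<omega> + r n * \<rho> * e n j \<omega>"
        unfolding recur[OF j w] b_def e_def by (simp add: algebra_simps)
      have "(b \<omega>)\<^sup>2 \<le> (1 - r n) * (Z n j \<omega> - q)\<^sup>2 + r n * (\<rho> * (p n j \<omega> - q))\<^sup>2"
        unfolding b_def using r[of n] by (intro convex_square) auto
      hence "(b \<omega>)\<^sup>2 \<le> (1 - r n) * (Z n j \<omega> - q)\<^sup>2 + r n * \<rho>\<^sup>2 * (p n j \<omega> - q)\<^sup>2"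
        unfolding power_mult_distrib[of \<rho>] by (simp only: mult.assoc)
      moreover have "(r n * \<rho> * e n j \<omega>)\<^sup>2 \<le> (r n)\<^sup>2"
      proof -
        have "\<bar>e n j \<omega>\<bar> \<le> 1" unfolding e_def using Irange[OF j w, of n] p_range[OF w j, of n] by auto
        hence "\<bar>\<rho> * e n j \<omega>\<bar> \<le> 1" using rho by (simp add: abs_mult mult_le_one)
        hence "\<bar>r n * (\<rho> * e n j \<omega>)\<bar> \<le> \<bar>r n\<bar>" using r[of n] by (simp add: abs_mult mult_left_le)
        thus ?thesis by (simp add: abs_le_square_iff mult.assoc)
      qed
      ultimately show "(Z (Suc n) j \<omega> - q)\<^sup>2 \<le> (1 - r n) * (Z n j \<omega> - q)\<^sup>2 + r n * \<rho>\<^sup>2 * (p n j \<omega> - q)\<^sup>2 + 2 * (r n * \<rho>) * b \<omega> * e n j \<omega> + (r n)\<^sup>2"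
        unfolding eq power2_sum[of "b \<omega>"] by (simp add: mult.assoc mult.left_commute)
    qed
    also have "\<dots> = (1 - r n) * expectation (\<lambda>\<omega>. (Z n j \<omega> - q)\<^sup>2) + r n * \<rho>\<^sup>2 * expectation (\<lambda>\<omega>. (p n j \<omega> - q)\<^sup>2) + (r n)\<^sup>2"
      using iZ[OF j] ip[OF j] ib e_mean[OF bF j] by (simp add: prob_space)
    finally show ?thesis .
  qed
  have 2: "(\<Sum>j=1..N. expectation (\<lambda>\<omega>. (p n j \<omega> - q)\<^sup>2)) \<le> \<Phi> n"
  proof -
    have "(\<Sum>j=1..N. expectation (\<lambda>\<omega>. (p n j \<omega> - q)\<^sup>2)) = expectation (\<lambda>\<omega>. \<Sum>j=1..N. (p n j \<omega> - q)\<^sup>2)"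
      using ip by (intro Bochner_Integration.integral_sum[symmetric])
    also have "\<dots> \<le> expectation (\<lambda>\<omega>. \<Sum>j=1..N. (Z n j \<omega> - q)\<^sup>2)"
      using ip iZ by (intro integral_mono Bochner_Integration.integrable_sum sum_p_square)
    also have "\<dots> = \<Phi> n" unfolding \<Phi>_def using iZ by (intro Bochner_Integration.integral_sum)
    finally show ?thesis .
  qed
  have "\<Phi> (Suc n) \<le> (\<Sum>j=1..N. (1 - r n) * expectation (\<lambda>\<omega>. (Z n j \<omega> - q)\<^sup>2) + r n * \<rho>\<^sup>2 * expectation (\<lambda>\<omega>. (p n j \<omega> - q)\<^sup>2) + (r n)\<^sup>2)"
    unfolding \<Phi>_def by (intro sum_mono 1)
  also have "\<dots> = (1 - r n) * \<Phi> n + r n * \<rho>\<^sup>2 * (\<Sum>j=1..N. expectation (\<lambda>\<omega>. (p n j \<omega> - q)\<^sup>2)) + real N * (r n)\<^sup>2"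
    unfolding \<Phi>_def by (simp add: sum.distrib sum_distrib_left)
  also have "\<dots> \<le> (1 - r n) * \<Phi> n + r n * \<rho>\<^sup>2 * \<Phi> n + real N * (r n)\<^sup>2"
    using 2 r[of n] by (intro add_right_mono add_left_mono mult_left_mono) auto
  finally show ?thesis by (simp add: algebra_simps)
qed

definition dev :: "nat \<Rightarrow> real" where "dev n = expectation (\<lambda>\<omega>. \<Sum>j=1..N. \<bar>Z n j \<omega> - q\<bar>)"

text \<open>The noise N (r n)^2 is of smaller order than n^(-\<gamma>), so \<Phi> tends to 0. The
  first absolute moment is the quantity that a Lipschitz variance function tested against a bounded
  factor calls for.\<close>

lemma dev_tendsto:
  assumes g: "0 < \<gamma>" "\<gamma> \<le> 1" and c: "c > 0" and rl: "(\<lambda>n. real n powr \<gamma> * r n) \<longlonglongrightarrow> c" and r0: "r \<longlonglongrightarrow> 0"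
  shows "dev \<longlonglongrightarrow> 0"
proof -
  have rho2: "\<rho>\<^sup>2 < 1" using rho by (simp add: power_less_one_iff abs_square_less_1)
  have \<Phi>0: "\<Phi> \<longlonglongrightarrow> 0"
  proof (rule recursion_tendsto_zero[OF g, where \<theta>="(1 - \<rho>\<^sup>2) * c" and d="\<lambda>n. (1 - \<rho>\<^sup>2) * r n" and e="\<lambda>n. real N * (r n)\<^sup>2"])
    show "(1 - \<rho>\<^sup>2) * c > 0" using rho2 c by simp
    show "0 \<le> \<Phi> n" for n unfolding \<Phi>_def by (intro sum_nonneg integral_nonneg_AE) auto
    show "\<forall>\<^sub>F n in sequentially. \<Phi> (Suc n) \<le> (1 - (1 - \<rho>\<^sup>2) * r n) * \<Phi> n + real N * (r n)\<^sup>2" using \<Phi>_Suc by simp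
    show "(\<lambda>n. real n powr \<gamma> * ((1 - \<rho>\<^sup>2) * r n)) \<longlonglongrightarrow> (1 - \<rho>\<^sup>2) * c"
      using tendsto_mult_left[OF rl, of "1 - \<rho>\<^sup>2"] by (simp add: algebra_simps)
    have "(\<lambda>n. real N * ((real n powr \<gamma> * r n) * r n)) \<longlonglongrightarrow> real N * (c * 0)" by (intro tendsto_intros rl r0)
    thus "(\<lambda>n. real n powr \<gamma> * (real N * (r n)\<^sup>2)) \<longlonglongrightarrow> 0" by (simp add: power2_eq_square algebra_simps)
  qed
  have ia: "integrable M (\<lambda>\<omega>. \<bar>Z n j \<omega> - q\<bar>)" if "j \<in> {1..N}" for n j
    using that by (intro integrable_abs bfun_integrable bfun_intros bfun_ZM)
  have le: "expectation (\<lambda>\<omega>. \<bar>Z n j \<omega> - q\<bar>) \<le> sqrt (\<Phi> n)" if j: "j \<in> {1..N}" for n j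
  proof (rule real_le_rsqrt)
    have i2: "integrable M (\<lambda>\<omega>. \<bar>Z n j \<omega> - q\<bar>\<^sup>2)" unfolding power2_abs using j by (intro bfun_integrable bfun_intros bfun_ZM)
    have "0 \<le> variance (\<lambda>\<omega>. \<bar>Z n j \<omega> - q\<bar>)" by (rule variance_positive)
    hence "(expectation (\<lambda>\<omega>. \<bar>Z n j \<omega> - q\<bar>))\<^sup>2 \<le> expectation (\<lambda>\<omega>. \<bar>Z n j \<omega> - q\<bar>\<^sup>2)"
      unfolding variance_eq[OF ia[OF j] i2] by simp
    also have "\<dots> \<le> \<Phi> n" unfolding \<Phi>_def power2_abs
      by (rule member_le_sum[OF j]) (auto intro!: integral_nonneg_AE)
    finally show "(expectation (\<lambda>\<omega>. \<bar>Z n j \<omega> - q\<bar>))\<^sup>2 \<le> \<Phi> n" .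
  qed
  have up: "dev n \<le> real N * sqrt (\<Phi> n)" for n
  proof -
    have "dev n = (\<Sum>j=1..N. expectation (\<lambda>\<omega>. \<bar>Z n j \<omega> - q\<bar>))" unfolding dev_def using ia by (intro Bochner_Integration.integral_sum)
    also have "\<dots> \<le> (\<Sum>j=1..N. sqrt (\<Phi> n))" by (intro sum_mono le)
    finally show ?thesis by simp
  qed
  have lo: "0 \<le> dev n" for n unfolding dev_def by (intro integral_nonneg_AE AE_I2 sum_nonneg) auto
  have "(\<lambda>n. real N * sqrt (\<Phi> n)) \<longlonglongrightarrow> real N * sqrt 0" by (intro tendsto_intros \<Phi>0)
  hence lim: "(\<lambda>n. real N * sqrt (\<Phi> n)) \<longlonglongrightarrow> 0" by simp
  show ?thesis
    by (rule real_tendsto_sandwich[OF _ _ tendsto_const lim]) (intro always_eventually allI lo up)+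
qed

end

section \<open>Limits of the squared and cubed coefficients\<close>

context step_sizes
begin

lemma shift_factor_tendsto: "(\<lambda>n. (1 + 1 / real n) powr (\<gamma>/2)) \<longlonglongrightarrow> 1"
  by real_asymp

lemma shift_factor: "n \<ge> 1 \<Longrightarrow> real (Suc n) powr (\<gamma>/2) = (1 + 1 / real n) powr (\<gamma>/2) * real n powr (\<gamma>/2)"
proof -
  assume n: "n \<ge> 1"
  have "(1 + 1 / real n) powr (\<gamma>/2) * real n powr (\<gamma>/2) = ((1 + 1 / real n) * real n) powr (\<gamma>/2)"
    using n by (subst powr_mult) auto
  also have "(1 + 1 / real n) * real n = real (Suc n)" using n by (simp add: field_simps)
  finally show ?thesis ..
qed

text \<open>The scaling is exact: n^\<gamma> (n^(\<gamma>/2) r)^2 = (n^\<gamma> r)^2, with limit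
  c^2. The constant g = 1 gives the variance, while g = \<open>dev\<close> gives a vanishing
  variance error.\<close>

lemma square_source_tendsto:
  assumes g: "g \<longlonglongrightarrow> L"
  shows "(\<lambda>n. real n powr \<gamma> * ((real (Suc n) powr (\<gamma>/2) * r n)\<^sup>2 * g n)) \<longlonglongrightarrow> c\<^sup>2 * L"
proof -
  have "(\<lambda>n. ((1 + 1 / real n) powr (\<gamma>/2))\<^sup>2 * (real n powr \<gamma> * r n)\<^sup>2 * g n) \<longlonglongrightarrow> 1\<^sup>2 * c\<^sup>2 * L"
    by (intro tendsto_mult tendsto_power shift_factor_tendsto rlim g)
  moreover have "((1 + 1 / real n) powr (\<gamma>/2))\<^sup>2 * (real n powr \<gamma> * r n)\<^sup>2 * g n
      = real n powr \<gamma> * ((real (Suc n) powr (\<gamma>/2) * r n)\<^sup>2 * g n)" if "n \<ge> 1" for n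
  proof -
    have "real n powr \<gamma> = (real n powr (\<gamma>/2))\<^sup>2" using that by (simp add: powr_power)
    thus ?thesis unfolding shift_factor[OF that] by (simp add: power2_eq_square algebra_simps)
  qed
  ultimately show ?thesis
    by (simp add: Lim_transform_eventually[OF _ eventually_sequentiallyI[of 1]])
qed

text \<open>Compared with (n^\<gamma> r)^3 a factor n^(-\<gamma>/2) is left over. This is the
  Lindeberg condition in third-moment form.\<close>

lemma cube_source_tendsto:
  "(\<lambda>n. real n powr \<gamma> * ((real (Suc n) powr (\<gamma>/2) * r n) ^ 3 * 1)) \<longlonglongrightarrow> 0"
proof -
  have "(\<lambda>n. real n powr (-(\<gamma>/2))) \<longlonglongrightarrow> 0" using \<gamma> by real_asymp
  hence "(\<lambda>n. ((1 + 1 / real n) powr (\<gamma>/2)) ^ 3 * (real n powr \<gamma> * r n) ^ 3 * real n powr (-(\<gamma>/2))) \<longlonglongrightarrow> 1 ^ 3 * c ^ 3 * 0"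
    by (intro tendsto_mult tendsto_power shift_factor_tendsto rlim)
  moreover have "((1 + 1 / real n) powr (\<gamma>/2)) ^ 3 * (real n powr \<gamma> * r n) ^ 3 * real n powr (-(\<gamma>/2))
      = real n powr \<gamma> * ((real (Suc n) powr (\<gamma>/2) * r n) ^ 3 * 1)" if "n \<ge> 1" for n
  proof -
    have "real n powr \<gamma> = (real n powr (\<gamma>/2))\<^sup>2" using that by (simp add: powr_power)
    thus ?thesis using that unfolding shift_factor[OF that] powr_minus
      by (simp add: power2_eq_square power3_eq_cube field_simps)
  qed
  ultimately show ?thesis
    by (simp add: Lim_transform_eventually[OF _ eventually_sequentiallyI[of 1]])
qed

end

lemma bernoulli_variance_Lipschitz:
  fixes x y :: real
  assumes "0 \<le> x" "x \<le> 1" "0 \<le> y" "y \<le> 1"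
  shows "\<bar>x * (1 - x) - y * (1 - y)\<bar> \<le> \<bar>x - y\<bar>"
proof -
  have "x * (1 - x) - y * (1 - y) = (x - y) * (1 - x - y)" by (simp add: algebra_simps)
  hence "\<bar>x * (1 - x) - y * (1 - y)\<bar> = \<bar>x - y\<bar> * \<bar>1 - x - y\<bar>" by (simp only: abs_mult)
  also have "\<dots> \<le> \<bar>x - y\<bar> * 1" using assms by (intro mult_left_mono) auto
  finally show ?thesis by simp
qed

section \<open>The deviation from the empirical mean\<close>

context reinforcement
begin

definition D :: "nat \<Rightarrow> 'a \<Rightarrow> real" where "D n \<omega> = Z n i \<omega> - Zbar N Z n \<omega>"

text \<open>Coefficients of the map from x to x i minus the mean of x. Their squares sum to 1 - 1/N,
  the prefactor of V.\<close>

definition w :: "nat \<Rightarrow> real" where "w j = (if j = i then 1 else 0) - 1 / real N"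

definition \<zeta> :: "nat \<Rightarrow> 'a \<Rightarrow> real" where "\<zeta> n \<omega> = (\<Sum>j=1..N. w j * e n j \<omega>)"

lemma sum_w: "(\<Sum>j=1..N. w j * x j) = x i - (\<Sum>j=1..N. x j) / real N"
proof -
  have "(\<Sum>j=1..N. w j * x j) = (\<Sum>j=1..N. (if j = i then x j else 0) - x j / real N)"
    unfolding w_def by (intro sum.cong) (auto simp: algebra_simps)
  also have "\<dots> = x i - (\<Sum>j=1..N. x j) / real N"
    using i by (simp add: sum_subtractf sum_divide_distrib)
  finally show ?thesis .
qed

lemma sum_w_square: "(\<Sum>j=1..N. (w j)\<^sup>2) = 1 - 1 / real N"
proof -
  have "(\<Sum>j=1..N. (w j)\<^sup>2) = (\<Sum>j=1..N. w j * w j)" by (simp add: power2_eq_square)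
  also have "\<dots> = w i - (\<Sum>j=1..N. w j) / real N" by (rule sum_w)
  also have "(\<Sum>j=1..N. w j) = 0" using sum_w[of "\<lambda>_. 1"] N by simp
  finally show ?thesis unfolding w_def by simp
qed

lemma bfun_\<zeta>: "bfun M M (\<zeta> n)"
  unfolding \<zeta>_def by (intro bfun_sum bfun_cmult bfun_e)

lemma \<zeta>_mean:
  assumes g: "bfun M (F n) g" shows "expectation (\<lambda>\<omega>. g \<omega> * \<zeta> n \<omega>) = 0"
proof -
  have gM: "bfun M M g" by (rule bfun_subalgebra[OF subalgebra_F g])
  have "expectation (\<lambda>\<omega>. g \<omega> * \<zeta> n \<omega>) = expectation (\<lambda>\<omega>. \<Sum>j=1..N. w j * (g \<omega> * e n j \<omega>))"
    unfolding \<zeta>_def by (simp add: sum_distrib_left mult.left_commute)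
  also have "\<dots> = (\<Sum>j=1..N. expectation (\<lambda>\<omega>. w j * (g \<omega> * e n j \<omega>)))"
    by (intro Bochner_Integration.integral_sum bfun_integrable bfun_cmult bfun_mult gM bfun_e)
  also have "\<dots> = 0" using e_mean[OF g] by (intro sum.neutral) auto
  finally show ?thesis .
qed

lemma \<zeta>_square:
  assumes g: "bfun M (F n) g"
  shows "expectation (\<lambda>\<omega>. g \<omega> * (\<zeta> n \<omega>)\<^sup>2) = expectation (\<lambda>\<omega>. g \<omega> * (\<Sum>j=1..N. (w j)\<^sup>2 * (p n j \<omega> * (1 - p n j \<omega>))))"
proof -
  have gM: "bfun M M g" by (rule bfun_subalgebra[OF subalgebra_F g])
  have "expectation (\<lambda>\<omega>. g \<omega> * (\<zeta> n \<omega>)\<^sup>2) = expectation (\<lambda>\<omega>. \<Sum>j=1..N. \<Sum>k=1..N. w j * w k * (g \<omega> * (e n j \<omega> * e n k \<omega>)))"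
    unfolding \<zeta>_def power2_eq_square sum_product
    by (simp add: sum_distrib_left mult.assoc mult.left_commute)
  also have "\<dots> = (\<Sum>j=1..N. \<Sum>k=1..N. w j * w k * expectation (\<lambda>\<omega>. g \<omega> * (e n j \<omega> * e n k \<omega>)))"
  proof -
    have i: "integrable M (\<lambda>\<omega>. w j * w k * (g \<omega> * (e n j \<omega> * e n k \<omega>)))" if "j \<in> {1..N}" "k \<in> {1..N}" for j k
      using that by (intro bfun_integrable bfun_cmult bfun_mult gM bfun_e)
    have "expectation (\<lambda>\<omega>. \<Sum>j=1..N. \<Sum>k=1..N. w j * w k * (g \<omega> * (e n j \<omega> * e n k \<omega>)))
      = (\<Sum>j=1..N. expectation (\<lambda>\<omega>. \<Sum>k=1..N. w j * w k * (g \<omega> * (e n j \<omega> * e n k \<omega>))))"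
      by (intro Bochner_Integration.integral_sum Bochner_Integration.integrable_sum i)
    also have "\<dots> = (\<Sum>j=1..N. \<Sum>k=1..N. expectation (\<lambda>\<omega>. w j * w k * (g \<omega> * (e n j \<omega> * e n k \<omega>))))"
      by (intro sum.cong refl Bochner_Integration.integral_sum i)
    finally show ?thesis by simp
  qed
  also have "\<dots> = (\<Sum>j=1..N. \<Sum>k=1..N. if k = j then (w j)\<^sup>2 * expectation (\<lambda>\<omega>. g \<omega> * (p n j \<omega> * (1 - p n j \<omega>))) else 0)"
    by (intro sum.cong refl) (use e_cov[OF g] in \<open>auto simp: power2_eq_square\<close>)
  also have "\<dots> = (\<Sum>j=1..N. (w j)\<^sup>2 * expectation (\<lambda>\<omega>. g \<omega> * (p n j \<omega> * (1 - p n j \<omega>))))" by simp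
  also have "\<dots> = expectation (\<lambda>\<omega>. \<Sum>j=1..N. (w j)\<^sup>2 * (g \<omega> * (p n j \<omega> * (1 - p n j \<omega>))))"
  proof -
    have "integrable M (\<lambda>\<omega>. (w j)\<^sup>2 * (g \<omega> * (p n j \<omega> * (1 - p n j \<omega>))))" if "j \<in> {1..N}" for j
      using that by (intro bfun_integrable bfun_intros gM bfun_pM)
    thus ?thesis by (simp add: Bochner_Integration.integral_sum)
  qed
  also have "\<dots> = expectation (\<lambda>\<omega>. g \<omega> * (\<Sum>j=1..N. (w j)\<^sup>2 * (p n j \<omega> * (1 - p n j \<omega>))))"
    by (simp add: sum_distrib_left mult.left_commute)
  finally show ?thesis .
qed

definition s2 :: real where "s2 = (1 - 1 / real N) * (q * (1 - q))"

lemma s2_range: "0 \<le> s2" "s2 \<le> 1"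
proof -
  have "0 \<le> 1 - 1 / real N" "1 - 1 / real N \<le> 1" using N by auto
  moreover have "0 \<le> q * (1 - q)" "q * (1 - q) \<le> 1" using q by (auto intro: mult_le_one)
  ultimately show "0 \<le> s2" "s2 \<le> 1" unfolding s2_def by (auto intro: mult_le_one)
qed

lemma w_square_le_one: "j \<in> {1..N} \<Longrightarrow> (w j)\<^sup>2 \<le> 1"
proof -
  assume "j \<in> {1..N}"
  have "(w j)\<^sup>2 \<le> (\<Sum>j=1..N. (w j)\<^sup>2)" by (rule member_le_sum) (use \<open>j \<in> {1..N}\<close> in auto)
  thus ?thesis unfolding sum_w_square by (smt (verit) divide_nonneg_nonneg of_nat_0_le_iff)
qed

text \<open>Convergence of the conditional variance of \<zeta> in the tested form that the Lindeberg
  replacement consumes. The map x (1 - x) is 1-Lipschitz on [0, 1] and the squared weights are at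
  most 1, so the error is controlled by the deviations of p, hence of Z, from q.\<close>

lemma \<zeta>_square_bound:
  assumes g: "bfun M (F n) g" and B: "\<And>\<omega>. \<omega> \<in> space M \<Longrightarrow> \<bar>g \<omega>\<bar> \<le> B" "B \<ge> 0"
  shows "\<bar>expectation (\<lambda>\<omega>. g \<omega> * ((\<zeta> n \<omega>)\<^sup>2 - s2))\<bar> \<le> B * dev n"
proof -
  have gM: "bfun M M g" by (rule bfun_subalgebra[OF subalgebra_F g])
  define \<sigma> where "\<sigma> = (\<lambda>\<omega>. \<Sum>j=1..N. (w j)\<^sup>2 * (p n j \<omega> * (1 - p n j \<omega>)))"
  have b\<sigma>: "bfun M M \<sigma>" unfolding \<sigma>_def by (intro bfun_intros bfun_pM)
  have i1: "integrable M (\<lambda>\<omega>. g \<omega> * (\<zeta> n \<omega>)\<^sup>2)" "integrable M (\<lambda>\<omega>. g \<omega> * s2)" "integrable M (\<lambda>\<omega>. g \<omega> * \<sigma> \<omega>)"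
    by (intro bfun_integrable bfun_intros gM bfun_\<zeta> b\<sigma>)+
  have "expectation (\<lambda>\<omega>. g \<omega> * ((\<zeta> n \<omega>)\<^sup>2 - s2)) = expectation (\<lambda>\<omega>. g \<omega> * (\<sigma> \<omega> - s2))"
    unfolding right_diff_distrib using i1 \<zeta>_square[OF g, folded \<sigma>_def] by (simp add: \<sigma>_def)
  also have "\<bar>\<dots>\<bar> \<le> expectation (\<lambda>\<omega>. \<bar>g \<omega> * (\<sigma> \<omega> - s2)\<bar>)" by (rule integral_abs_bound)
  also have "\<dots> \<le> expectation (\<lambda>\<omega>. B * (\<Sum>j=1..N. \<bar>Z n j \<omega> - q\<bar>))"
  proof (rule integral_mono)
    show "integrable M (\<lambda>\<omega>. \<bar>g \<omega> * (\<sigma> \<omega> - s2)\<bar>)"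
      by (intro integrable_abs bfun_integrable bfun_intros gM b\<sigma>)
    show "integrable M (\<lambda>\<omega>. B * (\<Sum>j=1..N. \<bar>Z n j \<omega> - q\<bar>))"
      by (intro integrable_mult_right Bochner_Integration.integrable_sum integrable_abs bfun_integrable bfun_intros bfun_ZM)
    fix \<omega> assume w: "\<omega> \<in> space M"
    have eq: "\<sigma> \<omega> - s2 = (\<Sum>j=1..N. (w j)\<^sup>2 * (p n j \<omega> * (1 - p n j \<omega>) - q * (1 - q)))"
    proof -
      have "(\<Sum>j=1..N. (w j)\<^sup>2 * x j) - (\<Sum>j=1..N. (w j)\<^sup>2) * y = (\<Sum>j=1..N. (w j)\<^sup>2 * (x j - y))" for x :: "nat \<Rightarrow> real" and y
        by (simp add: right_diff_distrib sum_subtractf sum_distrib_right)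
      from this[of "\<lambda>j. p n j \<omega> * (1 - p n j \<omega>)" "q * (1 - q)"] show ?thesis
        unfolding \<sigma>_def s2_def sum_w_square .
    qed
    have "\<bar>\<sigma> \<omega> - s2\<bar> \<le> (\<Sum>j=1..N. \<bar>(w j)\<^sup>2 * (p n j \<omega> * (1 - p n j \<omega>) - q * (1 - q))\<bar>)"
      unfolding eq by (rule sum_abs)
    also have "\<dots> \<le> (\<Sum>j=1..N. \<bar>p n j \<omega> - q\<bar>)"
    proof (rule sum_mono)
      fix j assume j: "j \<in> {1..N}"
      have "\<bar>p n j \<omega> * (1 - p n j \<omega>) - q * (1 - q)\<bar> \<le> \<bar>p n j \<omega> - q\<bar>"
        by (rule bernoulli_variance_Lipschitz) (use p_range[OF w j, of n] q in auto)
      hence "(w j)\<^sup>2 * \<bar>p n j \<omega> * (1 - p n j \<omega>) - q * (1 - q)\<bar> \<le> 1 * \<bar>p n j \<omega> - q\<bar>"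
        using w_square_le_one[OF j] by (intro mult_mono) auto
      thus "\<bar>(w j)\<^sup>2 * (p n j \<omega> * (1 - p n j \<omega>) - q * (1 - q))\<bar> \<le> \<bar>p n j \<omega> - q\<bar>"
        by (simp only: abs_mult abs_power2 mult_1)
    qed
    also have "\<dots> \<le> (\<Sum>j=1..N. \<bar>Z n j \<omega> - q\<bar>)" by (rule sum_p_abs)
    finally have "\<bar>g \<omega>\<bar> * \<bar>\<sigma> \<omega> - s2\<bar> \<le> B * (\<Sum>j=1..N. \<bar>Z n j \<omega> - q\<bar>)"
      using B(1)[OF w] B(2) by (intro mult_mono) auto
    thus "\<bar>g \<omega> * (\<sigma> \<omega> - s2)\<bar> \<le> B * (\<Sum>j=1..N. \<bar>Z n j \<omega> - q\<bar>)" by (simp add: abs_mult)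
  qed
  also have "\<dots> = B * dev n" unfolding dev_def by simp
  finally show ?thesis .
qed

lemma \<zeta>_range: "\<omega> \<in> space M \<Longrightarrow> \<bar>\<zeta> n \<omega>\<bar> \<le> 2"
proof -
  assume w: "\<omega> \<in> space M"
  have e1: "\<bar>e n j \<omega>\<bar> \<le> 1" if "j \<in> {1..N}" for j
    unfolding e_def using Irange[OF that w, of n] p_range[OF w that, of n] by auto
  have "\<bar>\<Sum>j=1..N. e n j \<omega>\<bar> \<le> (\<Sum>j=1..N. 1)" by (rule order_trans[OF sum_abs]) (intro sum_mono e1)
  hence "\<bar>(\<Sum>j=1..N. e n j \<omega>) / real N\<bar> \<le> 1" using N by (simp add: field_simps)
  thus ?thesis unfolding \<zeta>_def sum_w using e1[OF i] by linarith
qed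

text \<open>Averaging over j removes the interaction, because the mean of the p is the mean of the
  Z, and the constant drift (1 - \<rho>) q cancels in the difference. So D obeys a closed linear
  recursion, driven by \<zeta>.\<close>

lemma D_Suc:
  assumes w: "\<omega> \<in> space M"
  shows "D (Suc n) \<omega> = (1 - (1 - \<rho> * (1 - \<alpha>)) * r n) * D n \<omega> + r n * \<rho> * \<zeta> n \<omega>"
proof -
  have sp: "(\<Sum>j=1..N. p n j \<omega>) / real N = Zbar N Z n \<omega>"
  proof -
    define S where "S = (\<Sum>j=1..N. Z n j \<omega>)"
    have zb: "Zbar N Z n \<omega> = S / real N" unfolding S_def Zbar_def ..
    have "(\<Sum>j=1..N. p n j \<omega>) = (1 - \<alpha>) * S + real N * (\<alpha> * (S / real N))"
      unfolding p_def zb S_def by (simp add: sum.distrib sum_distrib_left)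
    also have "\<dots> = S" using N by (simp add: algebra_simps)
    finally show ?thesis unfolding zb by simp
  qed
  have "\<zeta> n \<omega> = (I (Suc n) i \<omega> - (\<Sum>j=1..N. I (Suc n) j \<omega>) / real N) - (p n i \<omega> - (\<Sum>j=1..N. p n j \<omega>) / real N)"
    unfolding \<zeta>_def sum_w e_def by (simp add: sum_subtractf diff_divide_distrib)
  hence z: "I (Suc n) i \<omega> - (\<Sum>j=1..N. I (Suc n) j \<omega>) / real N = \<zeta> n \<omega> + (1 - \<alpha>) * D n \<omega>"
    unfolding sp by (simp add: p_def D_def algebra_simps)
  have "Zbar N Z (Suc n) \<omega> = (\<Sum>j=1..N. (1 - r n) * Z n j \<omega> + r n * (\<rho> * I (Suc n) j \<omega> + (1 - \<rho>) * q)) / real N"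
    unfolding Zbar_def using recur[OF _ w] by simp
  also have "\<dots> = (1 - r n) * Zbar N Z n \<omega> + r n * (\<rho> * ((\<Sum>j=1..N. I (Suc n) j \<omega>) / real N) + (1 - \<rho>) * q)"
  proof -
    define S T where "S = (\<Sum>j=1..N. Z n j \<omega>)" and "T = (\<Sum>j=1..N. I (Suc n) j \<omega>)"
    have "(\<Sum>j=1..N. (1 - r n) * Z n j \<omega> + r n * (\<rho> * I (Suc n) j \<omega> + (1 - \<rho>) * q))
        = (1 - r n) * S + r n * (\<rho> * T + real N * ((1 - \<rho>) * q))"
      unfolding S_def T_def sum.distrib sum_distrib_left[symmetric] by simp
    moreover have "((1 - r n) * S + r n * (\<rho> * T + real N * ((1 - \<rho>) * q))) / real N
        = (1 - r n) * (S / real N) + r n * (\<rho> * (T / real N) + (1 - \<rho>) * q)"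
      using N by (simp add: field_simps)
    ultimately show ?thesis unfolding Zbar_def S_def T_def by simp
  qed
  finally have "D (Suc n) \<omega> = (1 - r n) * D n \<omega> + r n * (\<rho> * (I (Suc n) i \<omega> - (\<Sum>j=1..N. I (Suc n) j \<omega>) / real N))"
    unfolding D_def recur[OF i w] by (simp add: algebra_simps)
  thus ?thesis unfolding z by (simp add: algebra_simps)
qed

lemma bfun_D: "k \<le> n \<Longrightarrow> bfun M (F n) (D k)"
  unfolding D_def using i by (intro bfun_diff bfun_Z bfun_Zbar)

lemma D_range: "\<omega> \<in> space M \<Longrightarrow> \<bar>D n \<omega>\<bar> \<le> 1"
  unfolding D_def using Zrange[OF i, of \<omega> n] Zbar_range[of \<omega> n] by auto

end

section \<open>Convergence of the rescaled martingale\<close>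

text \<open>Common setting of both regimes: \<open>wt\<close> is the weight of the statement, and
  \<open>rh\<close> is the limit of \<open>ss.G n / ss.G (\<kappa> n t)\<close>, whose square
  governs the growth of the variance.\<close>

locale fluctuation = reinforcement M Z I N \<rho> \<alpha> q r i + ss: step_sizes r c \<gamma> "1 - \<rho> * (1 - \<alpha>)" \<theta>
  for M :: "'a measure" and Z I :: "nat \<Rightarrow> nat \<Rightarrow> 'a \<Rightarrow> real" and N :: nat and \<rho> \<alpha> q :: real
    and r :: "nat \<Rightarrow> real" and i :: nat and c \<gamma> \<theta> :: real +
  fixes \<kappa> :: "nat \<Rightarrow> real \<Rightarrow> nat" and wt rh :: "real \<Rightarrow> real"
  assumes \<kappa>_def: "\<kappa> = (\<lambda>n t. nat \<lfloor>real n + real n powr \<gamma> * t\<rfloor>)"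
    and weight: "\<And>T \<epsilon>. \<epsilon> > 0 \<Longrightarrow> \<forall>\<^sub>F n in sequentially. \<forall>t\<in>{0..T}. \<bar>wt t * ss.A (\<kappa> n t) / ss.A n - 1\<bar> \<le> \<epsilon>"
    and ratio: "\<And>t. t \<ge> 0 \<Longrightarrow> (\<lambda>n. ss.G n / ss.G (\<kappa> n t)) \<longlonglongrightarrow> rh t"
    and rh_cont: "continuous_on {0..} rh" and wt_cont: "continuous_on {0..} wt"
begin

lemma \<kappa>_ge: "t \<ge> 0 \<Longrightarrow> n \<le> \<kappa> n t"
proof -
  assume "t \<ge> 0"
  hence "real n \<le> real n + real n powr \<gamma> * t" by simp
  thus ?thesis unfolding \<kappa>_def by (rule le_nat_floor)
qed

lemma \<kappa>_mono: "s \<le> t \<Longrightarrow> \<kappa> n s \<le> \<kappa> n t"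
  unfolding \<kappa>_def by (intro nat_mono floor_mono add_left_mono mult_left_mono) auto

definition a :: "nat \<Rightarrow> nat \<Rightarrow> real" where "a n l = \<rho> * ss.G n * (r l / ss.A (Suc l))"

definition \<xi> :: "nat \<Rightarrow> nat \<Rightarrow> 'a \<Rightarrow> real" where "\<xi> n l \<omega> = a n l * \<zeta> l \<omega>"

text \<open>For fixed n this is a martingale in k, D k / A k in units of G n. At k =
  \<open>\<kappa> n t\<close> it agrees with the process of the statement up to a factor near
  1.\<close>

definition S :: "nat \<Rightarrow> nat \<Rightarrow> 'a \<Rightarrow> real" where "S n k \<omega> = ss.G n * D k \<omega> / ss.A k"

lemma G_nonneg: "ss.G n \<ge> 0"
  unfolding ss.G_def using ss.A_pos[of n] by simp

lemma G_pos: "n \<ge> 1 \<Longrightarrow> ss.G n > 0"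
  unfolding ss.G_def using ss.A_pos[of n] by simp

lemma a_nonneg: "a n l \<ge> 0"
  unfolding a_def using rho(1) G_nonneg[of n] r[of l] ss.A_pos[of "Suc l"] by simp

lemma S_Suc: "\<omega> \<in> space M \<Longrightarrow> S n (Suc k) \<omega> = S n k \<omega> + \<xi> n k \<omega>"
proof -
  assume w: "\<omega> \<in> space M"
  note f = ss.factor_pos[of k] and A = ss.A_pos[of k]
  have "S n (Suc k) \<omega> = ss.G n * ((1 - (1 - \<rho> * (1 - \<alpha>)) * r k) * D k \<omega>) / ss.A (Suc k) + ss.G n * (r k * \<rho> * \<zeta> k \<omega>) / ss.A (Suc k)"
    unfolding S_def D_Suc[OF w] by (simp add: distrib_left add_divide_distrib)
  also have "ss.G n * ((1 - (1 - \<rho> * (1 - \<alpha>)) * r k) * D k \<omega>) / ss.A (Suc k) = S n k \<omega>"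
  proof -
    have "g * (f * d) / (f * A) = g * d / A" if "f > 0" for g f d A :: real using that by simp
    from this[OF f] show ?thesis unfolding S_def ss.A_Suc .
  qed
  also have "ss.G n * (r k * \<rho> * \<zeta> k \<omega>) / ss.A (Suc k) = \<xi> n k \<omega>"
    unfolding \<xi>_def a_def by simp
  finally show ?thesis .
qed

lemma S_diff:
  assumes "\<omega> \<in> space M" "k \<le> m" shows "S n m \<omega> - S n k \<omega> = (\<Sum>l=k..<m. \<xi> n l \<omega>)"
  using assms(2) by (induction m rule: dec_induct) (auto simp: S_Suc[OF assms(1)])

lemma S_eq: "\<omega> \<in> space M \<Longrightarrow> S n k \<omega> = S n 0 \<omega> + (\<Sum>l<k. \<xi> n l \<omega>)"
  using S_diff[of \<omega> 0 k n] by (simp add: atLeast0LessThan)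

text \<open>The initial deviation is merely bounded; it drops out of the limit because G n tends to
  0.\<close>

lemma S_0: "\<omega> \<in> space M \<Longrightarrow> \<bar>S n 0 \<omega>\<bar> \<le> ss.G n"
  unfolding S_def using D_range[of \<omega> 0] G_nonneg[of n] by (simp add: ss.A_def abs_mult mult_left_le)

lemma bfun_S: "k \<le> m \<Longrightarrow> bfun M (F m) (S n k)"
  unfolding S_def using bfun_cmult[OF bfun_D[of k m], of "ss.G n / ss.A k"] by simp

text \<open>The filtration is generated by Z alone, and \<zeta> l need not be measurable at time l +
  1 when \<open>r l\<close> or \<rho> is 0. The scaled increment always is, being a difference of
  S.\<close>

lemma bfun_\<xi>: "l < k \<Longrightarrow> bfun M (F k) (\<xi> n l)"
proof (rule bfunI[where B="2 * a n l"])
  assume "l < k"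
  hence "bfun M (F k) (\<lambda>\<omega>. S n (Suc l) \<omega> - S n l \<omega>)" by (intro bfun_diff bfun_S) auto
  thus "\<xi> n l \<in> borel_measurable (F k)"
    unfolding bfun_def using S_Suc by (subst measurable_cong[where g="\<lambda>\<omega>. S n (Suc l) \<omega> - S n l \<omega>"]) auto
  fix \<omega> assume "\<omega> \<in> space M"
  from mult_left_mono[OF \<zeta>_range[OF this, of l] a_nonneg[of n l]]
  show "\<bar>\<xi> n l \<omega>\<bar> \<le> 2 * a n l" unfolding \<xi>_def using a_nonneg[of n l] by (simp add: abs_mult mult.commute)
qed

lemma \<xi>_bound: "\<omega> \<in> space M \<Longrightarrow> \<bar>\<xi> n l \<omega>\<bar> \<le> 2 * a n l"
  using mult_left_mono[OF \<zeta>_range[of \<omega> l] a_nonneg[of n l]] a_nonneg[of n l]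
  unfolding \<xi>_def by (simp add: abs_mult mult.commute)

lemma mdiff_\<xi>: "mdiff M F (a n) (\<xi> n)"
  unfolding mdiff_def
proof (intro conjI allI impI ballI)
  show "subalgebra M (F k)" for k by (rule subalgebra_F)
  show "\<xi> n l \<in> borel_measurable (F k)" if "l < k" for k l using bfun_\<xi>[OF that] by (simp add: bfun_def)
  show "\<bar>\<xi> n l \<omega>\<bar> \<le> 2 * a n l" if "\<omega> \<in> space M" for l \<omega> by (rule \<xi>_bound[OF that])
  show "expectation (\<lambda>\<omega>. g \<omega> * \<xi> n k \<omega>) = 0" if "bfun M (F k) g" for k g
    using \<zeta>_mean[OF bfun_cmult[OF that, of "a n k"]] unfolding \<xi>_def by (simp add: mult.assoc mult.left_commute)
qed

lemma \<kappa>_at_top: "t \<ge> 0 \<Longrightarrow> filterlim (\<lambda>n. \<kappa> n t) at_top sequentially"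
  by (rule filterlim_at_top_mono[OF filterlim_ident]) (simp add: \<kappa>_ge)

text \<open>The sum up to \<open>\<kappa> n t\<close> converges when normalised by G at its
  endpoint; trading that for G n contributes \<open>rh t ^ m\<close>.\<close>

lemma a_sum_tendsto:
  assumes t: "t \<ge> 0" and m: "m \<ge> 1"
    and E: "(\<lambda>n. real n powr \<gamma> * ((real (Suc n) powr (\<gamma>/2) * r n) ^ m * g n)) \<longlonglongrightarrow> E"
  shows "(\<lambda>n. \<Sum>l<\<kappa> n t. a n l ^ m * g l) \<longlonglongrightarrow> \<rho> ^ m * rh t ^ m * (E / (real m * \<theta>))"
proof -
  define y where "y = (\<lambda>n. ss.G n ^ m * (\<Sum>k<n. (r k / ss.A (Suc k)) ^ m * g k))"
  have y: "y \<longlonglongrightarrow> E / (real m * \<theta>)" unfolding y_def by (rule ss.power_sum_tendsto[OF m E])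
  have "(\<lambda>n. y (\<kappa> n t)) \<longlonglongrightarrow> E / (real m * \<theta>)" by (rule filterlim_compose[OF y \<kappa>_at_top[OF t]])
  hence "(\<lambda>n. \<rho> ^ m * (ss.G n / ss.G (\<kappa> n t)) ^ m * y (\<kappa> n t)) \<longlonglongrightarrow> \<rho> ^ m * rh t ^ m * (E / (real m * \<theta>))"
    by (intro tendsto_mult tendsto_const tendsto_power ratio t)
  moreover have "\<rho> ^ m * (ss.G n / ss.G (\<kappa> n t)) ^ m * y (\<kappa> n t) = (\<Sum>l<\<kappa> n t. a n l ^ m * g l)" if "n \<ge> 1" for n
  proof -
    have "ss.G (\<kappa> n t) \<noteq> 0" using G_pos[of "\<kappa> n t"] \<kappa>_ge[OF t, of n] that by simp
    hence "\<rho> ^ m * (ss.G n / ss.G (\<kappa> n t)) ^ m * y (\<kappa> n t) = \<rho> ^ m * ss.G n ^ m * (\<Sum>k<\<kappa> n t. (r k / ss.A (Suc k)) ^ m * g k)"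
      unfolding y_def by (simp add: power_divide)
    also have "\<dots> = (\<Sum>l<\<kappa> n t. a n l ^ m * g l)"
      unfolding a_def power_mult_distrib by (simp add: sum_distrib_left mult.assoc)
    finally show ?thesis .
  qed
  ultimately show ?thesis
    by (simp add: Lim_transform_eventually[OF _ eventually_sequentiallyI[of 1]])
qed

definition b2 :: "real \<Rightarrow> real" where "b2 t = \<rho>\<^sup>2 * (rh t)\<^sup>2 * (c\<^sup>2 / (2 * \<theta>))"

lemma a_square_tendsto: "t \<ge> 0 \<Longrightarrow> (\<lambda>n. \<Sum>l<\<kappa> n t. (a n l)\<^sup>2) \<longlonglongrightarrow> b2 t"
  using a_sum_tendsto[of t 2 "\<lambda>_. 1", OF _ _ ss.square_source_tendsto[OF tendsto_const]] unfolding b2_def by simp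

lemma a_square_dev_tendsto: "t \<ge> 0 \<Longrightarrow> (\<lambda>n. \<Sum>l<\<kappa> n t. (a n l)\<^sup>2 * dev l) \<longlonglongrightarrow> 0"
  using a_sum_tendsto[of t 2 dev, OF _ _ ss.square_source_tendsto[OF dev_tendsto[OF ss.\<gamma> ss.c ss.rlim ss.r_lim0]]] by simp

lemma a_cube_tendsto: "t \<ge> 0 \<Longrightarrow> (\<lambda>n. \<Sum>l<\<kappa> n t. (a n l) ^ 3) \<longlonglongrightarrow> 0"
  using a_sum_tendsto[of t 3 "\<lambda>_. 1", OF _ _ ss.cube_source_tendsto] by simp

lemma b2_cont: "continuous_on {0..} b2"
  unfolding b2_def by (intro continuous_intros rh_cont)

text \<open>Monotonicity is inherited from the sums of squares with limit b2, so nothing about the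
  shape of \<open>rh\<close> is required.\<close>

lemma b2_mono: "0 \<le> s \<Longrightarrow> s \<le> t \<Longrightarrow> b2 s \<le> b2 t"
  by (rule LIMSEQ_le[OF a_square_tendsto a_square_tendsto])
     (auto intro!: exI[of _ 0] sum_mono2 \<kappa>_mono)

lemma b2_nonneg: "0 \<le> b2 t"
  unfolding b2_def using ss.\<theta> by simp

section \<open>Finite-dimensional limits\<close>

context
  fixes P :: "'b measure" and W :: "real \<Rightarrow> 'b \<Rightarrow> real"
  assumes W: "brownian_motion P W"
begin

text \<open>The replacement compares with W at the accumulated variances for the current n. These
  deterministic times converge, and continuity of the paths of W with dominated convergence gives
  the limit.\<close>

lemma smooth_fdd:
  assumes h: "blip J h" and C: "C \<ge> 0" "\<And>i. i < Suc J \<Longrightarrow> \<exists>h1 h2. dsmooth J C (\<lambda>j. if i \<le> j then 1 else 0) h h1 h2"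
  shows "(\<lambda>n. expectation (\<lambda>\<omega>. h (\<lambda>j. \<Sum>l<\<kappa> n (real (min j J) / real K). \<xi> n l \<omega>)))
    \<longlonglongrightarrow> (\<integral>\<omega>. h (\<lambda>j. W (s2 * b2 (real (min j J) / real K)) \<omega>) \<partial>P)"
proof -
  interpret P: prob_space P using W unfolding brownian_motion_def by blast
  \<comment> \<open>Clamping at J makes the time indices monotone in j and bounded by the one at J,
    also for coordinates that h ignores.\<close>
  define t where "t = (\<lambda>j. real (min j J) / real K)"
  have t0: "t j \<ge> 0" for j unfolding t_def by simp
  have Wm: "W s \<in> borel_measurable P" if "s \<ge> 0" for s using W that unfolding brownian_motion_def by blast
  define err where "err = (\<lambda>n. \<Sum>k<\<kappa> n (t J). (a n k)\<^sup>2 * dev k + (2 * a n k) ^ 3 + 2 * sqrt (s2 * (a n k)\<^sup>2) ^ 3)"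
  have lind: "\<bar>expectation (\<lambda>\<omega>. h (\<lambda>j. \<Sum>l<\<kappa> n (t j). \<xi> n l \<omega>)) - (\<integral>\<omega>. h (\<lambda>j. W (\<Sum>l<\<kappa> n (t j). s2 * (a n l)\<^sup>2) \<omega>) \<partial>P)\<bar> \<le> C * err n" for n
    unfolding err_def
  proof (rule lindeberg_replacement[where h=h and \<xi>="\<xi> n" and \<kappa>="\<lambda>j. \<kappa> n (t j)" and v="\<lambda>k. s2 * (a n k)\<^sup>2"
        and b="\<lambda>k. 2 * a n k" and d="\<lambda>k. (a n k)\<^sup>2 * dev k", OF W])
    have x: "bfun M M (\<xi> n k)" for k using mdiff_facts(3)[OF mdiff_\<xi>] .
    show "\<xi> n k \<in> borel_measurable M" for k using x[of k] by (simp add: bfun_def)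
    show "\<bar>\<xi> n k \<omega>\<bar> \<le> 2 * a n k" if "\<omega> \<in> space M" for k \<omega> by (rule \<xi>_bound[OF that])
    show "0 \<le> s2 * (a n k)\<^sup>2" for k using s2_range by simp
    show "mono (\<lambda>j. \<kappa> n (t j))" unfolding t_def by (intro monoI \<kappa>_mono divide_right_mono) auto
    show "\<kappa> n (t j) \<le> \<kappa> n (t J)" for j unfolding t_def by (intro \<kappa>_mono divide_right_mono) auto
    have bg: "bfun M (F k) (\<lambda>\<omega>. g (\<lambda>j. \<Sum>l<min k (\<kappa> n (t j)). \<xi> n l \<omega>))" if g: "blip J g" for g k
    proof -
      obtain B where B: "\<And>x. \<bar>g x\<bar> \<le> B" using blipD[OF g] by blast
      show ?thesis
      proof (rule bfunI[where B=B])
        show "(\<lambda>\<omega>. g (\<lambda>j. \<Sum>l<min k (\<kappa> n (t j)). \<xi> n l \<omega>)) \<in> borel_measurable (F k)"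
        proof (rule blip_measurable[OF g])
          fix j
          have "bfun M (F k) (\<lambda>\<omega>. \<Sum>l<min k (\<kappa> n (t j)). \<xi> n l \<omega>)" by (intro bfun_sum bfun_\<xi>) auto
          thus "(\<lambda>\<omega>. \<Sum>l<min k (\<kappa> n (t j)). \<xi> n l \<omega>) \<in> borel_measurable (F k)" by (simp add: bfun_def)
        qed
      qed (rule B)
    qed
    show "expectation (\<lambda>\<omega>. g (\<lambda>j. \<Sum>l<min k (\<kappa> n (t j)). \<xi> n l \<omega>) * \<xi> n k \<omega>) = 0" if "blip J g" for k g
      by (rule mdiff_facts(5)[OF mdiff_\<xi> bg[OF that]])
    show "\<bar>expectation (\<lambda>\<omega>. g (\<lambda>j. \<Sum>l<min k (\<kappa> n (t j)). \<xi> n l \<omega>) * ((\<xi> n k \<omega>)\<^sup>2 - s2 * (a n k)\<^sup>2))\<bar> \<le> B * ((a n k)\<^sup>2 * dev k)"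
      if g: "blip J g" and B: "\<And>x. \<bar>g x\<bar> \<le> B" for k g B
    proof -
      define f where "f = (\<lambda>\<omega>. g (\<lambda>j. \<Sum>l<min k (\<kappa> n (t j)). \<xi> n l \<omega>))"
      have "B \<ge> 0" using B[of undefined] by linarith
      hence zb: "\<bar>expectation (\<lambda>\<omega>. f \<omega> * ((\<zeta> k \<omega>)\<^sup>2 - s2))\<bar> \<le> B * dev k"
        by (intro \<zeta>_square_bound) (use bg[OF g] B in \<open>auto simp: f_def\<close>)
      have eq: "f \<omega> * ((\<xi> n k \<omega>)\<^sup>2 - s2 * (a n k)\<^sup>2) = (a n k)\<^sup>2 * (f \<omega> * ((\<zeta> k \<omega>)\<^sup>2 - s2))" for \<omega>
        unfolding \<xi>_def by (simp add: power_mult_distrib algebra_simps)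
      have "\<bar>expectation (\<lambda>\<omega>. f \<omega> * ((\<xi> n k \<omega>)\<^sup>2 - s2 * (a n k)\<^sup>2))\<bar> = (a n k)\<^sup>2 * \<bar>expectation (\<lambda>\<omega>. f \<omega> * ((\<zeta> k \<omega>)\<^sup>2 - s2))\<bar>"
        unfolding eq by (simp add: abs_mult)
      also have "\<dots> \<le> (a n k)\<^sup>2 * (B * dev k)" by (intro mult_left_mono zb) simp
      finally show ?thesis unfolding f_def by (simp add: mult.left_commute)
    qed
  qed (use h C in auto)
  \<comment> \<open>10 = 8 + 2: the cube of the bound \<open>2 * a n k\<close>, and the Gaussian
    third moment with s2 \<le> 1.\<close>
  have err0: "err \<longlonglongrightarrow> 0"
  proof (rule real_tendsto_sandwich[where f="\<lambda>_. 0"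
        and h="\<lambda>n. (\<Sum>k<\<kappa> n (t J). (a n k)\<^sup>2 * dev k) + 10 * (\<Sum>k<\<kappa> n (t J). (a n k) ^ 3)"])
    have "(\<lambda>n. (\<Sum>k<\<kappa> n (t J). (a n k)\<^sup>2 * dev k) + 10 * (\<Sum>k<\<kappa> n (t J). (a n k) ^ 3)) \<longlonglongrightarrow> 0 + 10 * 0"
      by (intro tendsto_add tendsto_mult tendsto_const a_square_dev_tendsto a_cube_tendsto t0)
    thus "(\<lambda>n. (\<Sum>k<\<kappa> n (t J). (a n k)\<^sup>2 * dev k) + 10 * (\<Sum>k<\<kappa> n (t J). (a n k) ^ 3)) \<longlonglongrightarrow> 0" by simp
    have dev0: "0 \<le> dev n" for n unfolding dev_def by (intro integral_nonneg_AE AE_I2 sum_nonneg) auto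
    show "\<forall>\<^sub>F n in sequentially. 0 \<le> err n"
      unfolding err_def using dev0 a_nonneg s2_range by (intro always_eventually allI sum_nonneg) auto
    have "err n \<le> (\<Sum>k<\<kappa> n (t J). (a n k)\<^sup>2 * dev k) + 10 * (\<Sum>k<\<kappa> n (t J). (a n k) ^ 3)" for n
      unfolding err_def sum_distrib_left sum.distrib[symmetric]
    proof (rule sum_mono)
      fix k
      have "sqrt (s2 * (a n k)\<^sup>2) = sqrt s2 * a n k" using a_nonneg[of n k] by (simp add: real_sqrt_mult)
      also have "\<dots> \<le> 1 * a n k" using s2_range a_nonneg[of n k] by (intro mult_right_mono) auto
      finally have "sqrt (s2 * (a n k)\<^sup>2) ^ 3 \<le> a n k ^ 3" using s2_range by (intro power_mono) auto
      thus "(a n k)\<^sup>2 * dev k + (2 * a n k) ^ 3 + 2 * sqrt (s2 * (a n k)\<^sup>2) ^ 3 \<le> (a n k)\<^sup>2 * dev k + 10 * a n k ^ 3"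
        by (simp add: power_mult_distrib)
    qed
    thus "\<forall>\<^sub>F n in sequentially. err n \<le> (\<Sum>k<\<kappa> n (t J). (a n k)\<^sup>2 * dev k) + 10 * (\<Sum>k<\<kappa> n (t J). (a n k) ^ 3)" by simp
  qed simp
  have Ce: "(\<lambda>n. C * err n) \<longlonglongrightarrow> 0" using tendsto_mult_left[OF err0, of C] by simp
  have d0: "(\<lambda>n. expectation (\<lambda>\<omega>. h (\<lambda>j. \<Sum>l<\<kappa> n (t j). \<xi> n l \<omega>)) - (\<integral>\<omega>. h (\<lambda>j. W (\<Sum>l<\<kappa> n (t j). s2 * (a n l)\<^sup>2) \<omega>) \<partial>P)) \<longlonglongrightarrow> 0"
    by (rule Lim_null_comparison[OF _ Ce]) (use lind in simp)
  have "(\<lambda>n. \<integral>\<omega>. h (\<lambda>j. W (\<Sum>l<\<kappa> n (t j). s2 * (a n l)\<^sup>2) \<omega>) \<partial>P) \<longlonglongrightarrow> (\<integral>\<omega>. h (\<lambda>j. W (s2 * b2 (t j)) \<omega>) \<partial>P)"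
  proof -
    obtain B L where B: "\<And>x. \<bar>h x\<bar> \<le> B" "\<And>x y. \<bar>h x - h y\<bar> \<le> L * (\<Sum>j\<le>J. \<bar>x j - y j\<bar>)" using blipD[OF h] by blast
    have vn: "0 \<le> (\<Sum>l<\<kappa> n (t j). s2 * (a n l)\<^sup>2)" for n j using s2_range by (intro sum_nonneg) auto
    have vl: "0 \<le> s2 * b2 (t j)" for j using s2_range b2_nonneg by simp
    show ?thesis
    proof (rule integral_dominated_convergence[where w="\<lambda>_. B"])
      show "(\<lambda>\<omega>. h (\<lambda>j. W (s2 * b2 (t j)) \<omega>)) \<in> borel_measurable P"
        by (rule blip_measurable[OF h]) (rule Wm[OF vl])
      show "(\<lambda>\<omega>. h (\<lambda>j. W (\<Sum>l<\<kappa> n (t j). s2 * (a n l)\<^sup>2) \<omega>)) \<in> borel_measurable P" for n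
        by (rule blip_measurable[OF h]) (rule Wm[OF vn])
      show "AE \<omega> in P. norm (h (\<lambda>j. W (\<Sum>l<\<kappa> n (t j). s2 * (a n l)\<^sup>2) \<omega>)) \<le> B" for n using B(1) by simp
      show "AE \<omega> in P. (\<lambda>n. h (\<lambda>j. W (\<Sum>l<\<kappa> n (t j). s2 * (a n l)\<^sup>2) \<omega>)) \<longlonglongrightarrow> h (\<lambda>j. W (s2 * b2 (t j)) \<omega>)"
      proof (rule AE_I2)
        fix \<omega> assume "\<omega> \<in> space P"
        hence cW: "continuous_on {0..} (\<lambda>t. W t \<omega>)" using W unfolding brownian_motion_def by blast
        have lj: "(\<lambda>n. W (\<Sum>l<\<kappa> n (t j). s2 * (a n l)\<^sup>2) \<omega>) \<longlonglongrightarrow> W (s2 * b2 (t j)) \<omega>" for j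
        proof (rule continuous_on_tendsto_compose[OF cW])
          show "(\<lambda>n. \<Sum>l<\<kappa> n (t j). s2 * (a n l)\<^sup>2) \<longlonglongrightarrow> s2 * b2 (t j)"
            unfolding sum_distrib_left[symmetric] by (intro tendsto_mult_left a_square_tendsto t0)
        qed (use vn vl in auto)
        have "(\<lambda>n. L * (\<Sum>j\<le>J. \<bar>W (\<Sum>l<\<kappa> n (t j). s2 * (a n l)\<^sup>2) \<omega> - W (s2 * b2 (t j)) \<omega>\<bar>)) \<longlonglongrightarrow> L * (\<Sum>j\<le>J. \<bar>W (s2 * b2 (t j)) \<omega> - W (s2 * b2 (t j)) \<omega>\<bar>)"
          by (intro tendsto_mult tendsto_const tendsto_sum tendsto_rabs tendsto_diff lj)
        hence z: "(\<lambda>n. L * (\<Sum>j\<le>J. \<bar>W (\<Sum>l<\<kappa> n (t j). s2 * (a n l)\<^sup>2) \<omega> - W (s2 * b2 (t j)) \<omega>\<bar>)) \<longlonglongrightarrow> 0" by simp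
        have "(\<lambda>n. h (\<lambda>j. W (\<Sum>l<\<kappa> n (t j). s2 * (a n l)\<^sup>2) \<omega>) - h (\<lambda>j. W (s2 * b2 (t j)) \<omega>)) \<longlonglongrightarrow> 0"
          by (rule Lim_null_comparison[OF _ z]) (simp add: B(2))
        thus "(\<lambda>n. h (\<lambda>j. W (\<Sum>l<\<kappa> n (t j). s2 * (a n l)\<^sup>2) \<omega>)) \<longlonglongrightarrow> h (\<lambda>j. W (s2 * b2 (t j)) \<omega>)" by (rule LIM_zero_cancel)
      qed
    qed simp
  qed
  from tendsto_add[OF d0 this] show ?thesis unfolding t_def by simp
qed

text \<open>Removes two simplifications of \<open>smooth_fdd\<close>: a bounded Lipschitz h is
  replaced by a uniformly close smooth one, and the initial value of S costs at most a multiple of G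
  n.\<close>

lemma fdd:
  assumes h: "blip J h"
  shows "(\<lambda>n. expectation (\<lambda>\<omega>. h (\<lambda>j. S n (\<kappa> n (real j / real K)) \<omega>)))
    \<longlonglongrightarrow> (\<integral>\<omega>. h (\<lambda>j. W (s2 * b2 (real j / real K)) \<omega>) \<partial>P)"
proof (rule LIMSEQ_I)
  fix e0 :: real assume e0: "e0 > 0"
  interpret P: prob_space P using W unfolding brownian_motion_def by blast
  have Wm: "W s \<in> borel_measurable P" if "s \<ge> 0" for s using W that unfolding brownian_motion_def by blast
  obtain B L where B: "B \<ge> 0" "L \<ge> 0" "\<And>x. \<bar>h x\<bar> \<le> B" "\<And>x y. \<bar>h x - h y\<bar> \<le> L * (\<Sum>j\<le>J. \<bar>x j - y j\<bar>)"
    using blipD[OF h] by blast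
  have cut: "h x = h (\<lambda>j. x (min j J))" for x using B(4)[of x "\<lambda>j. x (min j J)"] by simp
  \<comment> \<open>Four errors of size \<epsilon> occur: smoothing on either side, the initial
    value, and the limit for g.\<close>
  define \<epsilon> where "\<epsilon> = e0 / 5"
  have eps: "\<epsilon> > 0" using e0 unfolding \<epsilon>_def by simp
  have "\<bar>if i \<le> j then 1 else 0 :: real\<bar> \<le> 1" for i j :: nat by simp
  from smooth_approximation[where e="\<lambda>i j. if i \<le> j then 1 else 0" and m="Suc J", OF h this eps]
  obtain g C where g: "blip J g" "\<And>x. \<bar>g x - h x\<bar> \<le> \<epsilon>" "C \<ge> 0"
    "\<And>i. i < Suc J \<Longrightarrow> \<exists>h1 h2. dsmooth J C (\<lambda>j. if i \<le> j then 1 else 0) g h1 h2" by blast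
  define t where "t = (\<lambda>j. real (min j J) / real K)"
  define U where "U = (\<lambda>n \<omega> j. \<Sum>l<\<kappa> n (t j). \<xi> n l \<omega>)"
  define V where "V = (\<lambda>\<omega> j. W (s2 * b2 (t j)) \<omega>)"
  have lim: "(\<lambda>n. expectation (\<lambda>\<omega>. g (U n \<omega>))) \<longlonglongrightarrow> (\<integral>\<omega>. g (V \<omega>) \<partial>P)"
    unfolding U_def V_def t_def by (rule smooth_fdd[OF g(1,3,4)])
  have Um: "(\<lambda>\<omega>. U n \<omega> j) \<in> borel_measurable M" for n j
    unfolding U_def using mdiff_facts(3)[OF mdiff_\<xi>] by (intro borel_measurable_sum) (auto simp: bfun_def)
  have Vm: "(\<lambda>\<omega>. V \<omega> j) \<in> borel_measurable P" for j
    unfolding V_def by (rule Wm) (use s2_range b2_nonneg in simp)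
  have Sm: "(\<lambda>\<omega>. S n (\<kappa> n (t j)) \<omega>) \<in> borel_measurable M" for n j
    using bfun_subalgebra[OF subalgebra_F bfun_S[OF order_refl]] by (simp add: bfun_def)
  have c1: "\<bar>(\<integral>\<omega>. g (V \<omega>) \<partial>P) - (\<integral>\<omega>. h (V \<omega>) \<partial>P)\<bar> \<le> \<epsilon>"
  proof -
    have "(\<integral>\<omega>. g (V \<omega>) \<partial>P) - (\<integral>\<omega>. h (V \<omega>) \<partial>P) = (\<integral>\<omega>. g (V \<omega>) - h (V \<omega>) \<partial>P)"
      by (rule Bochner_Integration.integral_diff[symmetric]) (rule P.blip_integrable[OF g(1) Vm] P.blip_integrable[OF h Vm])+
    thus ?thesis using P.abs_expectation_le[of "\<lambda>\<omega>. g (V \<omega>) - h (V \<omega>)" \<epsilon>] g(2) eps by simp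
  qed
  have c2: "\<bar>expectation (\<lambda>\<omega>. g (U n \<omega>)) - expectation (\<lambda>\<omega>. h (U n \<omega>))\<bar> \<le> \<epsilon>" for n
  proof -
    have "expectation (\<lambda>\<omega>. g (U n \<omega>)) - expectation (\<lambda>\<omega>. h (U n \<omega>)) = expectation (\<lambda>\<omega>. g (U n \<omega>) - h (U n \<omega>))"
      by (rule Bochner_Integration.integral_diff[symmetric]) (rule blip_integrable[OF g(1) Um] blip_integrable[OF h Um])+
    thus ?thesis using abs_expectation_le[of "\<lambda>\<omega>. g (U n \<omega>) - h (U n \<omega>)" \<epsilon>] g(2) eps by simp
  qed
  have c3: "\<bar>expectation (\<lambda>\<omega>. h (\<lambda>j. S n (\<kappa> n (t j)) \<omega>)) - expectation (\<lambda>\<omega>. h (U n \<omega>))\<bar> \<le> L * (real (Suc J) * ss.G n)" for n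
  proof -
    have "expectation (\<lambda>\<omega>. h (\<lambda>j. S n (\<kappa> n (t j)) \<omega>)) - expectation (\<lambda>\<omega>. h (U n \<omega>))
        = expectation (\<lambda>\<omega>. h (\<lambda>j. S n (\<kappa> n (t j)) \<omega>) - h (U n \<omega>))"
      by (rule Bochner_Integration.integral_diff[symmetric]) (rule blip_integrable[OF h Sm] blip_integrable[OF h Um])+
    moreover have "\<bar>expectation (\<lambda>\<omega>. h (\<lambda>j. S n (\<kappa> n (t j)) \<omega>) - h (U n \<omega>))\<bar> \<le> L * (real (Suc J) * ss.G n)"
    proof (rule abs_expectation_le)
      fix \<omega> assume w: "\<omega> \<in> space M"
      have "\<bar>h (\<lambda>j. S n (\<kappa> n (t j)) \<omega>) - h (U n \<omega>)\<bar> \<le> L * (\<Sum>j\<le>J. \<bar>S n (\<kappa> n (t j)) \<omega> - U n \<omega> j\<bar>)" by (rule B(4))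
      also have "\<dots> \<le> L * (\<Sum>j\<le>J. ss.G n)"
      proof (intro mult_left_mono sum_mono B(2))
        fix j
        have "S n (\<kappa> n (t j)) \<omega> - U n \<omega> j = S n 0 \<omega>" using S_eq[OF w, of n "\<kappa> n (t j)"] unfolding U_def by linarith
        thus "\<bar>S n (\<kappa> n (t j)) \<omega> - U n \<omega> j\<bar> \<le> ss.G n" using S_0[OF w, of n] by simp
      qed
      finally show "\<bar>h (\<lambda>j. S n (\<kappa> n (t j)) \<omega>) - h (U n \<omega>)\<bar> \<le> L * (real (Suc J) * ss.G n)" by simp
    qed (use B(2) G_nonneg in simp)
    ultimately show ?thesis by simp
  qed
  have "(\<lambda>n. L * (real (Suc J) * ss.G n)) \<longlonglongrightarrow> L * (real (Suc J) * 0)" by (intro tendsto_mult tendsto_const ss.G_lim0)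
  hence "\<forall>\<^sub>F n in sequentially. L * (real (Suc J) * ss.G n) < \<epsilon>" by (rule order_tendstoD) (use eps in simp)
  moreover have "\<forall>\<^sub>F n in sequentially. dist (expectation (\<lambda>\<omega>. g (U n \<omega>))) (\<integral>\<omega>. g (V \<omega>) \<partial>P) < \<epsilon>" by (rule tendstoD[OF lim eps])
  ultimately have "\<forall>\<^sub>F n in sequentially. \<bar>expectation (\<lambda>\<omega>. h (\<lambda>j. S n (\<kappa> n (t j)) \<omega>)) - (\<integral>\<omega>. h (V \<omega>) \<partial>P)\<bar> < e0"
  proof eventually_elim
    case (elim n)
    have "5 * \<epsilon> = e0" unfolding \<epsilon>_def by simp
    thus ?case using elim c1 c2[of n] c3[of n] eps unfolding dist_real_def by linarith
  qed
  moreover have "h (\<lambda>j. S n (\<kappa> n (real j / real K)) \<omega>) = h (\<lambda>j. S n (\<kappa> n (t j)) \<omega>)" for n \<omega>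
    unfolding t_def by (rule cut)
  moreover have "h (\<lambda>j. W (s2 * b2 (real j / real K)) \<omega>) = h (V \<omega>)" for \<omega> unfolding V_def t_def by (rule cut)
  ultimately show "\<exists>no. \<forall>n\<ge>no. norm (expectation (\<lambda>\<omega>. h (\<lambda>j. S n (\<kappa> n (real j / real K)) \<omega>)) - (\<integral>\<omega>. h (\<lambda>j. W (s2 * b2 (real j / real K)) \<omega>) \<partial>P)) < e0"
    unfolding eventually_sequentially by simp
qed

end

end

section \<open>Step paths and measurability of their functionals\<close>

lemma cadlag_step_path:
  fixes s x C :: real and f :: "nat \<Rightarrow> real"
  assumes s: "s > 0" and v: "continuous_on {0..} v"
  shows "cadlag (\<lambda>t. C * v t * f (nat \<lfloor>x + s * t\<rfloor>))"
  unfolding cadlag_def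
proof (intro conjI allI impI)
  have cv: "cadlag v" by (rule continuous_cadlag[OF v])
  fix t :: real assume t: "t \<ge> 0"
  have "\<forall>\<^sub>F t' in at_right t. \<lfloor>x + s * t'\<rfloor> = \<lfloor>x + s * t\<rfloor>"
    unfolding eventually_at_right_field
  proof (intro exI[of _ "(real_of_int \<lfloor>x + s * t\<rfloor> + 1 - x) / s"] conjI allI impI)
    have "x + s * t < real_of_int \<lfloor>x + s * t\<rfloor> + 1" by linarith
    thus "t < (real_of_int \<lfloor>x + s * t\<rfloor> + 1 - x) / s" using s by (simp add: field_simps)
    fix t' assume t': "t < t'" "t' < (real_of_int \<lfloor>x + s * t\<rfloor> + 1 - x) / s"
    have "s * t' < real_of_int \<lfloor>x + s * t\<rfloor> + 1 - x" using t'(2) s by (simp add: field_simps)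
    moreover have "s * t < s * t'" using t'(1) s by simp
    ultimately show "\<lfloor>x + s * t'\<rfloor> = \<lfloor>x + s * t\<rfloor>" by (intro floor_unique) linarith+
  qed
  hence "\<forall>\<^sub>F t' in at_right t. C * v t' * f (nat \<lfloor>x + s * t\<rfloor>) = C * v t' * f (nat \<lfloor>x + s * t'\<rfloor>)"
    by eventually_elim simp
  moreover have "((\<lambda>t'. C * v t' * f (nat \<lfloor>x + s * t\<rfloor>)) \<longlongrightarrow> C * v t * f (nat \<lfloor>x + s * t\<rfloor>)) (at_right t)"
    using cv t unfolding cadlag_def by (intro tendsto_mult tendsto_const) auto
  ultimately show "((\<lambda>t. C * v t * f (nat \<lfloor>x + s * t\<rfloor>)) \<longlongrightarrow> C * v t * f (nat \<lfloor>x + s * t\<rfloor>)) (at_right t)"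
    by (rule Lim_transform_eventually[rotated])
next
  have cv: "cadlag v" by (rule continuous_cadlag[OF v])
  fix t :: real assume t: "t > 0"
  obtain l where l: "(v \<longlongrightarrow> l) (at_left t)" using cv t unfolding cadlag_def by blast
  \<comment> \<open>The floor just to the left of t; using the ceiling also covers the jump times,
    where x + s t is an integer.\<close>
  define k where "k = \<lceil>x + s * t\<rceil> - 1"
  have "\<forall>\<^sub>F t' in at_left t. \<lfloor>x + s * t'\<rfloor> = k"
    unfolding eventually_at_left_field
  proof (intro exI[of _ "(real_of_int k - x) / s"] conjI allI impI)
    have "real_of_int k < x + s * t" unfolding k_def by linarith
    thus "(real_of_int k - x) / s < t" using s by (simp add: field_simps)
    fix t' assume t': "(real_of_int k - x) / s < t'" "t' < t"
    have "real_of_int k - x < s * t'" using t'(1) s by (simp add: field_simps)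
    moreover have "s * t' < s * t" using t'(2) s by simp
    moreover have "x + s * t \<le> real_of_int k + 1" unfolding k_def by simp
    ultimately show "\<lfloor>x + s * t'\<rfloor> = k" by (intro floor_unique) linarith+
  qed
  hence "\<forall>\<^sub>F t' in at_left t. C * v t' * f (nat k) = C * v t' * f (nat \<lfloor>x + s * t'\<rfloor>)"
    by eventually_elim simp
  moreover have "((\<lambda>t'. C * v t' * f (nat k)) \<longlongrightarrow> C * l * f (nat k)) (at_left t)"
    using l by (intro tendsto_mult tendsto_const)
  ultimately have "((\<lambda>t. C * v t * f (nat \<lfloor>x + s * t\<rfloor>)) \<longlongrightarrow> C * l * f (nat k)) (at_left t)"
    by (rule Lim_transform_eventually[rotated])
  thus "\<exists>l. ((\<lambda>t. C * v t * f (nat \<lfloor>x + s * t\<rfloor>)) \<longlongrightarrow> l) (at_left t)" by blast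
qed

text \<open>The functional factors through the sequence of values of X. As a function of that
  sequence it is continuous: on a bounded time interval only finitely many values are visible, so
  coordinatewise convergence gives locally uniform convergence of the paths.\<close>

lemma sk_test_step_path_measurable:
  fixes s x C :: real and X :: "nat \<Rightarrow> 'a \<Rightarrow> real"
  assumes f: "sk_test f" and s: "s > 0" and v: "continuous_on {0..} v"
    and X: "\<And>k. X k \<in> borel_measurable M"
  shows "(\<lambda>\<omega>. f (\<lambda>t. C * v t * X (nat \<lfloor>x + s * t\<rfloor>) \<omega>)) \<in> borel_measurable M"
proof -
  define \<Psi> where "\<Psi> = (\<lambda>g :: nat \<Rightarrow> real. f (\<lambda>t. C * v t * g (nat \<lfloor>x + s * t\<rfloor>)))"
  have "continuous_on UNIV \<Psi>"
    unfolding continuous_on_sequentially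
  proof (intro allI ballI impI)
    fix gs :: "nat \<Rightarrow> nat \<Rightarrow> real" and g :: "nat \<Rightarrow> real"
    assume "(\<forall>n. gs n \<in> UNIV) \<and> gs \<longlonglongrightarrow> g"
    hence lim: "gs \<longlonglongrightarrow> g" by simp
    have coord: "(\<lambda>n. gs n k) \<longlonglongrightarrow> g k" for k
    proof -
      have "continuous_on UNIV (\<lambda>y::nat\<Rightarrow>real. y k)" by (rule continuous_on_product_coordinates)
      from continuous_on_tendsto_compose[OF this lim] show ?thesis by simp
    qed
    have "sk_converges (\<lambda>n t. C * v t * gs n (nat \<lfloor>x + s * t\<rfloor>)) (\<lambda>t. C * v t * g (nat \<lfloor>x + s * t\<rfloor>))"
    proof (rule sk_converges_locally_uniformly)
      fix m e0 :: real assume e0: "e0 > 0"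
      have "bounded (v ` {0..m})"
        by (intro compact_imp_bounded compact_continuous_image continuous_on_subset[OF v]) auto
      then obtain Bv where Bv: "\<And>t. t \<in> {0..m} \<Longrightarrow> \<bar>v t\<bar> \<le> Bv" unfolding bounded_iff by fastforce
      define k where "k = nat \<lfloor>x + s * m\<rfloor>"
      have "(\<lambda>n. \<bar>C\<bar> * \<bar>Bv\<bar> * (\<Sum>j\<le>k. \<bar>gs n j - g j\<bar>)) \<longlonglongrightarrow> \<bar>C\<bar> * \<bar>Bv\<bar> * (\<Sum>j\<le>k. \<bar>g j - g j\<bar>)"
        by (intro tendsto_mult tendsto_const tendsto_sum tendsto_rabs tendsto_diff coord)
      hence "(\<lambda>n. \<bar>C\<bar> * \<bar>Bv\<bar> * (\<Sum>j\<le>k. \<bar>gs n j - g j\<bar>)) \<longlonglongrightarrow> 0" by simp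
      hence "\<forall>\<^sub>F n in sequentially. \<bar>C\<bar> * \<bar>Bv\<bar> * (\<Sum>j\<le>k. \<bar>gs n j - g j\<bar>) < e0" using e0 by (rule order_tendstoD)
      thus "\<forall>\<^sub>F n in sequentially. \<forall>t\<in>{0..m}. \<bar>C * v t * gs n (nat \<lfloor>x + s * t\<rfloor>) - C * v t * g (nat \<lfloor>x + s * t\<rfloor>)\<bar> \<le> e0"
      proof eventually_elim
        case (elim n)
        show ?case
        proof
          fix t assume t: "t \<in> {0..m}"
          define j where "j = nat \<lfloor>x + s * t\<rfloor>"
          have "j \<le> k" unfolding j_def k_def using t s by (intro nat_mono floor_mono add_left_mono mult_left_mono) auto
          hence "\<bar>gs n j - g j\<bar> \<le> (\<Sum>j\<le>k. \<bar>gs n j - g j\<bar>)" by (intro member_le_sum) auto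
          moreover have "\<bar>C * v t\<bar> \<le> \<bar>C\<bar> * \<bar>Bv\<bar>" using Bv[OF t] by (simp add: abs_mult mult_left_mono)
          ultimately have "\<bar>C * v t\<bar> * \<bar>gs n j - g j\<bar> \<le> \<bar>C\<bar> * \<bar>Bv\<bar> * (\<Sum>j\<le>k. \<bar>gs n j - g j\<bar>)" by (intro mult_mono) auto
          moreover have "C * v t * gs n j - C * v t * g j = C * v t * (gs n j - g j)" by (simp add: right_diff_distrib)
          ultimately show "\<bar>C * v t * gs n (nat \<lfloor>x + s * t\<rfloor>) - C * v t * g (nat \<lfloor>x + s * t\<rfloor>)\<bar> \<le> e0"
            using elim unfolding j_def[symmetric] by (simp add: abs_mult)
        qed
      qed
    qed
    moreover have "\<forall>xs x. cadlag x \<and> (\<forall>n. cadlag (xs n)) \<and> sk_converges xs x \<longrightarrow> (\<lambda>n. f (xs n)) \<longlonglongrightarrow> f x"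
      using f unfolding sk_test_def by (elim conjE)
    ultimately show "(\<Psi> \<circ> gs) \<longlonglongrightarrow> \<Psi> g"
      unfolding \<Psi>_def comp_def using cadlag_step_path[OF s v] by simp
  qed
  hence "\<Psi> \<in> borel_measurable borel" by (rule borel_measurable_continuous_onI)
  moreover have "(\<lambda>\<omega> k. X k \<omega>) \<in> borel_measurable M" using X by (rule measurable_coordinatewise_then_product)
  ultimately have "(\<lambda>\<omega>. \<Psi> (\<lambda>k. X k \<omega>)) \<in> borel_measurable M" by (rule measurable_compose[rotated])
  thus ?thesis unfolding \<Psi>_def .
qed

section \<open>Oscillation between grid points and the functional limit\<close>

context fluctuation
begin

text \<open>Two errors are added: the martingale moves little within a grid cell, by the maximal
  inequality in every cell, and the weighted deviation differs from S by a factor near 1, harmless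
  once S is bounded with high probability.\<close>

lemma oscillation:
  assumes T: "T > 0" and \<epsilon>: "\<epsilon> > 0" and \<delta>: "\<delta> > 0"
  shows "\<exists>K0. \<forall>K\<ge>K0. \<forall>\<^sub>F n in sequentially.
      \<exists>A\<in>sets M. measure M A \<le> \<delta> \<and> (\<forall>\<omega>\<in>space M - A. \<forall>t\<in>{0..T}.
        \<bar>real n powr (\<gamma>/2) * wt t * D (\<kappa> n t) \<omega> - S n (\<kappa> n (real_of_int \<lfloor>real K * t\<rfloor> / real K)) \<omega>\<bar> \<le> \<epsilon>)"
proof -
  define \<epsilon>1 where "\<epsilon>1 = \<epsilon> / 4"
  have e1: "\<epsilon>1 > 0" using \<epsilon> unfolding \<epsilon>1_def by simp
  \<comment> \<open>The cell containing T may end later, but not after T + 1 since K > 1. The extra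
    1 leaves room for passing from b2 to its prelimits.\<close>
  define Q where "Q = b2 (T + 1) + 1"
  have Q: "Q > 0" using b2_nonneg[of "T + 1"] unfolding Q_def by simp
  \<comment> \<open>Makes 64 / \<epsilon>1^4 * (2 \<eta> Q) equal to \<delta>/2, the probability
    granted to the cells.\<close>
  define \<eta> where "\<eta> = \<delta> * \<epsilon>1 ^ 4 / (256 * Q)"
  have eta: "\<eta> > 0" using \<delta> e1 Q unfolding \<eta>_def by simp
  have "uniformly_continuous_on {0..T+1} b2"
    by (rule compact_uniformly_continuous) (auto intro: continuous_on_subset[OF b2_cont])
  then obtain d where d: "d > 0" "\<And>s t. s \<in> {0..T+1} \<Longrightarrow> t \<in> {0..T+1} \<Longrightarrow> dist s t < d \<Longrightarrow> dist (b2 s) (b2 t) < \<eta>"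
    unfolding uniformly_continuous_on_def using eta by metis
  \<comment> \<open>A level the martingale reaches up to time T + 1 with probability at most
    \<delta>/4. It is needed because the weight error is multiplicative.\<close>
  obtain \<Lambda> where L: "\<Lambda> > 0" "64 * Q\<^sup>2 / \<Lambda> ^ 4 \<le> \<delta> / 4"
  proof -
    have "(\<lambda>n. 64 * Q\<^sup>2 / real n ^ 4) \<longlonglongrightarrow> 0" by real_asymp
    hence "\<forall>\<^sub>F n in sequentially. 64 * Q\<^sup>2 / real n ^ 4 < \<delta> / 4" by (rule order_tendstoD) (use \<delta> in simp)
    moreover have "\<forall>\<^sub>F n in sequentially. n \<ge> (1::nat)" by (rule eventually_ge_at_top)
    ultimately have "\<forall>\<^sub>F n in sequentially. 64 * Q\<^sup>2 / real n ^ 4 < \<delta> / 4 \<and> n \<ge> 1" by (rule eventually_conj)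
    then obtain n where "64 * Q\<^sup>2 / real n ^ 4 < \<delta> / 4" "n \<ge> 1" by (auto simp: eventually_sequentially)
    thus ?thesis by (intro that[of "real n"]) auto
  qed
  define \<epsilon>2 where "\<epsilon>2 = \<epsilon> / (2 * (\<Lambda> + 1))"
  have e2: "\<epsilon>2 > 0" "\<epsilon>2 * (\<Lambda> + 1) = \<epsilon> / 2" using \<epsilon> L(1) unfolding \<epsilon>2_def by (auto simp: field_simps)
  obtain K0 :: nat where K0: "real K0 > max 1 (1/d)" using reals_Archimedean2 by blast
  show ?thesis
  proof (intro exI[of _ K0] allI impI)
    fix K assume KK: "K \<ge> K0"
    have K: "real K > 1" "real K > 1/d" using K0 KK by auto
    have Kd: "1 / real K < d" using K d(1) by (simp add: field_simps)
    define J where "J = nat \<lfloor>real K * T\<rfloor>"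
    define t where "t = (\<lambda>j. real j / real K)"
    have t0: "t j \<ge> 0" for j unfolding t_def by simp
    have tm: "t j \<le> t k" if "j \<le> k" for j k unfolding t_def using that by (intro divide_right_mono) auto
    have tJ: "t (Suc J) \<le> T + 1"
    proof -
      have "real J \<le> real K * T" unfolding J_def using T by (simp add: of_nat_floor)
      hence "real (Suc J) \<le> (T + 1) * real K" using K(1) by (simp add: algebra_simps)
      thus ?thesis unfolding t_def using K(1) by (simp add: divide_le_eq)
    qed
    have inc: "b2 (t (Suc j)) - b2 (t j) \<le> \<eta>" "0 \<le> b2 (t (Suc j)) - b2 (t j)" if "j \<le> J" for j
    proof -
      have "dist (t (Suc j)) (t j) < d" using Kd K(1) unfolding t_def dist_real_def by (simp add: diff_divide_distrib[symmetric])
      moreover have "t (Suc j) \<in> {0..T+1}" "t j \<in> {0..T+1}" using t0 tm[of "Suc j" "Suc J"] tm[of j "Suc J"] tJ that by (auto intro: order_trans)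
      ultimately have "dist (b2 (t (Suc j))) (b2 (t j)) < \<eta>" by (intro d(2))
      thus "b2 (t (Suc j)) - b2 (t j) \<le> \<eta>" by (simp add: dist_real_def)
      show "0 \<le> b2 (t (Suc j)) - b2 (t j)" using b2_mono[OF t0 tm[of j "Suc j"]] by simp
    qed
    \<comment> \<open>Largest cell increment times total increment: here the quadratic form of the
      maximal inequality pays off.\<close>
    have sum_sq: "(\<Sum>j\<le>J. (b2 (t (Suc j)) - b2 (t j))\<^sup>2) \<le> \<eta> * Q"
    proof -
      have "(\<Sum>j\<le>J. (b2 (t (Suc j)) - b2 (t j))\<^sup>2) \<le> (\<Sum>j\<le>J. \<eta> * (b2 (t (Suc j)) - b2 (t j)))"
        unfolding power2_eq_square using inc by (intro sum_mono mult_right_mono) auto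
      also have "\<dots> = \<eta> * (b2 (t (Suc J)) - b2 (t 0))"
        using sum_lessThan_telescope[of "\<lambda>j. b2 (t j)" "Suc J"]
        unfolding sum_distrib_left[symmetric] lessThan_Suc_atMost by simp
      also have "\<dots> \<le> \<eta> * Q"
        using b2_mono[OF t0 tJ] b2_nonneg[of "t 0"] eta unfolding Q_def by (intro mult_left_mono) auto
      finally show ?thesis .
    qed
    define Bn where "Bn = (\<lambda>n s. \<Sum>l<\<kappa> n s. (a n l)\<^sup>2)"
    have Bn: "(\<lambda>n. Bn n s) \<longlonglongrightarrow> b2 s" if "s \<ge> 0" for s unfolding Bn_def by (rule a_square_tendsto[OF that])
    have "(\<lambda>n. \<Sum>j\<le>J. (Bn n (t (Suc j)) - Bn n (t j))\<^sup>2) \<longlonglongrightarrow> (\<Sum>j\<le>J. (b2 (t (Suc j)) - b2 (t j))\<^sup>2)"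
      by (intro tendsto_sum tendsto_power tendsto_diff Bn t0)
    hence ev1: "\<forall>\<^sub>F n in sequentially. (\<Sum>j\<le>J. (Bn n (t (Suc j)) - Bn n (t j))\<^sup>2) < 2 * (\<eta> * Q)"
      by (rule order_tendstoD) (use sum_sq eta Q mult_pos_pos[OF eta Q] in linarith)
    have ev2: "\<forall>\<^sub>F n in sequentially. Bn n (T + 1) < Q"
      by (rule order_tendstoD[OF Bn]) (use T in \<open>auto simp: Q_def\<close>)
    have ev3: "\<forall>\<^sub>F n in sequentially. ss.G n < 1" by (rule order_tendstoD[OF ss.G_lim0]) simp
    have ev4: "\<forall>\<^sub>F n in sequentially. n \<ge> (1::nat)" by (rule eventually_ge_at_top)
    show "\<forall>\<^sub>F n in sequentially.
      \<exists>A\<in>sets M. measure M A \<le> \<delta> \<and> (\<forall>\<omega>\<in>space M - A. \<forall>t\<in>{0..T}.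
        \<bar>real n powr (\<gamma>/2) * wt t * D (\<kappa> n t) \<omega> - S n (\<kappa> n (real_of_int \<lfloor>real K * t\<rfloor> / real K)) \<omega>\<bar> \<le> \<epsilon>)"
      using ev1 ev2 ev3 ev4 weight[OF e2(1), of T]
    proof eventually_elim
      case (elim n)
      define A1 where "A1 = (\<lambda>j. {\<omega>\<in>space M. \<exists>k\<in>{\<kappa> n (t j)..\<kappa> n (t (Suc j))}. \<epsilon>1 \<le> \<bar>\<Sum>l=\<kappa> n (t j)..<k. \<xi> n l \<omega>\<bar>})"
      define A2 where "A2 = {\<omega>\<in>space M. \<exists>k\<in>{0..\<kappa> n (T + 1)}. \<Lambda> \<le> \<bar>\<Sum>l=0..<k. \<xi> n l \<omega>\<bar>}"
      have A1: "A1 j \<in> sets M" "prob (A1 j) \<le> 64 * (Bn n (t (Suc j)) - Bn n (t j))\<^sup>2 / \<epsilon>1 ^ 4" for j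
      proof -
        have "(\<Sum>l=\<kappa> n (t j)..<\<kappa> n (t (Suc j)). (a n l)\<^sup>2) = Bn n (t (Suc j)) - Bn n (t j)"
        proof -
          have "\<kappa> n (t j) \<le> \<kappa> n (t (Suc j))" by (intro \<kappa>_mono tm) simp
          from sum.atLeastLessThan_concat[OF le0 this, of "\<lambda>l. (a n l)\<^sup>2"] show ?thesis
            unfolding Bn_def by (simp add: atLeast0LessThan)
        qed
        thus "A1 j \<in> sets M" "prob (A1 j) \<le> 64 * (Bn n (t (Suc j)) - Bn n (t j))\<^sup>2 / \<epsilon>1 ^ 4"
          using mdiff_maximal[OF mdiff_\<xi> e1, of "\<kappa> n (t j)" "\<kappa> n (t (Suc j))" n] unfolding A1_def by simp_all
      qed
      have A2: "A2 \<in> sets M" "prob A2 \<le> 64 * (Bn n (T + 1))\<^sup>2 / \<Lambda> ^ 4"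
        using mdiff_maximal[OF mdiff_\<xi> L(1), of 0 "\<kappa> n (T + 1)" n] unfolding A2_def Bn_def atLeast0LessThan by simp_all
      define A where "A = (\<Union>j\<le>J. A1 j) \<union> A2"
      have Am: "A \<in> sets M" unfolding A_def using A1(1) A2(1) by auto
      have "prob A \<le> prob (\<Union>j\<le>J. A1 j) + prob A2"
        unfolding A_def using A1(1) A2(1) by (intro measure_Un_le) auto
      also have "prob (\<Union>j\<le>J. A1 j) \<le> (\<Sum>j\<le>J. prob (A1 j))"
        using A1(1) by (intro measure_UNION_le) auto
      also have "\<dots> \<le> (\<Sum>j\<le>J. 64 * (Bn n (t (Suc j)) - Bn n (t j))\<^sup>2 / \<epsilon>1 ^ 4)" by (intro sum_mono A1(2))
      also have "\<dots> = 64 / \<epsilon>1 ^ 4 * (\<Sum>j\<le>J. (Bn n (t (Suc j)) - Bn n (t j))\<^sup>2)" by (simp add: sum_distrib_left)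
      also have "\<dots> \<le> 64 / \<epsilon>1 ^ 4 * (2 * (\<eta> * Q))" using elim(1) by (intro mult_left_mono) auto
      also have "\<dots> = \<delta> / 2" using e1 Q unfolding \<eta>_def by (simp add: field_simps)
      also have "prob A2 \<le> \<delta> / 4"
      proof -
        have "0 \<le> Bn n (T + 1)" unfolding Bn_def by (intro sum_nonneg) auto
        hence "(Bn n (T + 1))\<^sup>2 \<le> Q\<^sup>2" using elim(2) by (intro power_mono) auto
        hence "64 * (Bn n (T + 1))\<^sup>2 / \<Lambda> ^ 4 \<le> 64 * Q\<^sup>2 / \<Lambda> ^ 4" by (intro divide_right_mono mult_left_mono) auto
        thus ?thesis using A2(2) L(2) by linarith
      qed
      finally have pA: "prob A \<le> \<delta>" using \<delta> by simp
      have "\<bar>real n powr (\<gamma>/2) * wt s * D (\<kappa> n s) \<omega> - S n (\<kappa> n (real_of_int \<lfloor>real K * s\<rfloor> / real K)) \<omega>\<bar> \<le> \<epsilon>"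
        if w: "\<omega> \<in> space M - A" and s: "s \<in> {0..T}" for \<omega> s
      proof -
        have wM: "\<omega> \<in> space M" using w by simp
        define j where "j = nat \<lfloor>real K * s\<rfloor>"
        define k where "k = \<kappa> n s"
        have f0: "0 \<le> \<lfloor>real K * s\<rfloor>" using s by simp
        hence tj: "real_of_int \<lfloor>real K * s\<rfloor> / real K = t j" unfolding t_def j_def by simp
        have jJ: "j \<le> J" unfolding j_def J_def using s by (intro nat_mono floor_mono mult_left_mono) auto
        have rj: "real j = real_of_int \<lfloor>real K * s\<rfloor>" using f0 unfolding j_def by simp
        have "t j \<le> s" unfolding t_def rj using K(1) by (simp add: divide_le_eq mult.commute)
        moreover have "s \<le> t (Suc j)"
        proof -
          have "real K * s \<le> real (Suc j)" using rj by simp linarith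
          thus ?thesis unfolding t_def using K(1) by (simp add: le_divide_eq mult.commute)
        qed
        ultimately have k1: "\<kappa> n (t j) \<le> k" "k \<le> \<kappa> n (t (Suc j))" unfolding k_def by (auto intro: \<kappa>_mono)
        have k2: "k \<le> \<kappa> n (T + 1)" unfolding k_def using s by (intro \<kappa>_mono) auto
        have "\<omega> \<notin> A1 j" using w jJ unfolding A_def by auto
        hence "\<bar>\<Sum>l=\<kappa> n (t j)..<k. \<xi> n l \<omega>\<bar> < \<epsilon>1" using wM k1 unfolding A1_def by (auto simp: not_le)
        hence d1: "\<bar>S n k \<omega> - S n (\<kappa> n (t j)) \<omega>\<bar> < \<epsilon>1" using S_diff[OF wM k1(1), of n] by simp
        have "\<omega> \<notin> A2" using w unfolding A_def by auto
        hence "\<bar>\<Sum>l=0..<k. \<xi> n l \<omega>\<bar> < \<Lambda>" using wM k2 unfolding A2_def by (auto simp: not_le)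
        hence "\<bar>S n k \<omega> - S n 0 \<omega>\<bar> < \<Lambda>" using S_diff[OF wM le0, of n k] by simp
        hence d2: "\<bar>S n k \<omega>\<bar> \<le> \<Lambda> + 1" using S_0[OF wM, of n] elim(3) by linarith
        \<comment> \<open>The deviation is S times the weight times A k / A n, and
          \<open>weight\<close> says that the last two nearly cancel.\<close>
        have "real n powr (\<gamma>/2) * wt s * D k \<omega> = wt s * ss.A k / ss.A n * S n k \<omega>"
          unfolding S_def ss.G_def using ss.A_pos[of n] ss.A_pos[of k] by simp
        hence "real n powr (\<gamma>/2) * wt s * D k \<omega> - S n k \<omega> = (wt s * ss.A k / ss.A n - 1) * S n k \<omega>"
          by (simp add: left_diff_distrib)
        hence "\<bar>real n powr (\<gamma>/2) * wt s * D k \<omega> - S n k \<omega>\<bar> = \<bar>wt s * ss.A k / ss.A n - 1\<bar> * \<bar>S n k \<omega>\<bar>"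
          by (simp only: abs_mult)
        also have "\<dots> \<le> \<epsilon>2 * (\<Lambda> + 1)" using elim(5) s d2 e2(1) unfolding k_def by (intro mult_mono) auto
        finally have "\<bar>real n powr (\<gamma>/2) * wt s * D k \<omega> - S n k \<omega>\<bar> \<le> \<epsilon> / 2" unfolding e2(2) .
        thus ?thesis using d1 \<epsilon> unfolding tj k_def[symmetric] \<epsilon>1_def by linarith
      qed
      thus ?case using Am pA by blast
    qed
  qed
qed

theorem fluctuation_limit:
  assumes W: "brownian_motion P W"
  shows "sk_conv_dist M (\<lambda>n \<omega> t. real n powr (\<gamma>/2) * wt t * D (\<kappa> n t) \<omega>) P (\<lambda>\<omega> t. W (s2 * b2 t) \<omega>)"
proof (rule sk_conv_dist_criterion[where X'="\<lambda>n t \<omega>. S n (\<kappa> n t) \<omega>"])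
  show "prob_space M" by unfold_locales
  show "prob_space P" using W unfolding brownian_motion_def by blast
  have nn: "0 \<le> s2 * b2 t" for t using s2_range b2_nonneg by simp
  have Dm: "D k \<in> borel_measurable M" for k
    using bfun_subalgebra[OF subalgebra_F bfun_D[OF order_refl, of k]] by (simp add: bfun_def)
  show "(\<lambda>\<omega>. f (\<lambda>t. real n powr (\<gamma>/2) * wt t * D (\<kappa> n t) \<omega>)) \<in> borel_measurable M" if "sk_test f" "n \<ge> 1" for f n
    unfolding \<kappa>_def by (rule sk_test_step_path_measurable[OF that(1) _ wt_cont Dm]) (use that(2) in simp)
  show "cadlag (\<lambda>t. real n powr (\<gamma>/2) * wt t * D (\<kappa> n t) \<omega>)" if "n \<ge> 1" for n \<omega>
    unfolding \<kappa>_def using cadlag_step_path[OF _ wt_cont, of "real n powr \<gamma>" "real n powr (\<gamma>/2)" "\<lambda>k. D k \<omega>" "real n"] that by simp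
  show "(\<lambda>\<omega>. S n (\<kappa> n t) \<omega>) \<in> borel_measurable M" for n t
    using bfun_subalgebra[OF subalgebra_F bfun_S[OF order_refl]] by (simp add: bfun_def)
  show "(\<lambda>\<omega>. W (s2 * b2 t) \<omega>) \<in> borel_measurable P" for t
    using W nn[of t] unfolding brownian_motion_def by blast
  show "continuous_on {0..} (\<lambda>t. W (s2 * b2 t) \<omega>)" if "\<omega> \<in> space P" for \<omega>
  proof (rule continuous_on_compose2[where t="{0..}" and f="\<lambda>t. s2 * b2 t" and g="\<lambda>t. W t \<omega>"])
    show "continuous_on {0..} (\<lambda>t. W t \<omega>)" using W that unfolding brownian_motion_def by blast
    show "continuous_on {0..} (\<lambda>t. s2 * b2 t)" by (intro continuous_intros b2_cont)
    show "(\<lambda>t. s2 * b2 t) ` {0..} \<subseteq> {0..}" using nn by auto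
  qed
  show "(\<lambda>n. expectation (\<lambda>\<omega>. h (\<lambda>j. S n (\<kappa> n (real j / real K)) \<omega>)))
      \<longlonglongrightarrow> (\<integral>\<omega>. h (\<lambda>j. W (s2 * b2 (real j / real K)) \<omega>) \<partial>P)" if "blip J h" for K J h
    by (rule fdd[OF W that])
qed (rule oscillation)

end

section \<open>Specialisation to the two regimes\<close>

lemma sk_conv_dist_cong:
  assumes "sk_conv_dist M X P Y" and "\<And>n \<omega>. \<omega> \<in> space M \<Longrightarrow> X n \<omega> = X' n \<omega>" and "\<And>\<omega>. \<omega> \<in> space P \<Longrightarrow> Y \<omega> = Y' \<omega>"
  shows "sk_conv_dist M X' P Y'"
  unfolding sk_conv_dist_def
proof (intro allI impI)
  fix f assume "sk_test f"
  hence "(\<lambda>n. \<integral>\<omega>. f (X n \<omega>) \<partial>M) \<longlonglongrightarrow> (\<integral>\<omega>. f (Y \<omega>) \<partial>P)" using assms(1) unfolding sk_conv_dist_def by blast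
  moreover have "(\<integral>\<omega>. f (X n \<omega>) \<partial>M) = (\<integral>\<omega>. f (X' n \<omega>) \<partial>M)" for n
    by (rule Bochner_Integration.integral_cong) (simp_all add: assms(2))
  moreover have "(\<integral>\<omega>. f (Y \<omega>) \<partial>P) = (\<integral>\<omega>. f (Y' \<omega>) \<partial>P)"
    by (rule Bochner_Integration.integral_cong) (simp_all add: assms(3))
  ultimately show "(\<lambda>n. \<integral>\<omega>. f (X' n \<omega>) \<partial>M) \<longlonglongrightarrow> (\<integral>\<omega>. f (Y' \<omega>) \<partial>P)" by simp
qed

context reinforcement
begin

lemma beta_range: "0 < 1 - \<rho> * (1 - \<alpha>)" "1 - \<rho> * (1 - \<alpha>) \<le> 1"
proof -
  have "\<rho> * (1 - \<alpha>) \<le> \<rho> * 1" using rho alpha by (intro mult_left_mono) auto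
  thus "0 < 1 - \<rho> * (1 - \<alpha>)" using rho by simp
  show "1 - \<rho> * (1 - \<alpha>) \<le> 1" using rho alpha by simp
qed

lemma subcritical_limit:
  assumes g: "0 < \<gamma>" "\<gamma> < 1" and c: "c > 0" and rl: "(\<lambda>n. real n powr \<gamma> * r n) \<longlonglongrightarrow> c" and W: "brownian_motion P W"
  shows "sk_conv_dist M
     (\<lambda>n \<omega> t. real n powr (\<gamma>/2) * exp (c * (1 - \<rho> * (1 - \<alpha>)) * t) * D (nat \<lfloor>real n + real n powr \<gamma> * t\<rfloor>) \<omega>) P
     (\<lambda>\<omega> t. W ((1 - 1 / real N) * (c * \<rho>^2 * q * (1 - q)) / (2 * (1 - \<rho> * (1 - \<alpha>))) * exp (2 * c * (1 - \<rho> * (1 - \<alpha>)) * t)) \<omega>)"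
proof -
  define \<beta> where "\<beta> = 1 - \<rho> * (1 - \<alpha>)"
  have b: "0 < \<beta>" "\<beta> \<le> 1" using beta_range unfolding \<beta>_def by auto
  interpret ss: step_sizes r c \<gamma> \<beta> "c * \<beta>"
    using r g c rl b ulim_subcritical[OF g rl, of \<beta>] by unfold_locales auto
  define \<kappa> where "\<kappa> = (\<lambda>n t. nat \<lfloor>real n + real n powr \<gamma> * t\<rfloor>)"
  define H where "H = (\<lambda>n. real n powr (1-\<gamma>) / (1-\<gamma>))"
  have wt: "\<forall>\<^sub>F n in sequentially. \<forall>t\<in>{0..T}. \<bar>exp (c * \<beta> * t) * ss.A (\<kappa> n t) / ss.A n - 1\<bar> \<le> \<epsilon>" if e: "\<epsilon> > 0" for T \<epsilon>
  proof -
    \<comment> \<open>T is arbitrary here, while \<open>time_scale_subcritical\<close> asks for a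
      positive horizon.\<close>
    have "\<forall>\<^sub>F n in sequentially. \<forall>t\<in>{0..max T 1}. \<bar>exp (c * \<beta> * t) * ss.A (\<kappa> n t) / ss.A n - 1\<bar> \<le> \<epsilon>"
    proof (rule ss.A_weight_uniform[where H=H and \<psi>="\<lambda>t. t" and D="max T 1", OF _ _ _ _ _ e])
      show "H n < H (Suc n)" for n unfolding H_def using g by (intro divide_strict_right_mono powr_less_mono2) auto
      show "(\<lambda>n. real n powr \<gamma> * (H (Suc n) - H n)) \<longlonglongrightarrow> 1" unfolding H_def using g by real_asymp
      show "n \<le> \<kappa> n t" if "t \<ge> 0" for n t unfolding \<kappa>_def using that by (intro le_nat_floor) simp
      show "\<bar>t\<bar> \<le> max T 1" if "t \<in> {0..max T 1}" for t using that by simp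
      show "\<forall>\<^sub>F n in sequentially. \<forall>t\<in>{0..max T 1}. \<bar>H (\<kappa> n t) - H n - t\<bar> \<le> \<epsilon>'" if "\<epsilon>' > 0" for \<epsilon>'
        unfolding H_def \<kappa>_def by (rule time_scale_subcritical[OF g _ that]) simp
    qed
    thus ?thesis by eventually_elim auto
  qed
  have ratio: "(\<lambda>n. ss.G n / ss.G (\<kappa> n t)) \<longlonglongrightarrow> exp (c * \<beta> * t)" if t: "t \<ge> 0" for t
  proof -
    have "(\<lambda>n. (real n + real n powr \<gamma> * t) / real n) \<longlonglongrightarrow> 1" using g by real_asymp
    from ss.floor_ratio_tendsto[OF t this] have "(\<lambda>n. real n / real (\<kappa> n t)) \<longlonglongrightarrow> 1" unfolding \<kappa>_def by simp
    from ss.G_ratio_tendsto[where wt="\<lambda>t. exp (c * \<beta> * t)" and k=\<kappa>, OF t wt _ this] show ?thesis by simp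
  qed
  interpret fl: fluctuation M Z I N \<rho> \<alpha> q r i c \<gamma> "c * \<beta>" \<kappa> "\<lambda>t. exp (c * \<beta> * t)" "\<lambda>t. exp (c * \<beta> * t)"
  proof (intro fluctuation.intro fluctuation_axioms.intro)
    show "reinforcement M Z I N \<rho> \<alpha> q r i" by unfold_locales
    show "step_sizes r c \<gamma> (1 - \<rho> * (1 - \<alpha>)) (c * \<beta>)" unfolding \<beta>_def[symmetric] by unfold_locales
  qed (use wt ratio in \<open>auto simp: \<kappa>_def \<beta>_def[symmetric] intro!: continuous_intros\<close>)
  \<comment> \<open>With \<theta> = c \<beta>, one factor c of c^2 / (2 \<theta>) cancels.\<close>
  have V: "s2 * fl.b2 t = (1 - 1 / real N) * (c * \<rho>^2 * q * (1 - q)) / (2 * \<beta>) * exp (2 * c * \<beta> * t)" for t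
  proof -
    have "(exp (c * \<beta> * t))\<^sup>2 = exp (2 * c * \<beta> * t)" by (simp add: power2_eq_square mult_exp_exp)
    moreover have "c\<^sup>2 / (2 * (c * \<beta>)) = c / (2 * \<beta>)" using c b by (simp add: power2_eq_square)
    ultimately show ?thesis unfolding s2_def fl.b2_def by (simp add: algebra_simps)
  qed
  show ?thesis
    unfolding \<beta>_def[symmetric] by (rule sk_conv_dist_cong[OF fl.fluctuation_limit[OF W]]) (simp_all add: V \<kappa>_def)
qed

lemma critical_limit:
  assumes c: "c > 0" and rl: "(\<lambda>n. real n powr 1 * r n) \<longlonglongrightarrow> c" and cb: "2 * c * (1 - \<rho> * (1 - \<alpha>)) > 1" and W: "brownian_motion P W"
  shows "sk_conv_dist M
     (\<lambda>n \<omega> t. real n powr (1/2) * (1 + t) powr (c * (1 - \<rho> * (1 - \<alpha>))) * D (nat \<lfloor>real n + real n powr 1 * t\<rfloor>) \<omega>) P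
     (\<lambda>\<omega> t. W ((1 - 1 / real N) * (c^2 * \<rho>^2 * q * (1 - q)) / (2 * c * (1 - \<rho> * (1 - \<alpha>)) - 1)
                       * (1 + t) powr (2 * c * (1 - \<rho> * (1 - \<alpha>)) - 1)) \<omega>)"
proof -
  define \<beta> where "\<beta> = 1 - \<rho> * (1 - \<alpha>)"
  have b: "0 < \<beta>" "\<beta> \<le> 1" using beta_range unfolding \<beta>_def by auto
  have th: "c * \<beta> - 1/2 > 0" using cb unfolding \<beta>_def by simp
  interpret ss: step_sizes r c 1 \<beta> "c * \<beta> - 1/2"
    using r c rl b th ulim_critical[OF rl, of \<beta>] by unfold_locales auto
  define \<kappa> where "\<kappa> = (\<lambda>n t. nat \<lfloor>real n + real n powr 1 * t\<rfloor>)"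
  define H where "H = (\<lambda>n. ln (real n))"
  have wt: "\<forall>\<^sub>F n in sequentially. \<forall>t\<in>{0..T}. \<bar>(1 + t) powr (c * \<beta>) * ss.A (\<kappa> n t) / ss.A n - 1\<bar> \<le> \<epsilon>" if e: "\<epsilon> > 0" for T \<epsilon>
  proof -
    have "\<forall>\<^sub>F n in sequentially. \<forall>t\<in>{0..T}. \<bar>exp (c * \<beta> * ln (1 + t)) * ss.A (\<kappa> n t) / ss.A n - 1\<bar> \<le> \<epsilon>"
    proof (rule ss.A_weight_uniform[where H=H and \<psi>="\<lambda>t. ln (1 + t)" and D="T", OF _ _ _ _ _ e])
      show "H n < H (Suc n)" if "n \<ge> 1" for n unfolding H_def using that by simp
      show "(\<lambda>n. real n powr 1 * (H (Suc n) - H n)) \<longlonglongrightarrow> 1" unfolding H_def by real_asymp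
      show "n \<le> \<kappa> n t" if "t \<ge> 0" for n t unfolding \<kappa>_def using that by (intro le_nat_floor) simp
      show "\<bar>ln (1 + t)\<bar> \<le> T" if "t \<in> {0..T}" for t using that ln_add_one_self_le_self[of t] by simp
      show "\<forall>\<^sub>F n in sequentially. \<forall>t\<in>{0..T}. \<bar>H (\<kappa> n t) - H n - ln (1 + t)\<bar> \<le> \<epsilon>'" if "\<epsilon>' > 0" for \<epsilon>'
        unfolding H_def \<kappa>_def by (rule time_scale_critical[OF that])
    qed
    moreover have "(1 + t) powr (c * \<beta>) = exp (c * \<beta> * ln (1 + t))" if "t \<in> {0..T}" for t using that by (simp add: powr_def)
    ultimately show ?thesis by simp
  qed
  have ratio: "(\<lambda>n. ss.G n / ss.G (\<kappa> n t)) \<longlonglongrightarrow> (1 + t) powr (c * \<beta> - 1/2)" if t: "t \<ge> 0" for t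
  proof -
    have "(\<lambda>n. (real n + real n powr 1 * t) / real n) \<longlonglongrightarrow> 1 + t" by real_asymp
    from ss.floor_ratio_tendsto[OF t this] t have k: "(\<lambda>n. real n / real (\<kappa> n t)) \<longlonglongrightarrow> 1 / (1 + t)" unfolding \<kappa>_def by simp
    \<comment> \<open>The power of n inside G contributes (1 + t)^(-1/2) and lowers the exponent
      from c \<beta> to \<theta> = c \<beta> - 1/2.\<close>
    have "(1 / (1 + t)) powr (1/2) * (1 + t) powr (c * \<beta>) = (1 + t) powr (c * \<beta> - 1/2)"
      using t by (simp add: powr_divide powr_diff)
    with ss.G_ratio_tendsto[where wt="\<lambda>t. (1 + t) powr (c * \<beta>)" and k=\<kappa>, OF t wt _ k] t show ?thesis by simp
  qed
  interpret fl: fluctuation M Z I N \<rho> \<alpha> q r i c 1 "c * \<beta> - 1/2" \<kappa> "\<lambda>t. (1 + t) powr (c * \<beta>)" "\<lambda>t. (1 + t) powr (c * \<beta> - 1/2)"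
  proof (intro fluctuation.intro fluctuation_axioms.intro)
    show "reinforcement M Z I N \<rho> \<alpha> q r i" by unfold_locales
    show "step_sizes r c 1 (1 - \<rho> * (1 - \<alpha>)) (c * \<beta> - 1/2)" unfolding \<beta>_def[symmetric] by unfold_locales
  qed (use wt ratio in \<open>auto simp: \<kappa>_def \<beta>_def[symmetric] intro!: continuous_intros\<close>)
  \<comment> \<open>2 \<theta> = 2 c \<beta> - 1 appears twice: as the denominator of c^2 / (2
    \<theta>), and as the exponent of the squared ratio limit.\<close>
  have V: "s2 * fl.b2 t = (1 - 1 / real N) * (c^2 * \<rho>^2 * q * (1 - q)) / (2 * c * \<beta> - 1) * (1 + t) powr (2 * c * \<beta> - 1)" for t
  proof -
    have "((1 + t) powr (c * \<beta> - 1/2))\<^sup>2 = (1 + t) powr (2 * c * \<beta> - 1)"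
      by (simp add: powr_def power2_eq_square mult_exp_exp algebra_simps)
    moreover have "2 * (c * \<beta> - 1/2) = 2 * c * \<beta> - 1" by simp
    ultimately show ?thesis unfolding s2_def fl.b2_def by (simp add: algebra_simps)
  qed
  show ?thesis
    unfolding \<beta>_def[symmetric] by (rule sk_conv_dist_cong[OF fl.fluctuation_limit[OF W]]) (simp_all add: V \<kappa>_def)
qed

end

theorem theorem2p9:
  fixes M :: "'a measure" and Z I :: "nat \<Rightarrow> nat \<Rightarrow> 'a \<Rightarrow> real"
    and N :: nat and \<rho> \<alpha> q c \<gamma> :: real and r :: "nat \<Rightarrow> real" and i :: nat
  assumes N: "N \<ge> 1"
    and rho: "0 \<le> \<rho>" "\<rho> < 1" and alpha: "0 \<le> \<alpha>" "\<alpha> \<le> 1" and q: "0 < q" "q < 1"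
    and r: "\<And>n. 0 \<le> r n \<and> r n < 1"
    and gamma: "1/2 < \<gamma>" "\<gamma> \<le> 1" and c: "c > 0"
    and rlim: "(\<lambda>n. real n powr \<gamma> * r n) \<longlonglongrightarrow> c"
    and M: "prob_space M"
    and Zmeas: "\<And>n j. j \<in> {1..N} \<Longrightarrow> Z n j \<in> borel_measurable M"
    and Zrange: "\<And>n j \<omega>. j \<in> {1..N} \<Longrightarrow> \<omega> \<in> space M \<Longrightarrow> 0 \<le> Z n j \<omega> \<and> Z n j \<omega> \<le> 1"
    and Imeas: "\<And>n j. j \<in> {1..N} \<Longrightarrow> I (Suc n) j \<in> borel_measurable M"
    and Irange: "\<And>n j \<omega>. j \<in> {1..N} \<Longrightarrow> \<omega> \<in> space M \<Longrightarrow> I (Suc n) j \<omega> \<in> {0, 1}"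
    and recur: "\<And>n j \<omega>. j \<in> {1..N} \<Longrightarrow> \<omega> \<in> space M \<Longrightarrow>
        Z (Suc n) j \<omega> = (1 - r n) * Z n j \<omega> + r n * (\<rho> * I (Suc n) j \<omega> + (1 - \<rho>) * q)"
    and condindep: "\<And>n S (a :: nat \<Rightarrow> real). S \<subseteq> {1..N} \<Longrightarrow>
        AE \<omega> in M. real_cond_exp M (Filt M N Z n)
            (\<lambda>\<omega>. \<Prod>j\<in>S. indicator {\<omega>. I (Suc n) j \<omega> = a j} \<omega>) \<omega>
          = (\<Prod>j\<in>S. real_cond_exp M (Filt M N Z n) (indicator {\<omega>. I (Suc n) j \<omega> = a j}) \<omega>)"
    and condprob: "\<And>n j. j \<in> {1..N} \<Longrightarrow>
        AE \<omega> in M. real_cond_exp M (Filt M N Z n) (indicator {\<omega>. I (Suc n) j \<omega> = 1}) \<omega>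
          = (1 - \<alpha>) * Z n j \<omega> + \<alpha> * Zbar N Z n \<omega>"
    and exch: "\<And>\<sigma>. \<sigma> permutes {1..N} \<Longrightarrow>
        distr M (PiM {1..N} (\<lambda>_. borel)) (\<lambda>\<omega>. \<lambda>j\<in>{1..N}. Z 0 (\<sigma> j) \<omega>)
          = distr M (PiM {1..N} (\<lambda>_. borel)) (\<lambda>\<omega>. \<lambda>j\<in>{1..N}. Z 0 j \<omega>)"
    and mean: "\<And>j. j \<in> {1..N} \<Longrightarrow> (\<integral>\<omega>. Z 0 j \<omega> \<partial>M) = 1/2"
    and var: "(\<integral>\<omega>. Zbar N Z 0 \<omega> * (1 - Zbar N Z 0 \<omega>) \<partial>M) > 0"
    and i: "i \<in> {1..N}"
  shows
   "(\<gamma> < 1 \<longrightarrow>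
      (\<forall>(P :: 'b measure) W. brownian_motion P W \<longrightarrow>
        sk_conv_dist M
          (\<lambda>n \<omega> t. real n powr (\<gamma>/2) * exp (c * (1 - \<rho> * (1 - \<alpha>)) * t) *
             (Z (nat \<lfloor>real n + real n powr \<gamma> * t\<rfloor>) i \<omega> - Zbar N Z (nat \<lfloor>real n + real n powr \<gamma> * t\<rfloor>) \<omega>))
          P
          (\<lambda>\<omega> t. W ((1 - 1 / real N) * (c * \<rho>^2 * q * (1 - q)) / (2 * (1 - \<rho> * (1 - \<alpha>)))
                       * exp (2 * c * (1 - \<rho> * (1 - \<alpha>)) * t)) \<omega>)))
    \<and>
    (\<gamma> = 1 \<and> 2 * c * (1 - \<rho> * (1 - \<alpha>)) > 1 \<longrightarrow>
      (\<forall>(P :: 'b measure) W. brownian_motion P W \<longrightarrow>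
        sk_conv_dist M
          (\<lambda>n \<omega> t. sqrt (real n) * (1 + t) powr (c * (1 - \<rho> * (1 - \<alpha>))) *
             (Z (nat \<lfloor>real n + real n * t\<rfloor>) i \<omega> - Zbar N Z (nat \<lfloor>real n + real n * t\<rfloor>) \<omega>))
          P
          (\<lambda>\<omega> t. W ((1 - 1 / real N) * (c^2 * \<rho>^2 * q * (1 - q)) / (2 * c * (1 - \<rho> * (1 - \<alpha>)) - 1)
                       * (1 + t) powr (2 * c * (1 - \<rho> * (1 - \<alpha>)) - 1)) \<omega>)))"
proof -
  interpret prob_space M by (rule M)
  interpret reinforcement M Z I N \<rho> \<alpha> q r i
    using assms by unfold_locales auto
  show ?thesis
  proof (intro conjI impI allI)
    fix P :: "'b measure" and W assume "\<gamma> < 1" "brownian_motion P W"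
    with subcritical_limit[of \<gamma> c P W] gamma c rlim
    show "sk_conv_dist M
          (\<lambda>n \<omega> t. real n powr (\<gamma>/2) * exp (c * (1 - \<rho> * (1 - \<alpha>)) * t) *
             (Z (nat \<lfloor>real n + real n powr \<gamma> * t\<rfloor>) i \<omega> - Zbar N Z (nat \<lfloor>real n + real n powr \<gamma> * t\<rfloor>) \<omega>))
          P
          (\<lambda>\<omega> t. W ((1 - 1 / real N) * (c * \<rho>^2 * q * (1 - q)) / (2 * (1 - \<rho> * (1 - \<alpha>)))
                       * exp (2 * c * (1 - \<rho> * (1 - \<alpha>)) * t)) \<omega>)"
      unfolding D_def by simp
  next
    fix P :: "'b measure" and W assume "\<gamma> = 1 \<and> 2 * c * (1 - \<rho> * (1 - \<alpha>)) > 1" "brownian_motion P W"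
    with critical_limit[of c P W] c rlim
    have "sk_conv_dist M
     (\<lambda>n \<omega> t. real n powr (1/2) * (1 + t) powr (c * (1 - \<rho> * (1 - \<alpha>))) * D (nat \<lfloor>real n + real n powr 1 * t\<rfloor>) \<omega>) P
     (\<lambda>\<omega> t. W ((1 - 1 / real N) * (c^2 * \<rho>^2 * q * (1 - q)) / (2 * c * (1 - \<rho> * (1 - \<alpha>)) - 1)
                       * (1 + t) powr (2 * c * (1 - \<rho> * (1 - \<alpha>)) - 1)) \<omega>)" by blast
    thus "sk_conv_dist M
          (\<lambda>n \<omega> t. sqrt (real n) * (1 + t) powr (c * (1 - \<rho> * (1 - \<alpha>))) *
             (Z (nat \<lfloor>real n + real n * t\<rfloor>) i \<omega> - Zbar N Z (nat \<lfloor>real n + real n * t\<rfloor>) \<omega>))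
          P
          (\<lambda>\<omega> t. W ((1 - 1 / real N) * (c^2 * \<rho>^2 * q * (1 - q)) / (2 * c * (1 - \<rho> * (1 - \<alpha>)) - 1)
                       * (1 + t) powr (2 * c * (1 - \<rho> * (1 - \<alpha>)) - 1)) \<omega>)"
      unfolding D_def by (simp add: powr_half_sqrt)
  qed
qed

end
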